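(* Let $\Omega\subset\mathbb{R}^N$, $N>1$, be a bounded domain with Lipschitz boundary $\partial\Omega$, let $1<p,q<\infty$, and let $\mathcal A_i\colon \Omega\times\mathbb{R}\times\mathbb{R}^N\to\mathbb{R}^N$ and $\mathcal B_i\colon\Omega\times\mathbb{R}\times\mathbb{R}\times\mathbb{R}^N\times\mathbb{R}^N\to\mathbb{R}$, $i=1,2$, be Carathéodory functions such that, for a.e. $x\in\Omega$, for all $s,t\in\mathbb{R}$ and all $\xi,\zeta\in\mathbb{R}^N$, \begin{align*} |\mathcal A_1(x,s,\xi)| &\le A_1|\xi|^{p-1}+A_2|s|^{r_1\frac{p-1}{p}}+A_3,\\ |\mathcal A_2(x,t,\zeta)| &\le \tilde A_1|\zeta|^{q-1}+\tilde A_2|t|^{r_2\frac{q-1}{q}}+\tilde A_3,\\ \mathcal A_1(x,s,\xi)\cdot\xi &\ge A_4|\xi|^p-A_5|s|^{r_1}-A_6,\\ \mathcal A_2(x,t,\zeta)\cdot\zeta &\ge \tilde A_4|\zeta|^q-\tilde A_5|t|^{r_2}-\tilde A_6,\\ |\mathcal B_1(x,s,t,\xi,\zeta)| &\le B_1|s|^{b_1}+B_2|t|^{b_2}+B_3|s|^{b_3}|t|^{b_4}+B_4|\xi|^{b_5}+B_5|\zeta|^{b_6}+B_6|\xi|^{b_7}|\zeta|^{b_8}+B_7,\\ |\mathcal B_2(x,s,t,\xi,\zeta)| &\le \tilde B_1|s|^{\tilde b_1}+\tilde B_2|t|^{\tilde b_2}+\tilde B_3|s|^{\tilde b_3}|t|^{\tilde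 b_4}+\tilde B_4|\xi|^{\tilde b_5}+\tilde B_5|\zeta|^{\tilde b_6}+\tilde B_6|\xi|^{\tilde b_7}|\zeta|^{\tilde b_8}+\tilde B_7, \end{align*} with nonnegative constants $A_i,\tilde A_i,B_j,\tilde B_j$ ($i\in\{1,\dots,6\}$, $j\in\{1,\dots,7\}$) and with nonnegative exponents $b_i,\tilde b_i,r_1,r_2$ ($i\in\{1,\dots,8\}$) satisfying \begin{align*} & r_1\le p^*,\qquad r_2\le q^*,\\ & b_1\le p^*-1,\qquad b_2<\tfrac{q^*}{p^*}(p^*-p),\qquad \tfrac{b_3}{p^*}+\tfrac{b_4}{q^*}<\tfrac{p^*-p}{p^*},\\ & b_5\le p-1,\qquad b_6<\tfrac{q}{p^*}(p^*-p),\qquad \tfrac{b_7}{p}+\tfrac{b_8}{q}<\tfrac{p^*-p}{p^*},\\ & \tilde b_1<\tfrac{p^*}{q^*}(q^*-q),\qquad \tilde b_2\le q^*-1,\qquad \tfrac{\tilde b_3}{p^*}+\tfrac{\tilde b_4}{q^*}<\tfrac{q^*-q}{q^*},\\ & \tilde b_5<\tfrac{p}{q^*}(q^*-q),\qquad \tilde b_6\le q-1,\qquad \tfrac{\tilde b_7}{p}+\tfrac{\tilde b_8}{q}<\tfrac{q^*-q}{q^*}. \end{align*} Then every weak solution $(u,v)\in W^{1,p}_0(\Omega)\times W^{1,q}_0(\Omega)$ of the system \begin{align*} -\operatorname{div}\mathcal A_1(x,u,\nabla u)&=\mathcal B_1(x,u,v,\nabla u,\nabla v)&&\text{in }\Omega,\\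 -\operatorname{div}\mathcal A_2(x,v,\nabla v)&=\mathcal B_2(x,u,v,\nabla u,\nabla v)&&\text{in }\Omega,\\ u=v&=0&&\text{on }\partial\Omega \end{align*} belongs to $L^\infty(\overline\Omega)\times L^\infty(\overline\Omega)$.
   Context: For $1<r<\infty$ the critical exponent is $$r^*=\begin{cases}\frac{Nr}{N-r}&\text{if } r<N,\\ \text{any } m\in(1,\infty)&\text{if } r\ge N,\end{cases}$$ and $p^*,q^*$ are this with $r=p$ and $r=q$. A pair $(u,v)\in W^{1,p}_0(\Omega)\times W^{1,q}_0(\Omega)$ is a weak solution of the system if \begin{align*} \int_\Omega \mathcal A_1(x,u,\nabla u)\cdot\nabla\varphi\,dx&=\int_\Omega\mathcal B_1(x,u,v,\nabla u,\nabla v)\varphi\,dx,\\ \int_\Omega \mathcal A_2(x,v,\nabla v)\cdot\nabla\psi\,dx&=\int_\Omega\mathcal B_2(x,u,v,\nabla u,\nabla v)\psi\,dx \end{align*} hold for all $(\varphi,\psi)\in W^{1,p}_0(\Omega)\times W^{1,q}_0(\Omega)$. $L^\infty(\overline\Omega):=L^\infty(\Omega)\cap L^\infty(\partial\Omega)$, where $L^\infty(\partial\Omega)$ is taken with respect to the $(N-1)$-dimensional Hausdorff (surface) measure and values on $\partial\Omega$ are understood in the sense of traces.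
   Formalization: The coercivity constants A_4 and Ã_4 are taken to be strictly positive rather than merely nonnegative; with A_4 = 0 the choice 𝒜_i = 0, ℬ_i = 0 makes every u in W^{1,p}_0, including unbounded ones when p ≤ N, a weak solution. *)

theory Defs
  imports "HOL-Analysis.Analysis"
begin

section \<open>Real powers\<close>

text \<open>The library has \<^term>\<open>(0::real) powr 0 = 0\<close>.  In a growth condition a factor with exponent
  \<open>0\<close> is the constant \<open>1\<close>, also where the base vanishes.\<close>

definition rpow :: "real \<Rightarrow> real \<Rightarrow> real" where
  "rpow x a = (if a = 0 then 1 else x powr a)"

section \<open>Lipschitz domains and smooth functions\<close>

text \<open>Near every boundary point, \<open>\<Omega>\<close> is the strict epigraph of a Lipschitz function over
  a hyperplane; the unit vector \<open>e\<close> is the direction of the vertical axis of the local coordinate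
  system and \<^term>\<open>x - (x \<bullet> e) *\<^sub>R e\<close> is the projection of \<open>x\<close> onto the hyperplane.\<close>

definition lipschitz_boundary :: "(real^'n) set \<Rightarrow> bool" where
  "lipschitz_boundary \<Omega> \<longleftrightarrow>
     (\<forall>x0\<in>frontier \<Omega>. \<exists>r>0. \<exists>e \<gamma> L. norm e = 1 \<and> L-lipschitz_on {y. y \<bullet> e = 0} (\<gamma> :: real^'n \<Rightarrow> real) \<and>
        \<Omega> \<inter> ball x0 r = {x \<in> ball x0 r. \<gamma> (x - (x \<bullet> e) *\<^sub>R e) < x \<bullet> e})"

definition partial_deriv :: "'n \<Rightarrow> (real^'n \<Rightarrow> real) \<Rightarrow> real^'n \<Rightarrow> real" where
  "partial_deriv i f x = frechet_derivative f (at x) (axis i 1)"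

primrec C_diff :: "nat \<Rightarrow> (real^'n \<Rightarrow> real) \<Rightarrow> bool" where
  "C_diff 0 f \<longleftrightarrow> continuous_on UNIV f"
| "C_diff (Suc k) f \<longleftrightarrow> (\<forall>x. f differentiable (at x)) \<and> (\<forall>i. C_diff k (partial_deriv i f))"

definition smooth :: "(real^'n \<Rightarrow> real) \<Rightarrow> bool" where
  "smooth f \<longleftrightarrow> (\<forall>k. C_diff k f)"

definition test_functions :: "(real^'n) set \<Rightarrow> (real^'n \<Rightarrow> real) set" where
  "test_functions \<Omega> =
     {f. smooth f \<and> compact (closure {x. f x \<noteq> 0}) \<and> closure {x. f x \<noteq> 0} \<subseteq> \<Omega>}"

section \<open>Sobolev spaces\<close>

text \<open>Functions on \<open>\<Omega>\<close> are represented by total functions whose values outside \<open>\<Omega>\<close> are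
  irrelevant; elements of the spaces are representatives, not equivalence classes.\<close>

definition Lp :: "(real^'n) set \<Rightarrow> real \<Rightarrow> (real^'n \<Rightarrow> 'b::euclidean_space) set" where
  "Lp \<Omega> p = {f. f \<in> borel_measurable (lebesgue_on \<Omega>) \<and>
                integrable (lebesgue_on \<Omega>) (\<lambda>x. norm (f x) powr p)}"

definition locally_integrable :: "(real^'n) set \<Rightarrow> (real^'n \<Rightarrow> 'b::euclidean_space) \<Rightarrow> bool" where
  "locally_integrable \<Omega> f \<longleftrightarrow> (\<forall>K. compact K \<and> K \<subseteq> \<Omega> \<longrightarrow> integrable (lebesgue_on K) f)"

definition has_weak_gradient ::
    "(real^'n) set \<Rightarrow> (real^'n \<Rightarrow> real) \<Rightarrow> (real^'n \<Rightarrow> real^'n) \<Rightarrow> bool" where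
  "has_weak_gradient \<Omega> u g \<longleftrightarrow> locally_integrable \<Omega> u \<and> locally_integrable \<Omega> g \<and>
     (\<forall>\<phi>\<in>test_functions \<Omega>. \<forall>i.
        (LINT x|lebesgue_on \<Omega>. u x * partial_deriv i \<phi> x) = - (LINT x|lebesgue_on \<Omega>. (g x $ i) * \<phi> x))"

text \<open>Weak gradients on an open set are unique up to null sets, and everything below depends
  on the chosen one only up to null sets.\<close>

definition weak_gradient :: "(real^'n) set \<Rightarrow> (real^'n \<Rightarrow> real) \<Rightarrow> real^'n \<Rightarrow> real^'n" where
  "weak_gradient \<Omega> u = (SOME g. has_weak_gradient \<Omega> u g)"

definition sobolev :: "(real^'n) set \<Rightarrow> real \<Rightarrow> (real^'n \<Rightarrow> real) set" where
  "sobolev \<Omega> p = {u \<in> Lp \<Omega> p. \<exists>g\<in>Lp \<Omega> p. has_weak_gradient \<Omega> u g}"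

definition sobolev_norm :: "(real^'n) set \<Rightarrow> real \<Rightarrow> (real^'n \<Rightarrow> real) \<Rightarrow> real" where
  "sobolev_norm \<Omega> p u =
     ((LINT x|lebesgue_on \<Omega>. \<bar>u x\<bar> powr p) +
      (LINT x|lebesgue_on \<Omega>. norm (weak_gradient \<Omega> u x) powr p)) powr (1 / p)"

text \<open>The closure of the test functions in \<^term>\<open>sobolev \<Omega> p\<close>.\<close>

definition sobolev0 :: "(real^'n) set \<Rightarrow> real \<Rightarrow> (real^'n \<Rightarrow> real) set" where
  "sobolev0 \<Omega> p =
     {u \<in> sobolev \<Omega> p. \<forall>\<epsilon>>0. \<exists>\<phi>\<in>test_functions \<Omega>. sobolev_norm \<Omega> p (\<lambda>x. u x - \<phi> x) < \<epsilon>}"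

text \<open>\<open>m\<close> is an admissible value of the critical exponent \<open>r\<^sup>*\<close> in dimension \<open>N\<close>; for \<open>r \<ge> N\<close> any
  \<open>m\<close> in \<open>(1,\<infinity>)\<close> is.\<close>

definition critical_exponent :: "real \<Rightarrow> real \<Rightarrow> real \<Rightarrow> bool" where
  "critical_exponent N r m \<longleftrightarrow> (if r < N then m = N * r / (N - r) else 1 < m)"

section \<open>Hausdorff measure\<close>

text \<open>For \<open>d > 0\<close>.  The covering sets have to be required bounded, since \<^const>\<open>diameter\<close> is a
  real number and has no meaningful value on unbounded sets.\<close>

definition hausdorff_delta :: "nat \<Rightarrow> real \<Rightarrow> 'a::euclidean_space set \<Rightarrow> ennreal" where
  "hausdorff_delta d \<delta> A =
     (INF C \<in> {C :: nat \<Rightarrow> 'a set. A \<subseteq> (\<Union>i. C i) \<and> (\<forall>i. bounded (C i) \<and> diameter (C i) \<le> \<delta>)}.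
        (\<Sum>i. ennreal (unit_ball_vol (real d) * (diameter (C i) / 2) ^ d)))"

definition hausdorff_outer :: "nat \<Rightarrow> 'a::euclidean_space set \<Rightarrow> ennreal" where
  "hausdorff_outer d A = (SUP \<delta>\<in>{0<..}. hausdorff_delta d \<delta> A)"

definition hausdorff_measure :: "nat \<Rightarrow> 'a::euclidean_space measure" where
  "hausdorff_measure d =
     measure_of UNIV (lambda_system UNIV UNIV (hausdorff_outer d)) (hausdorff_outer d)"

text \<open>\<^const>\<open>measure_of\<close> yields the null measure when its last argument is not a measure on the
  given sets; this is not the case here.\<close>

lemma hausdorff_delta_mono: "A \<subseteq> B \<Longrightarrow> hausdorff_delta d \<delta> A \<le> hausdorff_delta d \<delta> B"
  unfolding hausdorff_delta_def by (intro INF_superset_mono) auto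

lemma hausdorff_delta_UN:
  fixes A :: "nat \<Rightarrow> 'a::euclidean_space set"
  shows "hausdorff_delta d \<delta> (\<Union>n. A n) \<le> (\<Sum>n. hausdorff_delta d \<delta> (A n))"
proof (cases "\<forall>n. hausdorff_delta d \<delta> (A n) < top")
  case False
  then obtain n where "hausdorff_delta d \<delta> (A n) = top"
    by (metis less_top)
  then have "(\<Sum>n. hausdorff_delta d \<delta> (A n)) = top"
    using ennreal_suminf_lessD[of "\<lambda>n. hausdorff_delta d \<delta> (A n)" top n] by (metis less_irrefl less_top)
  then show ?thesis by simp
next
  case True
  let ?w = "\<lambda>S::'a set. ennreal (unit_ball_vol (real d) * (diameter S / 2) ^ d)"
  show ?thesis
  proof (rule ennreal_le_epsilon)
    fix e :: real
    assume e: "0 < e"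
    have ex: "\<exists>C. (A n \<subseteq> (\<Union>i. C i) \<and> (\<forall>i. bounded (C i) \<and> diameter (C i) \<le> \<delta>)) \<and>
          (\<Sum>i. ?w (C i)) < hausdorff_delta d \<delta> (A n) + ennreal (e * (1/2)^Suc n)" for n
    proof -
      define y where "y = hausdorff_delta d \<delta> (A n) + ennreal (e * (1/2)^Suc n)"
      have "0 < ennreal (e * (1/2)^Suc n)" using e by simp
      then have "hausdorff_delta d \<delta> (A n) < y"
        using True[rule_format, of n] unfolding y_def by (simp add: ennreal_add_left_cancel_less)
      then have "\<exists>C\<in>{C. A n \<subseteq> (\<Union>i. C i) \<and> (\<forall>i. bounded (C i) \<and> diameter (C i) \<le> \<delta>)}. (\<Sum>i. ?w (C i)) < y"
        unfolding hausdorff_delta_def INF_less_iff .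
      then show ?thesis
        unfolding y_def by (simp only: Bex_def mem_Collect_eq)
    qed
    obtain C where C: "\<And>n. A n \<subseteq> (\<Union>i. C n i)"
        "\<And>n i. bounded (C n i)" "\<And>n i. diameter (C n i) \<le> \<delta>"
        "\<And>n. (\<Sum>i. ?w (C n i)) < hausdorff_delta d \<delta> (A n) + ennreal (e * (1/2)^Suc n)"
    proof -
      from choice[OF allI, OF ex] obtain C where "\<forall>n. (A n \<subseteq> (\<Union>i. C n i) \<and>
            (\<forall>i. bounded (C n i) \<and> diameter (C n i) \<le> \<delta>)) \<and>
          (\<Sum>i. ?w (C n i)) < hausdorff_delta d \<delta> (A n) + ennreal (e * (1/2)^Suc n)" ..
      then show thesis by (intro that[of C]) blast+
    qed
    define D where "D k = C (fst (prod_decode k)) (snd (prod_decode k))" for k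
    have "A n \<subseteq> (\<Union>k. D k)" for n
    proof
      fix x assume "x \<in> A n"
      then obtain i where "x \<in> C n i" using C(1) by blast
      then have "x \<in> D (prod_encode (n, i))" by (simp add: D_def)
      then show "x \<in> (\<Union>k. D k)" by blast
    qed
    then have "hausdorff_delta d \<delta> (\<Union>n. A n) \<le> (\<Sum>k. ?w (D k))"
      unfolding hausdorff_delta_def using C(2,3) by (intro INF_lower) (auto simp: D_def)
    also have "\<dots> = (\<Sum>n. \<Sum>i. ?w (C n i))"
      using suminf_ennreal_2dimen[of "\<lambda>n. \<Sum>i. ?w (C n i)" "\<lambda>z. ?w (C (fst z) (snd z))"]
      by (simp add: D_def)
    also have "\<dots> \<le> (\<Sum>n. hausdorff_delta d \<delta> (A n) + ennreal (e * (1/2)^Suc n))"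
      by (intro suminf_le less_imp_le C(4)) auto
    also have "\<dots> = (\<Sum>n. hausdorff_delta d \<delta> (A n)) + (\<Sum>n. ennreal (e * (1/2)^Suc n))"
      by (intro suminf_add[symmetric]) auto
    also have "(\<Sum>n. ennreal (e * (1/2)^Suc n)) = ennreal e"
      using e sums_mult[OF power_half_series, of e] by (intro suminf_ennreal_eq) auto
    finally show "hausdorff_delta d \<delta> (\<Union>n. A n) \<le> (\<Sum>n. hausdorff_delta d \<delta> (A n)) + ennreal e" .
  qed
qed

lemma hausdorff_outer_measure_space:
  assumes "0 < d"
  shows "outer_measure_space UNIV (hausdorff_outer d :: 'a::euclidean_space set \<Rightarrow> ennreal)"
proof -
  have "hausdorff_delta d \<delta> ({} :: 'a set) = 0" if "0 < \<delta>" for \<delta>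
  proof -
    have "hausdorff_delta d \<delta> ({} :: 'a set) \<le> (\<Sum>i::nat. ennreal (unit_ball_vol (real d) * (diameter ({} :: 'a set) / 2) ^ d))"
      unfolding hausdorff_delta_def using that by (intro INF_lower2[of "\<lambda>_. {}"]) auto
    then show ?thesis using assms by (simp add: zero_power)
  qed
  then have pos: "positive UNIV (hausdorff_outer d :: 'a set \<Rightarrow> ennreal)"
    by (auto simp: positive_def hausdorff_outer_def)
  have inc: "increasing UNIV (hausdorff_outer d :: 'a set \<Rightarrow> ennreal)"
    unfolding increasing_def hausdorff_outer_def by (auto intro!: SUP_mono hausdorff_delta_mono)
  have "hausdorff_outer d (\<Union>n. A n) \<le> (\<Sum>n. hausdorff_outer d (A n))" for A :: "nat \<Rightarrow> 'a set"
    unfolding hausdorff_outer_def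
  proof (rule SUP_least)
    fix \<delta> :: real assume "\<delta> \<in> {0<..}"
    then show "hausdorff_delta d \<delta> (\<Union>n. A n) \<le> (\<Sum>n. SUP \<delta>\<in>{0<..}. hausdorff_delta d \<delta> (A n))"
      by (intro order_trans[OF hausdorff_delta_UN] suminf_le SUP_upper) auto
  qed
  with pos inc show ?thesis
    by (simp add: outer_measure_space_def countably_subadditive_def)
qed

lemma emeasure_hausdorff_measure:
  assumes "0 < d" and "A \<in> lambda_system UNIV UNIV (hausdorff_outer d)"
  shows "emeasure (hausdorff_measure d) A = hausdorff_outer d A"
proof -
  interpret sigma_algebra UNIV "UNIV :: 'a set set"
    using sigma_algebra_Pow[of "UNIV :: 'a set"] by simp
  have "measure_space UNIV (lambda_system UNIV UNIV (hausdorff_outer d)) (hausdorff_outer d :: 'a set \<Rightarrow> ennreal)"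
    using caratheodory_lemma[OF hausdorff_outer_measure_space[OF assms(1)]] by simp
  with assms(2) show ?thesis
    unfolding hausdorff_measure_def measure_space_def
    by (intro emeasure_measure_of_sigma) auto
qed

section \<open>Traces and essential boundedness up to the boundary\<close>

definition surface_measure :: "(real^'n) set \<Rightarrow> (real^'n) measure" where
  "surface_measure \<Omega> = restrict_space (hausdorff_measure (CARD('n) - 1)) (frontier \<Omega>)"

text \<open>The trace operator on a bounded Lipschitz domain is the continuous extension of
  \<open>\<phi> \<mapsto> \<phi>|\<^bsub>\<partial>\<Omega>\<^esub>\<close>, from functions \<open>\<phi>\<close> smooth up to the boundary (which are dense) to an operator from
  \<^term>\<open>sobolev \<Omega> p\<close> to \<open>L\<^sup>p(\<partial>\<Omega>)\<close>.  Its graph is the closure of the graph of this restriction; so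
  a trace always exists and is unique up to null sets of the surface measure.\<close>

definition is_trace ::
    "(real^'n) set \<Rightarrow> real \<Rightarrow> (real^'n \<Rightarrow> real) \<Rightarrow> (real^'n \<Rightarrow> real) \<Rightarrow> bool" where
  "is_trace \<Omega> p u g \<longleftrightarrow> u \<in> sobolev \<Omega> p \<and> g \<in> borel_measurable (surface_measure \<Omega>) \<and>
     (\<forall>\<epsilon>>0. \<exists>\<phi>. smooth \<phi> \<and> sobolev_norm \<Omega> p (\<lambda>x. u x - \<phi> x) < \<epsilon> \<and>
        (\<integral>\<^sup>+x. ennreal (\<bar>g x - \<phi> x\<bar> powr p) \<partial>surface_measure \<Omega>) < ennreal \<epsilon>)"

definition Linfty :: "'a measure \<Rightarrow> ('a \<Rightarrow> real) set" where
  "Linfty M = {f \<in> borel_measurable M. \<exists>C. AE x in M. \<bar>f x\<bar> \<le> C}"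

text \<open>\<open>L\<^sup>\<infinity>(\<Omega>) \<inter> L\<^sup>\<infinity>(\<partial>\<Omega>)\<close> for functions in \<^term>\<open>sobolev \<Omega> p\<close>.\<close>

definition Linfty_closure :: "(real^'n) set \<Rightarrow> real \<Rightarrow> (real^'n \<Rightarrow> real) set" where
  "Linfty_closure \<Omega> p =
     {u \<in> Linfty (lebesgue_on \<Omega>). \<exists>g. is_trace \<Omega> p u g \<and> g \<in> Linfty (surface_measure \<Omega>)}"

section \<open>The elliptic system\<close>

definition caratheodory ::
    "(real^'n) set \<Rightarrow> (real^'n \<Rightarrow> 'b::topological_space \<Rightarrow> 'c::topological_space) \<Rightarrow> bool" where
  "caratheodory \<Omega> f \<longleftrightarrow> (\<forall>z. (\<lambda>x. f x z) \<in> borel_measurable (lebesgue_on \<Omega>)) \<and>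
     (AE x in lebesgue_on \<Omega>. continuous_on UNIV (f x))"

text \<open>A Bochner integral that does not exist has the value \<open>0\<close> in the library; that the
  integral identities hold includes that the integrals exist.\<close>

definition weak_solution ::
    "(real^'n) set \<Rightarrow> real \<Rightarrow> real
     \<Rightarrow> (real^'n \<Rightarrow> real \<Rightarrow> real^'n \<Rightarrow> real^'n)
     \<Rightarrow> (real^'n \<Rightarrow> real \<Rightarrow> real^'n \<Rightarrow> real^'n)
     \<Rightarrow> (real^'n \<Rightarrow> real \<Rightarrow> real \<Rightarrow> real^'n \<Rightarrow> real^'n \<Rightarrow> real)
     \<Rightarrow> (real^'n \<Rightarrow> real \<Rightarrow> real \<Rightarrow> real^'n \<Rightarrow> real^'n \<Rightarrow> real)
     \<Rightarrow> (real^'n \<Rightarrow> real) \<Rightarrow> (real^'n \<Rightarrow> real) \<Rightarrow> bool" where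
  "weak_solution \<Omega> p q \<A>\<^sub>1 \<A>\<^sub>2 \<B>\<^sub>1 \<B>\<^sub>2 u v \<longleftrightarrow>
     u \<in> sobolev0 \<Omega> p \<and> v \<in> sobolev0 \<Omega> q \<and>
     (let Du = weak_gradient \<Omega> u; Dv = weak_gradient \<Omega> v in
      \<forall>\<phi>\<in>sobolev0 \<Omega> p. \<forall>\<psi>\<in>sobolev0 \<Omega> q.
        integrable (lebesgue_on \<Omega>) (\<lambda>x. \<A>\<^sub>1 x (u x) (Du x) \<bullet> weak_gradient \<Omega> \<phi> x) \<and>
        integrable (lebesgue_on \<Omega>) (\<lambda>x. \<B>\<^sub>1 x (u x) (v x) (Du x) (Dv x) * \<phi> x) \<and>
        integrable (lebesgue_on \<Omega>) (\<lambda>x. \<A>\<^sub>2 x (v x) (Dv x) \<bullet> weak_gradient \<Omega> \<psi> x) \<and>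
        integrable (lebesgue_on \<Omega>) (\<lambda>x. \<B>\<^sub>2 x (u x) (v x) (Du x) (Dv x) * \<psi> x) \<and>
        (LINT x|lebesgue_on \<Omega>. \<A>\<^sub>1 x (u x) (Du x) \<bullet> weak_gradient \<Omega> \<phi> x) =
          (LINT x|lebesgue_on \<Omega>. \<B>\<^sub>1 x (u x) (v x) (Du x) (Dv x) * \<phi> x) \<and>
        (LINT x|lebesgue_on \<Omega>. \<A>\<^sub>2 x (v x) (Dv x) \<bullet> weak_gradient \<Omega> \<psi> x) =
          (LINT x|lebesgue_on \<Omega>. \<B>\<^sub>2 x (u x) (v x) (Du x) (Dv x) * \<psi> x))"

end

theory Submission
  imports Defs
begin

text \<open>The growth conditions decouple the system. Let \<open>H = 1 + |u|\<^sup>p\<^sup>* + |v|\<^sup>q\<^sup>* + |\<nabla>u|\<^sup>p + |\<nabla>v|\<^sup>q\<close>, which is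
integrable by the Sobolev embedding. Every term on the right-hand side of the first equation that
involves \<open>v\<close> or a product is at most a constant times \<open>H\<^sup>\<theta>\<close> for some \<open>\<theta> < 1 - p/p\<^sup>*\<close>: this is what the strict
inequalities between the exponents say. Hence \<open>u\<close> solves one equation with a right-hand side
bounded by \<open>C (|u|\<^sup>p\<^sup>*\<^sup>-\<^sup>1 + |\<nabla>u|\<^sup>p\<^sup>-\<^sup>1 + H\<^sup>\<theta>)\<close>, and likewise \<open>v\<close>. As \<open>-u\<close> solves an equation of the same type,
an upper bound for \<open>u\<close> suffices. The boundary values are no issue, because a function in
\<open>W\<^sub>0\<^sup>1\<^sup>,\<^sup>p\<close> has the trace \<open>0\<close>.

Let \<open>a(k)\<close> be the measure of \<open>{u > k}\<close> and \<open>D(k)\<close> the integral of \<open>|\<nabla>u|\<^sup>p\<close> over this set. Two facts about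
level sets carry the proof.

\<^item> Testing the equation with \<open>(u - k)\<^sup>+\<close> gives \<open>D(k) \<le> C \<integral>\<^bsub>{u > k}\<^esub> (u\<^sup>p\<^sup>* + u H\<^sup>\<theta>)\<close> for \<open>k \<ge> 1\<close>
  (\<open>level_identity\<close>, \<open>equation_bounded_above\<close>).

\<^item> \<open>(h - k)\<^sup>p a(h) \<le> C a(k)\<^sup>1\<^sup>-\<^sup>p\<^sup>/\<^sup>p\<^sup>* \<integral>\<^bsub>{k < u \<le> h}\<^esub> |\<nabla>u|\<^sup>p\<close> for \<open>0 \<le> k < h\<close> (\<open>level_inequality\<close>). This takes the place
  of the Sobolev inequality. It is elementary: the truncation of \<open>u\<close> between the levels \<open>k\<close> and \<open>h\<close> is compared
  with its translates by the vectors of a ball of volume \<open>2 a(k)\<close>.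

The rest is real analysis on a finite measure space. Put \<open>k = 2\<^sup>j\<close>, \<open>c\<^sub>j = (2\<^sup>j\<^sup>p\<^sup>* a(2\<^sup>j))\<^sup>p\<^sup>/\<^sup>p\<^sup>*\<close> and let \<open>d\<^sub>j\<close> be the energy
between the levels \<open>2\<^sup>j\<close> and \<open>2\<^sup>j\<^sup>+\<^sup>1\<close>. The second fact becomes \<open>c\<^sub>j\<^sub>+\<^sub>1 \<le> \<eta> c\<^sub>j + C\<^sub>\<eta> d\<^sub>j\<close> for every \<open>\<eta> > 0\<close>. As the
\<open>d\<^sub>j\<close> are summable, so are the \<open>c\<^sub>j\<close>, which is the embedding into \<open>L\<^sup>p\<^sup>*\<close>. The first fact bounds the
tail sums of \<open>d\<close> by those of \<open>c\<close> with a factor that tends to \<open>0\<close>; here the critical powers are harmless since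
the tails of convergent integrals are small. Together the two recursions force
\<open>c\<^sub>j = O(\<delta>\<^sup>j)\<close> for every \<open>\<delta> > 0\<close> (\<open>seq_decay\<close>), so \<open>u\<close> has integrable powers of every order. Then \<open>u\<close> itself can
be absorbed into \<open>H\<close>, the first fact improves to \<open>D(k) \<le> C a(k)\<^sup>1\<^sup>-\<^sup>\<theta>\<^sup>1\<close> with \<open>\<theta>\<^sub>1 < 1 - p/p\<^sup>*\<close>, and the second one
turns this into \<open>(h - k)\<^sup>p a(h) \<le> C a(k)\<^sup>\<beta>\<close> with \<open>\<beta> > 1\<close>. By Stampacchia's lemma \<open>a\<close> vanishes
from some level on (\<open>essentially_bounded_above\<close>).\<close>

section \<open>Smooth functions\<close>

lemma partial_deriv_eqI:
  assumes "(f has_derivative f') (at x)"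
  shows "partial_deriv i f x = f' (axis i 1)"
  unfolding partial_deriv_def using frechet_derivative_at[OF assms] by simp

lemma C_diff_continuous: "C_diff k f \<Longrightarrow> continuous_on UNIV f"
  by (cases k) (auto simp: differentiable_on_def differentiable_at_withinI
      intro!: differentiable_imp_continuous_on)

lemma C_diff_SucD: "C_diff (Suc k) f \<Longrightarrow> C_diff k f"
proof (induction k arbitrary: f)
  case 0
  then show ?case using C_diff_continuous[of "Suc 0" f] by simp
next
  case (Suc k)
  then show ?case by (auto)
qed

lemma C_diff_const: "C_diff k (\<lambda>x::real^'n. c)"
proof (induction k arbitrary: c)
  case (Suc k)
  have "partial_deriv i (\<lambda>x::real^'n. c) = (\<lambda>x. 0)" for i
    by (intro ext) (subst partial_deriv_eqI[where f'="\<lambda>h. 0"], auto)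
  with Suc show ?case by simp
qed auto

lemma partial_deriv_add:
  assumes "f differentiable (at x)" "g differentiable (at x)"
  shows "partial_deriv i (\<lambda>x. f x + g x) x = partial_deriv i f x + partial_deriv i g x"
  unfolding partial_deriv_def
  using frechet_derivative_at[OF has_derivative_add[OF
        frechet_derivative_works[THEN iffD1, OF assms(1)] frechet_derivative_works[THEN iffD1, OF assms(2)]]]
  by metis

lemma partial_deriv_mult:
  assumes "f differentiable (at x)" "g differentiable (at x)"
  shows "partial_deriv i (\<lambda>x. f x * g x) x = f x * partial_deriv i g x + partial_deriv i f x * g x"
  unfolding partial_deriv_def
  using frechet_derivative_at[OF has_derivative_mult[OF
        frechet_derivative_works[THEN iffD1, OF assms(1)] frechet_derivative_works[THEN iffD1, OF assms(2)]]]
  by metis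

lemma C_diff_add: "C_diff k f \<Longrightarrow> C_diff k g \<Longrightarrow> C_diff k (\<lambda>x. f x + g x)"
proof (induction k arbitrary: f g)
  case 0 then show ?case by (auto intro!: continuous_intros)
next
  case (Suc k)
  then have "partial_deriv i (\<lambda>x. f x + g x) = (\<lambda>x. partial_deriv i f x + partial_deriv i g x)" for i
    by (intro ext partial_deriv_add) auto
  moreover have "(\<lambda>x. f x + g x) differentiable (at x)" for x
    using Suc.prems by (intro differentiable_add) auto
  ultimately show ?case using Suc by simp
qed

lemma C_diff_mult: "C_diff k f \<Longrightarrow> C_diff k g \<Longrightarrow> C_diff k (\<lambda>x. f x * g x)"
proof (induction k arbitrary: f g)
  case 0 then show ?case by (auto intro!: continuous_intros)
next
  case (Suc k)
  then have "partial_deriv i (\<lambda>x. f x * g x) = (\<lambda>x. f x * partial_deriv i g x + partial_deriv i f x * g x)" for i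
    by (intro ext partial_deriv_mult) auto
  moreover have "(\<lambda>x. f x * g x) differentiable (at x)" for x
    using Suc.prems by (intro differentiable_mult) auto
  moreover have "C_diff k (\<lambda>x. f x * partial_deriv i g x + partial_deriv i f x * g x)" for i
    using Suc.prems by (intro C_diff_add Suc.IH C_diff_SucD[of k f] C_diff_SucD[of k g]) auto
  ultimately show ?case by simp
qed

lemma smooth_const: "smooth (\<lambda>x. c)"
  by (simp add: smooth_def C_diff_const)

lemma smooth_add: "smooth f \<Longrightarrow> smooth g \<Longrightarrow> smooth (\<lambda>x. f x + g x)"
  by (simp add: smooth_def C_diff_add)

lemma smooth_mult: "smooth f \<Longrightarrow> smooth g \<Longrightarrow> smooth (\<lambda>x. f x * g x)"
  by (simp add: smooth_def C_diff_mult)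

lemma smooth_diff: "smooth f \<Longrightarrow> smooth g \<Longrightarrow> smooth (\<lambda>x. f x - g x)"
  using smooth_add[of f "\<lambda>x. (-1) * g x"] smooth_mult[OF smooth_const[of "-1"], of g] by simp

lemma smooth_prod:
  assumes "finite I" "\<And>i. i \<in> I \<Longrightarrow> smooth (f i)"
  shows "smooth (\<lambda>x. \<Prod>i\<in>I. f i x)"
  using assms by (induction I rule: finite_induct) (auto intro!: smooth_mult smooth_const)

lemma smooth_component: "smooth (\<lambda>x::real^'n. x $ i)"
  unfolding smooth_def
proof
  fix k
  have hd: "((\<lambda>x. x $ i) has_derivative (\<lambda>h. h $ i)) (at x)" for x :: "real^'n"
    by (intro bounded_linear_imp_has_derivative bounded_linear_vec_nth)
  show "C_diff k (\<lambda>x::real^'n. x $ i)"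
  proof (cases k)
    case 0 then show ?thesis by (auto intro!: continuous_intros)
  next
    case (Suc m)
    have "partial_deriv j (\<lambda>x::real^'n. x $ i) = (\<lambda>x. axis j 1 $ i)" for j
      by (intro ext partial_deriv_eqI hd)
    with Suc hd show ?thesis by (auto simp: differentiable_def C_diff_const)
  qed
qed

lemma smooth_differentiable: "smooth f \<Longrightarrow> f differentiable (at x)"
  unfolding smooth_def by (metis C_diff.simps(2))

lemma smooth_partial_deriv: "smooth f \<Longrightarrow> smooth (partial_deriv i f)"
  unfolding smooth_def by (metis C_diff.simps(2))

lemma smooth_continuous: "smooth f \<Longrightarrow> continuous_on UNIV f"
  unfolding smooth_def using C_diff_continuous by blast

lemma partial_deriv_compose:
  assumes "f differentiable (at x)" "(F has_real_derivative d) (at (f x))"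
  shows "partial_deriv i (\<lambda>x. F (f x)) x = d * partial_deriv i f x"
proof -
  have "((\<lambda>x. F (f x)) has_derivative (\<lambda>h. d * frechet_derivative f (at x) h)) (at x)"
    using has_derivative_compose[OF frechet_derivative_works[THEN iffD1, OF assms(1)]
        assms(2)[unfolded has_field_derivative_def]] .
  then show ?thesis by (subst partial_deriv_eqI) (auto simp: partial_deriv_def)
qed

lemma differentiable_compose_real:
  assumes "f differentiable (at x)" "(F has_real_derivative d) (at (f x))"
  shows "(\<lambda>x. F (f x)) differentiable (at x)"
  using has_derivative_compose[OF frechet_derivative_works[THEN iffD1, OF assms(1)]
        assms(2)[unfolded has_field_derivative_def]] by (auto simp: differentiable_def)

lemma C_diff_compose:
  assumes "smooth f" "\<And>s. (F has_real_derivative F' s) (at s)" "C_diff k (\<lambda>x. F' (f x))"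
  shows "C_diff (Suc k) (\<lambda>x. F (f x))"
proof -
  have "partial_deriv i (\<lambda>x. F (f x)) = (\<lambda>x. F' (f x) * partial_deriv i f x)" for i
    by (intro ext partial_deriv_compose smooth_differentiable assms)
  then show ?thesis
    using assms smooth_partial_deriv[OF assms(1)]
    using smooth_differentiable[OF assms(1)]
    by (auto intro!: differentiable_compose_real[OF _ assms(2)] C_diff_mult simp: smooth_def)
qed

text \<open>Smoothness is required of the composition with the derivative only. This form applies to
antiderivatives that are not given by a formula.\<close>

lemma smooth_compose_antiderivative:
  assumes "smooth f" "\<And>s. (F has_real_derivative F' s) (at s)" "smooth (\<lambda>x. F' (f x))"
  shows "smooth (\<lambda>x. F (f x))"
  using C_diff_compose[OF assms(1,2)] assms(3) unfolding smooth_def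
  by (metis C_diff_SucD)

text \<open>For \<open>m = 0\<close> this is the classical smooth function that is flat at \<open>0\<close>. The whole family is
needed because the derivative of one member is a combination of the next two, so that smoothness of
all members follows by one induction.\<close>

definition flat :: "nat \<Rightarrow> real \<Rightarrow> real" where
  "flat m x = (if 0 < x then (1 / x) ^ m * exp (- (1 / x)) else 0)"

lemma flat_tendsto_0: "(flat m \<longlongrightarrow> 0) (at 0)"
proof -
  have "((\<lambda>x. (inverse x) ^ m / exp (inverse x)) \<longlongrightarrow> 0) (at_right (0::real))"
    by (rule filterlim_compose[OF tendsto_power_div_exp_0 filterlim_inverse_at_top_right])
  then have "(flat m \<longlongrightarrow> 0) (at_right 0)"
    by (rule Lim_transform_eventually)
       (auto simp: eventually_at_filter flat_def exp_minus field_simps)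
  moreover have "(flat m \<longlongrightarrow> 0) (at_left 0)"
    by (rule Lim_transform_eventually[OF tendsto_const])
       (auto simp: eventually_at_filter flat_def)
  ultimately show ?thesis by (simp add: filterlim_split_at)
qed

lemma flat_has_derivative:
  "(flat m has_real_derivative flat (m + 2) x - real m * flat (m + 1) x) (at x)"
proof -
  consider "x > 0" | "x < 0" | "x = 0" by linarith
  then show ?thesis
  proof cases
    case 1
    have "((\<lambda>x. (1 / x) ^ m * exp (- (1 / x))) has_real_derivative
        flat (m + 2) x - real m * flat (m + 1) x) (at x)"
    proof (cases m)
      case 0
      with 1 show ?thesis
        by (auto intro!: derivative_eq_intros simp: flat_def field_simps power2_eq_square)
    next
      case (Suc k)
      have "k = 0 \<or> x * x ^ (k - Suc 0) = x ^ k"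
        by (cases k) auto
      with 1 Suc show ?thesis
        by (auto intro!: derivative_eq_intros simp: flat_def field_simps power2_eq_square)
    qed
    then show ?thesis
      by (rule has_field_derivative_transform_within_open[of _ _ _ "{0<..}"])
         (use 1 in \<open>auto simp: flat_def\<close>)
  next
    case 2
    have "((\<lambda>x. 0) has_real_derivative flat (m + 2) x - real m * flat (m + 1) x) (at x)"
      using 2 by (auto simp: flat_def)
    then show ?thesis
      by (rule has_field_derivative_transform_within_open[of _ _ _ "{..<0}"])
         (use 2 in \<open>auto simp: flat_def\<close>)
  next
    case 3
    have "((\<lambda>h. (flat m (0 + h) - flat m 0) / h) \<longlongrightarrow> 0) (at 0)"
      by (rule Lim_transform_eventually[OF flat_tendsto_0[of "Suc m"]])
         (auto simp: flat_def eventually_at_filter)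
    with 3 show ?thesis by (simp add: DERIV_def flat_def)
  qed
qed

lemma smooth_flat_compose:
  assumes "smooth f"
  shows "smooth (\<lambda>x. flat m (f x))"
  unfolding smooth_def
proof
  fix k show "C_diff k (\<lambda>x. flat m (f x))"
  proof (induction k arbitrary: m)
    case 0
    have "continuous_on UNIV (flat m)"
      by (rule DERIV_continuous_on[OF has_field_derivative_at_within[OF flat_has_derivative]])
    from continuous_on_compose2[OF this smooth_continuous[OF assms]]
    show ?case by simp
  next
    case (Suc k)
    show ?case
      using C_diff_add[OF Suc[of "m+2"] C_diff_mult[OF C_diff_const[of k "- real m"] Suc[of "m+1"]]]
      by (intro C_diff_compose[OF assms flat_has_derivative]) simp
  qed
qed

lemma flat0_bounds: "0 \<le> flat 0 x" "flat 0 x \<le> 1"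
  by (auto simp: flat_def)

text \<open>The rescaled functions converge to the indicator function of the positive half-line at every point, also at \<open>0\<close>.
Both the bump functions and the smooth truncations below are built on this.\<close>

lemma flat0_limit: "(\<lambda>n. flat 0 (real (Suc n) * x)) \<longlonglongrightarrow> (if 0 < x then 1 else 0)"
proof (cases "0 < x")
  case True
  have "(\<lambda>n. exp (- (inverse (real (Suc n)) * inverse x))) \<longlonglongrightarrow> exp (- (0 * inverse x))"
    by (intro tendsto_intros LIMSEQ_inverse_real_of_nat)
  with True show ?thesis by (simp add: flat_def divide_inverse)
qed (auto simp: flat_def mult_le_0_iff zero_less_mult_iff)

section \<open>Test functions and integration by parts\<close>

definition grad :: "(real^'n \<Rightarrow> real) \<Rightarrow> real^'n \<Rightarrow> real^'n" where
  "grad f x = (\<chi> i. partial_deriv i f x)"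

lemma has_derivative_grad:
  assumes "f differentiable (at x)"
  shows "(f has_derivative (\<lambda>h. grad f x \<bullet> h)) (at x)"
proof -
  let ?f' = "frechet_derivative f (at x)"
  have d: "(f has_derivative ?f') (at x)"
    using assms by (simp add: frechet_derivative_works)
  then have lin: "linear ?f'" by (rule has_derivative_linear)
  have "?f' h = grad f x \<bullet> h" for h
  proof -
    have "?f' h = ?f' (\<Sum>i\<in>UNIV. h $ i *\<^sub>R axis i 1)"
      using basis_expansion[of h] by (simp add: scalar_mult_eq_scaleR)
    also have "\<dots> = (\<Sum>i\<in>UNIV. h $ i * ?f' (axis i 1))"
      using lin by (simp add: linear_sum linear_scale)
    also have "\<dots> = grad f x \<bullet> h"
      by (simp add: inner_vec_def grad_def partial_deriv_def mult.commute)
    finally show ?thesis .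
  qed
  then have "?f' = (\<lambda>h. grad f x \<bullet> h)" by (rule ext)
  with d show ?thesis by simp
qed

lemma continuous_on_grad: "smooth f \<Longrightarrow> continuous_on A (grad f)"
  unfolding grad_def
  by (intro continuous_on_vec_lambda continuous_on_subset[OF smooth_continuous[OF smooth_partial_deriv]]) auto

lemma continuous_on_smooth: "smooth f \<Longrightarrow> continuous_on A f"
  using continuous_on_subset[OF smooth_continuous] by blast

lemma borel_measurable_smooth: "smooth f \<Longrightarrow> f \<in> borel_measurable borel"
  by (intro borel_measurable_continuous_onI smooth_continuous)

lemma borel_measurable_grad: "smooth f \<Longrightarrow> grad f \<in> borel_measurable borel"
  by (intro borel_measurable_continuous_onI continuous_on_grad)

abbreviation supp :: "('a::topological_space \<Rightarrow> real) \<Rightarrow> 'a set" where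
  "supp f \<equiv> closure {x. f x \<noteq> 0}"

lemma supp_vanish: "x \<notin> supp f \<Longrightarrow> f x = 0"
  using closure_subset[of "{x. f x \<noteq> 0}"] by blast

lemma partial_deriv_vanish:
  assumes "x \<notin> supp f" shows "partial_deriv i f x = 0"
proof -
  have "((\<lambda>x. 0) has_derivative (\<lambda>h. 0)) (at x)" by simp
  then have "(f has_derivative (\<lambda>h. 0)) (at x)"
  proof (rule has_derivative_transform_within_open)
    show "open (- supp f)" "x \<in> - supp f" using assms by auto
    show "0 = f y" if "y \<in> - supp f" for y using supp_vanish[of y f] that by simp
  qed
  then show ?thesis by (simp add: partial_deriv_eqI)
qed

lemma grad_vanish: "x \<notin> supp f \<Longrightarrow> grad f x = 0"
  by (simp add: grad_def vec_eq_iff partial_deriv_vanish)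

lemma bounded_if_compact_support:
  fixes g :: "real^'n \<Rightarrow> 'b::real_normed_vector"
  assumes "continuous_on UNIV g" "compact K" "\<And>x. x \<notin> K \<Longrightarrow> g x = 0"
  obtains M where "0 \<le> M" "\<And>x. norm (g x) \<le> M"
proof -
  have "compact (g ` K)"
    using assms by (intro compact_continuous_image continuous_on_subset[OF assms(1)]) auto
  then obtain M where "\<And>y. y \<in> g ` K \<Longrightarrow> norm y \<le> M"
    using compact_imp_bounded bounded_iff by metis
  then have "norm (g x) \<le> max M 0" for x
    using assms(3)[of x] by (cases "x \<in> K") (fastforce intro: max.coboundedI1)+
  then show thesis using that[of "max M 0"] by auto
qed

lemma integrable_if_compact_support:
  fixes g :: "real^'n \<Rightarrow> 'b::euclidean_space"
  assumes "continuous_on UNIV g" "compact K" "\<And>x. x \<notin> K \<Longrightarrow> g x = 0"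
  shows "integrable lborel g"
proof -
  have "set_integrable lborel K g"
    unfolding set_integrable_def
    using assms by (intro borel_integrable_compact) (auto intro: continuous_on_subset)
  moreover have "(\<lambda>x. indicator K x *\<^sub>R g x) = g"
    using assms(3) by (auto simp: indicator_def fun_eq_iff)
  ultimately show ?thesis by (simp add: set_integrable_def)
qed

lemma integral_lebesgue_on_eq_lborel:
  fixes g :: "real^'n \<Rightarrow> 'b::euclidean_space"
  assumes "S \<in> sets lebesgue" "g \<in> borel_measurable borel" "\<And>x. x \<notin> S \<Longrightarrow> g x = 0"
  shows "integral\<^sup>L (lebesgue_on S) g = integral\<^sup>L lborel g"
    and "integrable (lebesgue_on S) g \<longleftrightarrow> integrable lborel g"
proof -
  have eq: "(\<lambda>x. indicator S x *\<^sub>R g x) = g"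
    using assms(3) by (auto simp: indicator_def fun_eq_iff)
  show "integral\<^sup>L (lebesgue_on S) g = integral\<^sup>L lborel g"
    using assms eq by (simp add: integral_restrict_space integral_completion)
  show "integrable (lebesgue_on S) g \<longleftrightarrow> integrable lborel g"
    using assms eq by (simp add: integrable_restrict_space integrable_completion)
qed

lemma smooth_lipschitz:
  assumes "smooth f" "\<And>x. norm (grad f x) \<le> M"
  shows "\<bar>f x - f y\<bar> \<le> M * norm (x - y)"
proof -
  have M: "0 \<le> M" using assms(2) norm_ge_zero order_trans by blast
  have "norm (f x - f y) \<le> M * norm (x - y)"
  proof (rule differentiable_bound[of UNIV])
    show "(f has_derivative (\<lambda>h. grad f x \<bullet> h)) (at x within UNIV)" for x
      using has_derivative_grad[OF smooth_differentiable[OF assms(1)]] by simp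
    show "onorm (\<lambda>h. grad f x \<bullet> h) \<le> M" for x
      using M by (intro onorm_bound)
        (auto intro!: order_trans[OF Cauchy_Schwarz_ineq2] mult_right_mono assms(2))
  qed auto
  then show ?thesis by simp
qed

lemma integral_translate:
  fixes f :: "'a::euclidean_space \<Rightarrow> 'b::euclidean_space"
  assumes int: "integrable lborel f"
  shows "integral\<^sup>L lborel (\<lambda>x. f (x + c)) = integral\<^sup>L lborel f"
    and "integrable lborel (\<lambda>x. f (x + c))"
proof -
  have [measurable]: "f \<in> borel_measurable borel" using int by auto
  from int have "integrable (distr lborel borel ((+) c)) f" by (simp add: lborel_distr_plus)
  then show "integrable lborel (\<lambda>x. f (x + c))"
    by (subst (asm) integrable_distr_eq) (auto simp: add.commute)
  have "integral\<^sup>L (distr lborel borel ((+) c)) f = integral\<^sup>L lborel (\<lambda>x. f (c + x))"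
    by (intro integral_distr) auto
  then show "integral\<^sup>L lborel (\<lambda>x. f (x + c)) = integral\<^sup>L lborel f"
    by (simp add: lborel_distr_plus add.commute)
qed

text \<open>A derivative is the dominated limit of difference quotients, and these integrate to zero by translation
invariance.\<close>

lemma integral_partial_deriv_zero:
  fixes f :: "real^'n \<Rightarrow> real"
  assumes "smooth f" "compact (supp f)"
  shows "(LINT x|lborel. partial_deriv i f x) = 0"
proof -
  obtain M where M: "0 \<le> M" "\<And>x. norm (grad f x) \<le> M"
    using bounded_if_compact_support[OF continuous_on_grad[OF assms(1)] assms(2) grad_vanish] by blast
  obtain r where r: "\<And>x. x \<in> supp f \<Longrightarrow> norm x \<le> r"
    using compact_imp_bounded[OF assms(2)] bounded_iff by metis
  define s where "s n = inverse (real (Suc n))" for n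
  have s: "0 < s n" "s n \<le> 1" for n by (auto simp: s_def field_simps)
  define e where "e = (axis i 1 :: real^'n)"
  have ne: "norm e = 1" by (simp add: e_def)
  define q where "q n x = (f (x + s n *\<^sub>R e) - f x) / s n" for n x
  have f_int: "integrable lborel f"
    by (rule integrable_if_compact_support[OF smooth_continuous[OF assms(1)] assms(2) supp_vanish[of _ f]])
  have q0: "integral\<^sup>L lborel (q n) = 0" for n
    unfolding q_def by (simp add: integral_translate f_int)
  have "(\<lambda>n. integral\<^sup>L lborel (q n)) \<longlonglongrightarrow> integral\<^sup>L lborel (partial_deriv i f)"
  proof (rule integral_dominated_convergence)
    show "partial_deriv i f \<in> borel_measurable lborel"
      using borel_measurable_smooth[OF smooth_partial_deriv[OF assms(1)]] by simp
    show "q n \<in> borel_measurable lborel" for n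
      unfolding q_def using borel_measurable_smooth[OF assms(1)] by (simp add: measurable_compose[where f="\<lambda>x. x + s n *\<^sub>R e"])
    show "integrable lborel (\<lambda>x. M * indicator (cball (0::real^'n) (r + 1)) x)"
      by (intro integrable_mult_right integrable_real_indicator) (use emeasure_lborel_cball_finite[of "0::real^'n" "r + 1"] in \<open>auto simp: infinity_ennreal_def\<close>)
    show "AE x in lborel. (\<lambda>n. q n x) \<longlonglongrightarrow> partial_deriv i f x"
    proof (rule AE_I2)
      fix x
      have d1: "((\<lambda>t. x + t *\<^sub>R e) has_derivative (\<lambda>t. t *\<^sub>R e)) (at 0)"
        by (auto intro!: derivative_eq_intros)
      have d2: "(f has_derivative (\<bullet>) (grad f x)) (at (x + 0 *\<^sub>R e))"
        using has_derivative_grad[OF smooth_differentiable[OF assms(1)]] by simp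
      have "((\<lambda>t. f (x + t *\<^sub>R e)) has_derivative (\<lambda>t. grad f x \<bullet> (t *\<^sub>R e))) (at 0)"
        by (rule has_derivative_compose[OF d1 d2])
      then have "((\<lambda>t. f (x + t *\<^sub>R e)) has_real_derivative partial_deriv i f x) (at 0)"
        by (rule has_derivative_imp_has_field_derivative)
           (simp add: e_def inner_axis grad_def)
      then have "((\<lambda>h. (f (x + h *\<^sub>R e) - f x) / h) \<longlongrightarrow> partial_deriv i f x) (at 0)"
        by (simp add: DERIV_def)
      moreover have "filterlim s (at 0) sequentially"
      proof -
        have "s \<longlonglongrightarrow> 0" unfolding s_def by (rule LIMSEQ_inverse_real_of_nat)
        with s(1) show ?thesis by (auto simp: filterlim_at less_imp_neq[symmetric])
      qed
      ultimately show "(\<lambda>n. q n x) \<longlonglongrightarrow> partial_deriv i f x"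
        unfolding q_def by (rule filterlim_compose)
    qed
    show "AE x in lborel. norm (q n x) \<le> M * indicator (cball 0 (r + 1)) x" for n
    proof (rule AE_I2)
      fix x
      show "norm (q n x) \<le> M * indicator (cball 0 (r + 1)) x"
      proof (cases "x \<in> cball 0 (r + 1)")
        case True
        have "\<bar>f (x + s n *\<^sub>R e) - f x\<bar> \<le> M * s n"
          using smooth_lipschitz[OF assms(1) M(2), of "x + s n *\<^sub>R e" x] s[of n] ne by simp
        with True s[of n] show ?thesis by (simp add: q_def field_simps)
      next
        case False
        then have nx: "norm x > r + 1" by simp
        have "norm x \<le> norm (x + s n *\<^sub>R e) + s n"
          using norm_triangle_ineq4[of "x + s n *\<^sub>R e" "s n *\<^sub>R e"] s[of n] ne by simp
        with nx s[of n] have "norm (x + s n *\<^sub>R e) > r" by linarith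
        with nx r have "x \<notin> supp f" "x + s n *\<^sub>R e \<notin> supp f" by force+
        then have "f x = 0" "f (x + s n *\<^sub>R e) = 0" by (auto intro: supp_vanish)
        then show ?thesis using M(1) by (simp add: q_def)
      qed
    qed
  qed
  then show ?thesis unfolding q0 by (simp add: LIMSEQ_const_iff)
qed

lemma test_functionsD:
  assumes "f \<in> test_functions \<Omega>"
  shows "smooth f" "compact (supp f)" "supp f \<subseteq> \<Omega>" "x \<notin> \<Omega> \<Longrightarrow> f x = 0" "x \<notin> \<Omega> \<Longrightarrow> grad f x = 0"
    "x \<notin> \<Omega> \<Longrightarrow> partial_deriv i f x = 0"
  using assms supp_vanish[of x f] grad_vanish[of x f] partial_deriv_vanish[of x f i]
  by (auto simp: test_functions_def)

lemma test_functionsI: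
  assumes "smooth f" "compact K" "K \<subseteq> \<Omega>" "\<And>x. x \<notin> K \<Longrightarrow> f x = 0"
  shows "f \<in> test_functions \<Omega>"
proof -
  have "supp f \<subseteq> K"
    using assms(4) by (intro closure_minimal compact_imp_closed assms) blast
  moreover have "compact (supp f)"
    using bounded_subset[OF compact_imp_bounded[OF assms(2)] calculation] by (simp add: compact_eq_bounded_closed)
  ultimately show ?thesis
    using assms(1,3) by (auto simp: test_functions_def)
qed

section \<open>Uniqueness of weak gradients\<close>

lemma integrable_local_mult:
  fixes u \<psi> :: "real^'n \<Rightarrow> real"
  assumes "open \<Omega>" "locally_integrable \<Omega> u" "continuous_on UNIV \<psi>"
    and K: "compact K" "K \<subseteq> \<Omega>" "\<And>x. x \<notin> K \<Longrightarrow> \<psi> x = 0"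
  shows "integrable (lebesgue_on \<Omega>) (\<lambda>x. u x * \<psi> x)"
proof -
  have Km: "K \<in> sets lebesgue" "\<Omega> \<in> sets lebesgue"
    using K(1) assms(1) by (auto simp: compact_imp_closed)
  have i: "integrable lebesgue (\<lambda>x. indicator K x *\<^sub>R u x)"
    using assms(2) K Km by (auto simp: locally_integrable_def integrable_restrict_space)
  obtain M where M: "0 \<le> M" "\<And>x. norm (\<psi> x) \<le> M"
    using bounded_if_compact_support[OF assms(3) K(1,3)] by blast
  have "integrable lebesgue (\<lambda>x. (indicator K x *\<^sub>R u x) * \<psi> x)"
  proof (rule Bochner_Integration.integrable_bound[where f="\<lambda>x. M * (indicator K x *\<^sub>R u x)"])
    show "integrable lebesgue (\<lambda>x. M * (indicator K x *\<^sub>R u x))" using i by simp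
    have "\<psi> \<in> borel_measurable lebesgue"
      using borel_measurable_continuous_onI[OF assms(3)] by (intro measurable_completion) simp
    then show "(\<lambda>x. (indicator K x *\<^sub>R u x) * \<psi> x) \<in> borel_measurable lebesgue"
      using borel_measurable_integrable[OF i] by simp
    show "AE x in lebesgue. norm (indicat_real K x *\<^sub>R u x * \<psi> x) \<le> norm (M * indicat_real K x *\<^sub>R u x)"
      using M mult_left_mono[OF M(2), of "\<bar>u x\<bar>" for x]
      by (auto simp: abs_mult indicator_def mult.commute)
  qed
  moreover have "(\<lambda>x. (indicator K x *\<^sub>R u x) * \<psi> x) = (\<lambda>x. indicator \<Omega> x *\<^sub>R (u x * \<psi> x))"
    using K by (auto simp: fun_eq_iff indicator_def)
  ultimately show ?thesis using Km by (simp add: integrable_restrict_space)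
qed

lemma integrable_local_test:
  assumes "open \<Omega>" "locally_integrable \<Omega> (u :: real^'n \<Rightarrow> real)" "\<psi> \<in> test_functions \<Omega>"
  shows "integrable (lebesgue_on \<Omega>) (\<lambda>x. u x * \<psi> x)"
    "integrable (lebesgue_on \<Omega>) (\<lambda>x. u x * partial_deriv i \<psi> x)"
proof -
  note t = test_functionsD[OF assms(3)]
  show "integrable (lebesgue_on \<Omega>) (\<lambda>x. u x * \<psi> x)"
    by (rule integrable_local_mult[OF assms(1,2) smooth_continuous[OF t(1)] t(2,3) supp_vanish[of _ \<psi>]])
  show "integrable (lebesgue_on \<Omega>) (\<lambda>x. u x * partial_deriv i \<psi> x)"
    by (rule integrable_local_mult[OF assms(1,2) smooth_continuous[OF smooth_partial_deriv[OF t(1)]] t(2,3)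
          partial_deriv_vanish[of _ \<psi>]])
qed

lemma locally_integrable_nth:
  "locally_integrable \<Omega> g \<Longrightarrow> locally_integrable \<Omega> (\<lambda>x. (g x :: real^'n) $ i)"
  unfolding locally_integrable_def cart_eq_inner_axis by (auto intro: integrable_inner_left)

lemma locally_integrable_continuous:
  fixes g :: "real^'n \<Rightarrow> 'b::euclidean_space"
  assumes "continuous_on UNIV g"
  shows "locally_integrable \<Omega> g"
  unfolding locally_integrable_def
proof safe
  fix K :: "(real^'n) set" assume K: "compact K"
  have "integrable lborel (\<lambda>x. indicator K x *\<^sub>R g x)"
    using K assms by (intro borel_integrable_compact) (auto intro: continuous_on_subset)
  moreover from this have "integrable lebesgue (\<lambda>x. indicator K x *\<^sub>R g x)"
    by (subst integrable_completion) auto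
  ultimately show "integrable (lebesgue_on K) g"
    using K by (simp add: integrable_restrict_space compact_imp_closed)
qed

text \<open>Integration by parts: the product rule reduces it to the vanishing of the integral of a derivative of
a test function.\<close>

lemma has_weak_gradient_test:
  fixes \<phi> :: "real^'n \<Rightarrow> real"
  assumes "open \<Omega>" "smooth \<phi>"
  shows "has_weak_gradient \<Omega> \<phi> (grad \<phi>)"
  unfolding has_weak_gradient_def
proof (intro conjI ballI allI)
  show li: "locally_integrable \<Omega> \<phi>" "locally_integrable \<Omega> (grad \<phi>)"
    by (intro locally_integrable_continuous continuous_on_smooth continuous_on_grad assms)+
  fix \<psi> i assume \<psi>: "\<psi> \<in> test_functions \<Omega>"
  note t = test_functionsD[OF \<psi>]
  let ?L = "lebesgue_on \<Omega>"
  let ?P = "\<lambda>x. \<phi> x * \<psi> x"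
  have sm: "smooth ?P" by (intro smooth_mult assms t)
  have "?P \<in> test_functions \<Omega>"
    by (rule test_functionsI[OF sm t(2,3)]) (metis supp_vanish[of _ \<psi>] mult_zero_right)
  note tP = test_functionsD[OF this]
  have "(LINT x|?L. \<phi> x * partial_deriv i \<psi> x) + (LINT x|?L. (grad \<phi> x $ i) * \<psi> x)
      = (LINT x|?L. \<phi> x * partial_deriv i \<psi> x + (grad \<phi> x $ i) * \<psi> x)"
    by (intro Bochner_Integration.integral_add[symmetric] integrable_local_test \<psi> assms(1) li
        locally_integrable_nth)
  also have "\<dots> = (LINT x|?L. partial_deriv i ?P x)"
    by (simp add: partial_deriv_mult[OF smooth_differentiable[OF assms(2)] smooth_differentiable[OF t(1)]] grad_def)
  also have "\<dots> = (LINT x|lborel. partial_deriv i ?P x)"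
    using assms(1) borel_measurable_smooth[OF smooth_partial_deriv[OF sm]] tP(6)
    by (intro integral_lebesgue_on_eq_lborel(1)) auto
  also have "\<dots> = 0"
    by (rule integral_partial_deriv_zero[OF sm tP(2)])
  finally show "(LINT x|?L. \<phi> x * partial_deriv i \<psi> x) = - (LINT x|?L. (grad \<phi> x $ i) * \<psi> x)"
    by simp
qed

lemma has_weak_gradient_diff:
  fixes u u' :: "real^'n \<Rightarrow> real"
  assumes "open \<Omega>" "has_weak_gradient \<Omega> u g" "has_weak_gradient \<Omega> u' g'"
  shows "has_weak_gradient \<Omega> (\<lambda>x. u x - u' x) (\<lambda>x. g x - g' x)"
proof -
  have li: "locally_integrable \<Omega> u" "locally_integrable \<Omega> u'" "locally_integrable \<Omega> g" "locally_integrable \<Omega> g'"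
    using assms by (auto simp: has_weak_gradient_def)
  show ?thesis
    unfolding has_weak_gradient_def
  proof (intro conjI ballI allI)
    show "locally_integrable \<Omega> (\<lambda>x. u x - u' x)" "locally_integrable \<Omega> (\<lambda>x. g x - g' x)"
      using li by (auto simp: locally_integrable_def)
    fix \<phi> i assume \<phi>: "\<phi> \<in> test_functions \<Omega>"
    have "(LINT x|lebesgue_on \<Omega>. u x * partial_deriv i \<phi> x) = - (LINT x|lebesgue_on \<Omega>. g x $ i * \<phi> x)"
      "(LINT x|lebesgue_on \<Omega>. u' x * partial_deriv i \<phi> x) = - (LINT x|lebesgue_on \<Omega>. g' x $ i * \<phi> x)"
      using assms \<phi> by (auto simp: has_weak_gradient_def)
    then show "(LINT x|lebesgue_on \<Omega>. (u x - u' x) * partial_deriv i \<phi> x)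
        = - (LINT x|lebesgue_on \<Omega>. (g x - g' x) $ i * \<phi> x)"
      using integrable_local_test(2)[OF assms(1) li(1) \<phi>, of i] integrable_local_test(2)[OF assms(1) li(2) \<phi>, of i]
        integrable_local_test(1)[OF assms(1) locally_integrable_nth[OF li(3), of i] \<phi>]
        integrable_local_test(1)[OF assms(1) locally_integrable_nth[OF li(4), of i] \<phi>]
      by (simp add: left_diff_distrib)
  qed
qed

definition box_bump :: "real^'n \<Rightarrow> real^'n \<Rightarrow> nat \<Rightarrow> real^'n \<Rightarrow> real" where
  "box_bump a b n x =
     (\<Prod>i\<in>UNIV. flat 0 (real (Suc n) * (x $ i - a $ i)) * flat 0 (real (Suc n) * (b $ i - x $ i)))"

lemma box_bump_outside:
  assumes "x \<notin> box a b" shows "box_bump a b n x = 0"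
proof -
  obtain i where "\<not> (a $ i < x $ i \<and> x $ i < b $ i)"
    using assms by (auto simp: mem_box_cart)
  then have "flat 0 (real (Suc n) * (x $ i - a $ i)) * flat 0 (real (Suc n) * (b $ i - x $ i)) = 0"
    by (auto simp: flat_def zero_less_mult_iff)
  then show ?thesis unfolding box_bump_def by (intro prod_zero) auto
qed

lemma box_bump_bounds: "0 \<le> box_bump a b n x" "box_bump a b n x \<le> 1"
  unfolding box_bump_def
  by (auto intro!: prod_nonneg prod_le_1 mult_nonneg_nonneg mult_le_one flat0_bounds)

lemma box_bump_limit: "(\<lambda>n. box_bump a b n x) \<longlonglongrightarrow> indicator (box a b) x"
proof -
  have 1: "(\<lambda>n. box_bump a b n x) \<longlonglongrightarrow>
      (\<Prod>i\<in>UNIV. (if 0 < x $ i - a $ i then 1 else 0) * (if 0 < b $ i - x $ i then 1 else 0 :: real))"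
    unfolding box_bump_def by (intro tendsto_prod tendsto_mult flat0_limit)
  have 2: "(\<Prod>i\<in>UNIV. (if 0 < x $ i - a $ i then 1 else 0) * (if 0 < b $ i - x $ i then 1 else 0 :: real))
      = indicator (box a b) x"
  proof (cases "x \<in> box a b")
    case False
    then obtain i where "\<not> (a $ i < x $ i \<and> x $ i < b $ i)"
      by (auto simp: mem_box_cart)
    with False show ?thesis
      by (subst prod_zero) auto
  qed (simp add: mem_box_cart)
  show ?thesis using 1 unfolding 2 .
qed

lemma box_bump_test:
  assumes "cbox a b \<subseteq> \<Omega>"
  shows "box_bump a b n \<in> test_functions \<Omega>"
proof (rule test_functionsI[OF _ compact_cbox assms])
  show "smooth (box_bump a b n)"
    unfolding box_bump_def
    by (intro smooth_prod smooth_mult smooth_flat_compose smooth_diff smooth_const smooth_component) auto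
qed (use box_subset_cbox box_bump_outside in blast)

text \<open>The open boxes are closed under intersection and generate the Borel sets, so the integral of \<open>f\<close> vanishes over
every Borel set. The total integral has to be known for the complements.\<close>

lemma AE_zero_if_box_integrals_zero:
  fixes f :: "real^'n \<Rightarrow> real"
  assumes f: "integrable lebesgue f" and 0: "integral\<^sup>L lebesgue f = 0"
    and box: "\<And>c d. (LINT x|lebesgue. indicator (box c d) x * f x) = 0"
  shows "AE x in lebesgue. f x = 0"
proof -
  obtain f' where f'[measurable]: "f' \<in> borel_measurable lborel" and eq: "AE x in lborel. f x = f' x"
    using completion_ex_borel_measurable_real[of f lborel] f by auto
  have eq': "AE x in lebesgue. f x = f' x" using eq by (rule AE_completion)
  have [measurable]: "f' \<in> borel_measurable lebesgue" using f' by (rule measurable_completion)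
  have "integrable lebesgue f'"
    using integrable_cong_AE[THEN iffD1, OF _ _ eq' f] f by auto
  then have f'i: "integrable lborel f'" by (simp add: integrable_completion)
  have tr: "(LINT x|lborel. indicator A x * f' x) = (LINT x|lebesgue. indicator A x * f x)"
    if [measurable]: "A \<in> sets borel" for A
  proof -
    have [measurable]: "A \<in> sets lebesgue" "f \<in> borel_measurable lebesgue" using that f by auto
    have "(LINT x|lborel. indicator A x * f' x) = (LINT x|lebesgue. indicator A x * f' x)"
      by (rule integral_completion[symmetric]) simp
    also have "\<dots> = (LINT x|lebesgue. indicator A x * f x)"
      using eq' f by (intro integral_cong_AE) auto
    finally show ?thesis .
  qed
  have tr0: "integral\<^sup>L lborel f' = 0"
    using tr[of UNIV] 0 by simp
  have all: "set_lebesgue_integral lborel A f' = 0" if "A \<in> sets borel" for A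
  proof -
    let ?G = "range (\<lambda>(a, b). box a b :: (real^'n) set)"
    have ss: "sigma_sets UNIV ?G = sets borel"
      by (subst borel_eq_box) simp
    have "A \<in> sigma_sets UNIV ?G" using that ss by simp
    then show ?thesis
    proof (induction rule: sigma_sets_induct_disjoint[rotated 2, where \<Omega>=UNIV and G="?G",
          consumes 1, case_names basic empty compl union stable sub])
      case stable
      show ?case unfolding Int_stable_def by (auto simp: box_Int_box split: prod.splits)
    next
      case sub then show ?case by auto
    next
      case (basic A)
      then obtain c d where "A = box c d" by auto
      then show ?case using tr[of A] box[of c d] by (simp add: set_lebesgue_integral_def)
    next
      case empty then show ?case by (simp add: set_lebesgue_integral_def)
    next
      case (compl A)
      have A: "A \<in> sets borel" using compl(1) ss by simp
      have "(LINT x|lborel. indicator (UNIV - A) x * f' x) = (LINT x|lborel. f' x - indicator A x * f' x)"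
        by (intro Bochner_Integration.integral_cong) (auto simp: indicator_def)
      also have "\<dots> = integral\<^sup>L lborel f' - (LINT x|lborel. indicator A x * f' x)"
        using A f'i integrable_mult_indicator[of A lborel f']
        by (intro Bochner_Integration.integral_diff) auto
      finally show ?case using compl(2) tr0 by (simp add: set_lebesgue_integral_def)
    next
      case (union A)
      have A: "\<And>i. A i \<in> sets borel" using union(2) ss by auto
      have "set_integrable lborel (\<Union>i. A i) f'"
        using A f'i unfolding set_integrable_def by (intro integrable_mult_indicator) auto
      then have "set_lebesgue_integral lborel (\<Union>i. A i) f' = (\<Sum>i. set_lebesgue_integral lborel (A i) f')"
        using A union(1) by (intro lebesgue_integral_countable_add) (auto simp: disjoint_family_on_def)
      then show ?case using union(3) by simp
    qed
  qed
  have "AE x in lborel. f' x = 0"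
    by (rule sigma_finite_measure.density_zero[OF lborel.sigma_finite_measure_axioms f'i]) (use all in simp)
  then have "AE x in lborel. f x = 0" using eq by eventually_elim simp
  then show ?thesis by (rule AE_completion)
qed

text \<open>On a box whose closure lies in \<open>\<Omega>\<close>, the bump functions converge boundedly to the indicator
function of the box. Hence all integrals of \<open>h\<close> over such boxes vanish, and \<open>\<Omega>\<close> is a countable union of closed boxes.\<close>

lemma fundamental_lemma_variations:
  fixes h :: "real^'n \<Rightarrow> real"
  assumes \<Omega>: "open \<Omega>" and h: "locally_integrable \<Omega> h"
    and zero: "\<And>\<phi>. \<phi> \<in> test_functions \<Omega> \<Longrightarrow> (LINT x|lebesgue_on \<Omega>. h x * \<phi> x) = 0"
  shows "AE x in lebesgue_on \<Omega>. h x = 0"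
proof -
  have \<Omega>m: "\<Omega> \<in> sets lebesgue" using \<Omega> by auto
  have int: "integrable lebesgue (\<lambda>x. indicator (cbox a b) x * h x)" if "cbox a b \<subseteq> \<Omega>" for a b
  proof -
    have "integrable (lebesgue_on (cbox a b)) h"
      using h that by (simp add: locally_integrable_def)
    then show ?thesis by (simp add: integrable_restrict_space)
  qed
  have boxint: "integrable lebesgue (\<lambda>x. indicator (box a b) x * h x)" if "cbox a b \<subseteq> \<Omega>" for a b
  proof -
    have "integrable lebesgue (\<lambda>x. indicator (box a b) x *\<^sub>R (indicator (cbox a b) x * h x))"
      by (intro integrable_mult_indicator int that) auto
    moreover have "(\<lambda>x. indicator (box a b) x *\<^sub>R (indicator (cbox a b) x * h x)) = (\<lambda>x. indicator (box a b) x * h x)"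
      using box_subset_cbox[of a b] by (auto simp: indicator_def fun_eq_iff)
    ultimately show ?thesis by simp
  qed
  have boxzero: "(LINT x|lebesgue. indicator (box a b) x * h x) = 0" if ab: "cbox a b \<subseteq> \<Omega>" for a b
  proof -
    have "(\<lambda>n. LINT x|lebesgue. indicator (cbox a b) x * h x * box_bump a b n x) \<longlonglongrightarrow>
        (LINT x|lebesgue. indicator (cbox a b) x * h x * indicator (box a b) x)"
    proof (rule integral_dominated_convergence)
      show "integrable lebesgue (\<lambda>x. norm (indicator (cbox a b) x * h x))"
        using int[OF ab] by (rule integrable_norm)
      show "(\<lambda>x. indicat_real (cbox a b) x * h x * indicat_real (box a b) x) \<in> borel_measurable lebesgue"
        by (rule borel_measurable_times[OF borel_measurable_integrable[OF int[OF ab]] borel_measurable_indicator]) simp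
      show "(\<lambda>x. indicat_real (cbox a b) x * h x * box_bump a b n x) \<in> borel_measurable lebesgue" for n
        using borel_measurable_smooth[OF test_functionsD(1)[OF box_bump_test[OF ab, of n]]]
        by (intro borel_measurable_times[OF borel_measurable_integrable[OF int[OF ab]]] measurable_completion) simp
      show "AE x in lebesgue. (\<lambda>n. indicat_real (cbox a b) x * h x * box_bump a b n x)
          \<longlonglongrightarrow> indicat_real (cbox a b) x * h x * indicat_real (box a b) x"
        by (intro AE_I2 tendsto_intros box_bump_limit)
      show "AE x in lebesgue. norm (indicat_real (cbox a b) x * h x * box_bump a b n x)
          \<le> norm (indicat_real (cbox a b) x * h x)" for n
        using box_bump_bounds[of a b n] by (auto simp: abs_mult mult_left_le)
    qed
    moreover have "(LINT x|lebesgue. indicator (cbox a b) x * h x * box_bump a b n x) = 0" for n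
    proof -
      have "(LINT x|lebesgue. indicator (cbox a b) x * h x * box_bump a b n x)
         = (LINT x|lebesgue. indicator \<Omega> x *\<^sub>R (h x * box_bump a b n x))"
        using ab box_bump_outside[of _ a b n] box_subset_cbox[of a b]
        by (intro Bochner_Integration.integral_cong) (auto simp: indicator_def)
      also have "\<dots> = (LINT x|lebesgue_on \<Omega>. h x * box_bump a b n x)"
        using \<Omega>m by (simp add: integral_restrict_space)
      finally show ?thesis using zero[OF box_bump_test[OF ab]] by simp
    qed
    ultimately have "(LINT x|lebesgue. indicator (cbox a b) x * h x * indicator (box a b) x) = 0"
      by (simp add: LIMSEQ_const_iff)
    moreover have "(\<lambda>x. indicator (cbox a b) x * h x * indicator (box a b) x) = (\<lambda>x. indicator (box a b) x * h x)"
      using box_subset_cbox[of a b] by (auto simp: indicator_def fun_eq_iff)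
    ultimately show ?thesis by simp
  qed
  have AEbox: "AE x in lebesgue. x \<in> cbox a b \<longrightarrow> h x = 0" if ab: "cbox a b \<subseteq> \<Omega>" for a b
  proof -
    have "AE x in lebesgue. indicator (box a b) x * h x = 0"
    proof (rule AE_zero_if_box_integrals_zero[OF boxint[OF ab] boxzero[OF ab]])
      fix c d
      obtain e f where ef: "box a b \<inter> box c d = box e f"
        unfolding box_Int_box by blast
      have "(LINT x|lebesgue. indicator (box e f) x * h x) = 0"
      proof (cases "box e f = {}")
        case False
        have "box e f \<subseteq> cbox a b" using ef box_subset_cbox[of a b] by blast
        then have "closure (box e f) \<subseteq> cbox a b" by (rule closure_minimal) (rule closed_cbox)
        then have "cbox e f \<subseteq> cbox a b" using closure_box[OF False] by simp
        then show ?thesis using boxzero ab by blast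
      qed simp
      moreover have "(\<lambda>x. indicator (box c d) x * (indicator (box a b) x * h x)) = (\<lambda>x. indicator (box e f) x * h x)"
        unfolding ef[symmetric] by (auto simp: indicator_def)
      ultimately show "(LINT x|lebesgue. indicator (box c d) x * (indicator (box a b) x * h x)) = 0" by simp
    qed
    moreover have "AE x in lebesgue. x \<notin> cbox a b - box a b"
      by (rule AE_not_in) (simp add: negligible_iff_null_sets[symmetric] negligible_frontier_interval)
    ultimately show ?thesis by eventually_elim (auto simp: indicator_def split: if_splits)
  qed
  obtain \<D> where \<D>: "countable \<D>" "\<D> \<subseteq> Pow \<Omega>" "\<And>X. X \<in> \<D> \<Longrightarrow> \<exists>a b. X = cbox a b" "\<Union>\<D> = \<Omega>"
    using open_countable_Union_open_cbox[OF \<Omega>] by metis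
  have "AE x in lebesgue. \<forall>X\<in>\<D>. x \<in> X \<longrightarrow> h x = 0"
    using \<D>(1)
  proof (subst AE_ball_countable)
    show "\<forall>X\<in>\<D>. AE x in lebesgue. x \<in> X \<longrightarrow> h x = 0"
      using \<D>(2,3) AEbox by (metis PowD subsetD)
  qed
  then have "AE x in lebesgue. x \<in> \<Omega> \<longrightarrow> h x = 0"
    by eventually_elim (use \<D>(4) in blast)
  then show ?thesis using \<Omega>m by (simp add: AE_restrict_space_iff)
qed

lemma weak_gradient_unique:
  fixes u :: "real^'n \<Rightarrow> real"
  assumes \<Omega>: "open \<Omega>" and g: "has_weak_gradient \<Omega> u g" "has_weak_gradient \<Omega> u g'"
  shows "AE x in lebesgue_on \<Omega>. g x = g' x"
proof -
  have d: "has_weak_gradient \<Omega> (\<lambda>x. 0) (\<lambda>x. g x - g' x)"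
    using has_weak_gradient_diff[OF \<Omega> g] by simp
  have "AE x in lebesgue_on \<Omega>. (g x - g' x) $ i = 0" for i
  proof (rule fundamental_lemma_variations[OF \<Omega>])
    show "locally_integrable \<Omega> (\<lambda>x. (g x - g' x) $ i)"
      using d by (intro locally_integrable_nth) (simp add: has_weak_gradient_def)
    show "(LINT x|lebesgue_on \<Omega>. (g x - g' x) $ i * \<phi> x) = 0" if "\<phi> \<in> test_functions \<Omega>" for \<phi>
      using d that by (simp add: has_weak_gradient_def)
  qed
  then have "AE x in lebesgue_on \<Omega>. \<forall>i. (g x - g' x) $ i = 0"
    by (simp add: AE_all_countable)
  then show ?thesis by eventually_elim (simp add: vec_eq_iff)
qed

lemma weak_gradient_AE:
  fixes u :: "real^'n \<Rightarrow> real"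
  assumes "open \<Omega>" "has_weak_gradient \<Omega> u g"
  shows "has_weak_gradient \<Omega> u (weak_gradient \<Omega> u)" "AE x in lebesgue_on \<Omega>. weak_gradient \<Omega> u x = g x"
proof -
  show *: "has_weak_gradient \<Omega> u (weak_gradient \<Omega> u)"
    unfolding weak_gradient_def by (rule someI[of "has_weak_gradient \<Omega> u", OF assms(2)])
  show "AE x in lebesgue_on \<Omega>. weak_gradient \<Omega> u x = g x"
    by (rule weak_gradient_unique[OF assms(1) * assms(2)])
qed

section \<open>A translation inequality for test functions\<close>

text \<open>Young's inequality with a free parameter. It is used instead of Hoelder's inequality, so that only integrals of
\<open>p\<close>-th powers occur, which pass to limits without taking roots.\<close>

lemma le_young_powr:
  fixes a l p :: real
  assumes "0 \<le> a" "0 < l" "1 < p"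
  shows "a \<le> l + l powr (1 - p) * a powr p"
proof (cases "a \<le> l")
  case True
  have "0 \<le> l powr (1 - p) * a powr p" by simp
  with True show ?thesis by linarith
next
  case False
  then have "l powr (p - 1) \<le> a powr (p - 1)"
    using assms by (intro powr_mono2) auto
  then have "l powr (1 - p) * l powr (p - 1) * a \<le> l powr (1 - p) * a powr (p - 1) * a"
    using assms by (intro mult_right_mono mult_left_mono) auto
  moreover have "l powr (1 - p) * l powr (p - 1) = 1"
    using assms by (simp flip: powr_add)
  moreover have "a powr (p - 1) * a = a powr p"
    using False assms powr_add[of a "p - 1" 1] by simp
  ultimately have "a \<le> l powr (1 - p) * a powr p" by (simp add: mult.assoc)
  with assms show ?thesis by linarith
qed

lemma nn_integral_translate:
  fixes f :: "'a::euclidean_space \<Rightarrow> ennreal"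
  assumes "f \<in> borel_measurable borel"
  shows "(\<integral>\<^sup>+x. f (x + c) \<partial>lborel) = (\<integral>\<^sup>+x. f x \<partial>lborel)"
    "(\<integral>\<^sup>+x. f (c + x) \<partial>lborel) = (\<integral>\<^sup>+x. f x \<partial>lborel)"
proof -
  have "(\<integral>\<^sup>+x. f x \<partial>distr lborel borel ((+) c)) = (\<integral>\<^sup>+x. f (c + x) \<partial>lborel)"
    using assms by (intro nn_integral_distr) auto
  then show "(\<integral>\<^sup>+x. f (c + x) \<partial>lborel) = (\<integral>\<^sup>+x. f x \<partial>lborel)"
    by (simp add: lborel_distr_plus)
  then show "(\<integral>\<^sup>+x. f (x + c) \<partial>lborel) = (\<integral>\<^sup>+x. f x \<partial>lborel)"
    by (simp add: add.commute)
qed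

text \<open>The fundamental theorem of calculus on the segment from \<open>x\<close> to \<open>x + z\<close>, with Young's inequality applied
to the integrand.\<close>

lemma smooth_increment_bound:
  fixes f :: "real^'n \<Rightarrow> real"
  assumes f: "smooth f" and R: "norm z \<le> R" and l: "0 < l" and p: "1 < p"
  shows "ennreal \<bar>f x\<bar> \<le> ennreal \<bar>f (x + z)\<bar> + ennreal (R * l)
    + ennreal (R * l powr (1 - p)) * (\<integral>\<^sup>+t. ennreal (norm (grad f (x + t *\<^sub>R z)) powr p) * indicator {0..1} t \<partial>lborel)"
proof -
  have R0: "0 \<le> R" using R norm_ge_zero order_trans by blast
  define d where "d t = grad f (x + t *\<^sub>R z) \<bullet> z" for t
  define m where "m t = norm (grad f (x + t *\<^sub>R z)) powr p" for t
  have cg: "continuous_on UNIV (\<lambda>t. grad f (x + t *\<^sub>R z))"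
    by (intro continuous_on_compose2[OF continuous_on_grad[OF f, of UNIV]] continuous_intros) auto
  have cd: "continuous_on UNIV d" unfolding d_def by (intro continuous_intros cg)
  have cm: "continuous_on UNIV m" unfolding m_def
    using p by (intro continuous_on_powr' continuous_intros cg) auto
  have der: "((\<lambda>t. f (x + t *\<^sub>R z)) has_real_derivative d t) (at t)" for t
  proof -
    have d1: "((\<lambda>t. x + t *\<^sub>R z) has_derivative (\<lambda>t. t *\<^sub>R z)) (at t)"
      by (auto intro!: derivative_eq_intros)
    have "((\<lambda>t. f (x + t *\<^sub>R z)) has_derivative (\<lambda>s. grad f (x + t *\<^sub>R z) \<bullet> (s *\<^sub>R z))) (at t)"
      by (rule has_derivative_compose[OF d1 has_derivative_grad[OF smooth_differentiable[OF f]]])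
    then show ?thesis
      by (rule has_derivative_imp_has_field_derivative) (simp add: d_def)
  qed
  have id: "integrable lborel (\<lambda>t. indicator {0..1} t *\<^sub>R d t)"
    by (intro borel_integrable_compact continuous_on_subset[OF cd]) auto
  have im: "integrable lborel (\<lambda>t. indicator {0..1} t *\<^sub>R m t)"
    by (intro borel_integrable_compact continuous_on_subset[OF cm]) auto
  have i1: "integrable lborel (\<lambda>t. indicator {0..1::real} t *\<^sub>R (1::real))"
    by (intro borel_integrable_compact) auto
  have "(\<integral>t. d t * indicator {0..1} t \<partial>lborel) = f (x + 1 *\<^sub>R z) - f (x + 0 *\<^sub>R z)"
    using cd by (intro integral_FTC_Icc_real) (auto intro: der simp: continuous_on_eq_continuous_at)
  then have eq: "f (x + z) - f x = (\<integral>t. indicator {0..1} t *\<^sub>R d t \<partial>lborel)"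
    by (simp add: mult.commute)
  have "\<bar>f (x + z) - f x\<bar> \<le> (\<integral>t. norm (indicator {0..1} t *\<^sub>R d t) \<partial>lborel)"
    unfolding eq real_norm_def[symmetric] by (rule integral_norm_bound)
  also have "\<dots> \<le> (\<integral>t. R * l * (indicator {0..1} t *\<^sub>R 1) + R * l powr (1 - p) * (indicator {0..1} t *\<^sub>R m t) \<partial>lborel)"
  proof (rule integral_mono)
    show "integrable lborel (\<lambda>t. norm (indicat_real {0..1} t *\<^sub>R d t))" using id by (rule integrable_norm)
    show "integrable lborel (\<lambda>t. R * l * (indicator {0..1} t *\<^sub>R 1) + R * l powr (1 - p) * (indicator {0..1} t *\<^sub>R m t))"
      using i1 im by (intro Bochner_Integration.integrable_add integrable_mult_right)
    fix t
    have "\<bar>d t\<bar> \<le> norm (grad f (x + t *\<^sub>R z)) * R"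
      unfolding d_def using R by (intro order_trans[OF Cauchy_Schwarz_ineq2] mult_left_mono) auto
    also have "\<dots> \<le> (l + l powr (1 - p) * m t) * R"
      unfolding m_def using R0 l p by (intro mult_right_mono le_young_powr) auto
    finally show "norm (indicat_real {0..1} t *\<^sub>R d t)
        \<le> R * l * (indicator {0..1} t *\<^sub>R 1) + R * l powr (1 - p) * (indicator {0..1} t *\<^sub>R m t)"
      by (auto simp: indicator_def algebra_simps)
  qed
  also have "\<dots> = R * l + R * l powr (1 - p) * (\<integral>t. indicator {0..1} t *\<^sub>R m t \<partial>lborel)"
    using i1 im by (subst Bochner_Integration.integral_add) auto
  finally have "\<bar>f x\<bar> \<le> \<bar>f (x + z)\<bar> + (R * l + R * l powr (1 - p) * (\<integral>t. indicator {0..1} t *\<^sub>R m t \<partial>lborel))"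
    by linarith
  moreover have "0 \<le> (\<integral>t. indicator {0..1} t *\<^sub>R m t \<partial>lborel)"
    by (rule Bochner_Integration.integral_nonneg) (simp add: m_def)
  moreover have "ennreal (\<integral>t. indicator {0..1} t *\<^sub>R m t \<partial>lborel)
      = (\<integral>\<^sup>+t. ennreal (m t) * indicator {0..1} t \<partial>lborel)"
    using im by (subst nn_integral_eq_integral[symmetric])
      (auto simp: m_def indicator_def intro!: nn_integral_cong)
  ultimately show ?thesis
    using R0 l unfolding m_def
    by (subst (asm) ennreal_le_iff[symmetric])
       (auto simp: ennreal_plus ennreal_mult add.assoc)
qed

text \<open>The increment bound is averaged over \<open>z\<close> in a ball and integrated over \<open>x\<close> in \<open>E\<close>. By Tonelli and translation
invariance every shift of the gradient contributes the same integral.\<close>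

lemma test_function_set_bound_nn:
  fixes f :: "real^'n \<Rightarrow> real"
  assumes f: "smooth f" and R: "0 < R" and l: "0 < l" and p: "1 < p"
    and E: "E \<in> sets lebesgue"
  shows "ennreal (measure lborel (cball (0::real^'n) R)) * (\<integral>\<^sup>+x. ennreal \<bar>f x\<bar> * indicator E x \<partial>lebesgue)
    \<le> (\<integral>\<^sup>+x. ennreal \<bar>f x\<bar> \<partial>lborel) * emeasure lebesgue E
     + ennreal (measure lborel (cball (0::real^'n) R)) * (ennreal (R * l) * emeasure lebesgue E
     + ennreal (R * l powr (1 - p)) * (\<integral>\<^sup>+x. ennreal (norm (grad f x) powr p) \<partial>lborel))"
proof -
  define B where "B = cball (0::real^'n) R"
  let ?b = "ennreal (measure lborel B)"
  have b: "emeasure lborel B = ?b"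
    using emeasure_lborel_cball_finite[of "0::real^'n" R] by (simp add: B_def emeasure_eq_ennreal_measure)
  have [measurable]: "B \<in> sets borel" by (simp add: B_def)
  have [measurable]: "f \<in> borel_measurable borel" "grad f \<in> borel_measurable borel"
    using f by (auto intro: borel_measurable_smooth borel_measurable_grad)
  define g where "g x = ennreal (norm (grad f x) powr p)" for x
  have [measurable]: "g \<in> borel_measurable borel" unfolding g_def by measurable
  define k where "k x z = (\<integral>\<^sup>+t. g (x + t *\<^sub>R z) * indicator {0..1} t \<partial>lborel)" for x z
  have [measurable]: "case_prod k \<in> borel_measurable (borel \<Otimes>\<^sub>M borel)"
    unfolding k_def by measurable
  have k_x: "(\<integral>\<^sup>+x. k x z \<partial>lborel) = (\<integral>\<^sup>+x. g x \<partial>lborel)" for z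
  proof -
    have "(\<integral>\<^sup>+x. k x z \<partial>lborel) = (\<integral>\<^sup>+t. (\<integral>\<^sup>+x. g (x + t *\<^sub>R z) * indicator {0..1} t \<partial>lborel) \<partial>lborel)"
      unfolding k_def by (rule lborel_pair.Fubini') measurable
    also have "\<dots> = (\<integral>\<^sup>+t. (\<integral>\<^sup>+x. g x \<partial>lborel) * indicator {0..1::real} t \<partial>lborel)"
      by (intro nn_integral_cong) (simp add: nn_integral_multc nn_integral_translate)
    also have "\<dots> = (\<integral>\<^sup>+x. g x \<partial>lborel)"
      by (simp add: nn_integral_cmult)
    finally show ?thesis .
  qed
  define K where "K x = (\<integral>\<^sup>+z. k x z * indicator B z \<partial>lborel)" for x
  have Km[measurable]: "K \<in> borel_measurable borel" unfolding K_def by measurable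
  have K_int: "(\<integral>\<^sup>+x. K x \<partial>lborel) = ?b * (\<integral>\<^sup>+x. g x \<partial>lborel)"
  proof -
    have "(\<integral>\<^sup>+x. K x \<partial>lborel) = (\<integral>\<^sup>+z. (\<integral>\<^sup>+x. k x z * indicator B z \<partial>lborel) \<partial>lborel)"
      unfolding K_def by (rule lborel_pair.Fubini') measurable
    also have "\<dots> = (\<integral>\<^sup>+z. (\<integral>\<^sup>+x. g x \<partial>lborel) * indicator B z \<partial>lborel)"
      by (intro nn_integral_cong) (simp add: nn_integral_multc k_x)
    also have "\<dots> = ?b * (\<integral>\<^sup>+x. g x \<partial>lborel)"
      by (subst nn_integral_cmult) (auto simp: b mult.commute)
    finally show ?thesis .
  qed
  have pt: "?b * ennreal \<bar>f x\<bar> \<le> (\<integral>\<^sup>+x. ennreal \<bar>f x\<bar> \<partial>lborel)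
      + (?b * ennreal (R * l) + ennreal (R * l powr (1 - p)) * K x)" for x
  proof -
    have "?b * ennreal \<bar>f x\<bar> = (\<integral>\<^sup>+z. ennreal \<bar>f x\<bar> * indicator B z \<partial>lborel)"
      by (subst nn_integral_cmult) (auto simp: b mult.commute)
    also have "\<dots> \<le> (\<integral>\<^sup>+z. ennreal \<bar>f (x + z)\<bar> + (ennreal (R * l) * indicator B z
          + ennreal (R * l powr (1 - p)) * (k x z * indicator B z)) \<partial>lborel)"
    proof (rule nn_integral_mono)
      fix z
      show "ennreal \<bar>f x\<bar> * indicator B z \<le> ennreal \<bar>f (x + z)\<bar> + (ennreal (R * l) * indicator B z
          + ennreal (R * l powr (1 - p)) * (k x z * indicator B z))"
        using smooth_increment_bound[OF f _ l p, of z R x] unfolding k_def g_def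
        by (auto simp: indicator_def add.assoc B_def)
    qed
    also have "\<dots> = (\<integral>\<^sup>+z. ennreal \<bar>f (x + z)\<bar> \<partial>lborel) + (ennreal (R * l) * ?b
          + ennreal (R * l powr (1 - p)) * K x)"
      unfolding K_def by (subst nn_integral_add, measurable, subst nn_integral_add, measurable)
        (simp add: nn_integral_cmult b)
    also have "(\<integral>\<^sup>+z. ennreal \<bar>f (x + z)\<bar> \<partial>lborel) = (\<integral>\<^sup>+z. ennreal \<bar>f z\<bar> \<partial>lborel)"
      by (rule nn_integral_translate(2)[of "\<lambda>z. ennreal \<bar>f z\<bar>"]) measurable
    finally show ?thesis by (simp add: mult.commute)
  qed
  have [measurable]: "f \<in> borel_measurable lebesgue" "K \<in> borel_measurable lebesgue" "E \<in> sets lebesgue"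
    using E by (auto intro!: measurable_completion)
  have "?b * (\<integral>\<^sup>+x. ennreal \<bar>f x\<bar> * indicator E x \<partial>lebesgue)
      = (\<integral>\<^sup>+x. (?b * ennreal \<bar>f x\<bar>) * indicator E x \<partial>lebesgue)"
    by (subst nn_integral_cmult[symmetric]) (auto simp: mult.assoc)
  also have "\<dots> \<le> (\<integral>\<^sup>+x. ((\<integral>\<^sup>+x. ennreal \<bar>f x\<bar> \<partial>lborel) + ?b * ennreal (R * l)) * indicator E x
      + ennreal (R * l powr (1 - p)) * K x \<partial>lebesgue)"
  proof (rule nn_integral_mono)
    fix x
    show "(?b * ennreal \<bar>f x\<bar>) * indicator E x \<le> ((\<integral>\<^sup>+x. ennreal \<bar>f x\<bar> \<partial>lborel) + ?b * ennreal (R * l)) * indicator E x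
      + ennreal (R * l powr (1 - p)) * K x"
      using pt[of x] by (auto simp: indicator_def add.assoc)
  qed
  also have "\<dots> = ((\<integral>\<^sup>+x. ennreal \<bar>f x\<bar> \<partial>lborel) + ?b * ennreal (R * l)) * emeasure lebesgue E
      + ennreal (R * l powr (1 - p)) * (\<integral>\<^sup>+x. K x \<partial>lebesgue)"
    by (subst nn_integral_add) (auto simp: nn_integral_cmult)
  also have "(\<integral>\<^sup>+x. K x \<partial>lebesgue) = ?b * (\<integral>\<^sup>+x. g x \<partial>lborel)"
    using K_int by (simp add: nn_integral_completion)
  finally show ?thesis
    unfolding g_def B_def[symmetric] by (simp add: algebra_simps)
qed

text \<open>If the ball is large compared with the support of \<open>\<phi>\<close>, the first term on the right is absorbed on the
set where \<open>\<phi>\<close> is largest, and the gradient controls \<open>\<phi>\<close> there. This is the only quantitative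
inequality about test functions that the proof uses.\<close>

lemma test_function_set_bound:
  fixes \<phi> :: "real^'n \<Rightarrow> real"
  assumes \<Omega>: "open \<Omega>" "bounded \<Omega>" and \<phi>: "\<phi> \<in> test_functions \<Omega>"
    and R: "0 < R" and l: "0 < l" and p: "1 < p" and E: "E \<in> sets (lebesgue_on \<Omega>)"
  shows "measure lborel (cball (0::real^'n) R) * (LINT x|lebesgue_on \<Omega>. indicator E x * \<bar>\<phi> x\<bar>)
    \<le> measure (lebesgue_on \<Omega>) E * (LINT x|lebesgue_on \<Omega>. \<bar>\<phi> x\<bar>)
     + measure lborel (cball (0::real^'n) R) * (R * l * measure (lebesgue_on \<Omega>) E
     + R * l powr (1 - p) * (LINT x|lebesgue_on \<Omega>. norm (grad \<phi> x) powr p))"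
proof -
  let ?b = "measure lborel (cball (0::real^'n) R)"
  note t = test_functionsD[OF \<phi>]
  have \<Omega>m: "\<Omega> \<in> sets lebesgue" using \<Omega> by auto
  have E': "E \<subseteq> \<Omega>" "E \<in> sets lebesgue"
    using E \<Omega>m by (auto simp: sets_restrict_space_iff)
  have \<Omega>fin: "emeasure lebesgue \<Omega> < \<infinity>"
    using \<Omega> emeasure_bounded_finite[OF \<Omega>(2)] by (simp add: infinity_ennreal_def)
  have Efin: "emeasure lebesgue E < \<infinity>"
    using emeasure_mono[OF E'(1) \<Omega>m] \<Omega>fin by order
  have mE: "emeasure lebesgue E = ennreal (measure (lebesgue_on \<Omega>) E)"
    using E' \<Omega>m Efin by (simp add: measure_restrict_space emeasure_eq_ennreal_measure)
  have i1: "integrable lborel (\<lambda>x. \<bar>\<phi> x\<bar>)"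
    by (intro integrable_abs integrable_if_compact_support[OF smooth_continuous[OF t(1)] t(2) supp_vanish[of _ \<phi>]])
  have i2: "integrable lborel (\<lambda>x. norm (grad \<phi> x) powr p)"
  proof (rule integrable_if_compact_support[OF _ t(2)])
    show "continuous_on UNIV (\<lambda>x. norm (grad \<phi> x) powr p)"
      using p by (intro continuous_on_powr' continuous_intros continuous_on_grad t) auto
  qed (simp add: grad_vanish)
  have e1: "(LINT x|lebesgue_on \<Omega>. \<bar>\<phi> x\<bar>) = (LINT x|lborel. \<bar>\<phi> x\<bar>)"
    using borel_measurable_integrable[OF i1] t(4) \<Omega>m by (intro integral_lebesgue_on_eq_lborel(1)) auto
  have e2: "(LINT x|lebesgue_on \<Omega>. norm (grad \<phi> x) powr p) = (LINT x|lborel. norm (grad \<phi> x) powr p)"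
    using borel_measurable_integrable[OF i2] t(5) \<Omega>m by (intro integral_lebesgue_on_eq_lborel(1)) auto
  have i3: "integrable lebesgue (\<lambda>x. indicator E x *\<^sub>R \<bar>\<phi> x\<bar>)"
    using i1 E' by (intro integrable_mult_indicator) (auto simp: integrable_completion)
  have e3: "(LINT x|lebesgue_on \<Omega>. indicator E x * \<bar>\<phi> x\<bar>) = (LINT x|lebesgue. indicator E x *\<^sub>R \<bar>\<phi> x\<bar>)"
    using \<Omega>m E' by (subst integral_restrict_space) (auto intro!: Bochner_Integration.integral_cong simp: indicator_def)
  have n1: "(\<integral>\<^sup>+x. ennreal \<bar>\<phi> x\<bar> \<partial>lborel) = ennreal (LINT x|lborel. \<bar>\<phi> x\<bar>)"
    using i1 by (intro nn_integral_eq_integral) auto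
  have n2: "(\<integral>\<^sup>+x. ennreal (norm (grad \<phi> x) powr p) \<partial>lborel) = ennreal (LINT x|lborel. norm (grad \<phi> x) powr p)"
    using i2 by (intro nn_integral_eq_integral) auto
  have n3: "(\<integral>\<^sup>+x. ennreal \<bar>\<phi> x\<bar> * indicator E x \<partial>lebesgue) = ennreal (LINT x|lebesgue. indicator E x *\<^sub>R \<bar>\<phi> x\<bar>)"
    using i3 by (subst nn_integral_eq_integral[symmetric]) (auto simp: indicator_def intro!: nn_integral_cong)
  have nn: "0 \<le> (LINT x|lborel. \<bar>\<phi> x\<bar>)" "0 \<le> (LINT x|lborel. norm (grad \<phi> x) powr p)"
      "0 \<le> (LINT x|lebesgue. indicator E x *\<^sub>R \<bar>\<phi> x\<bar>)"
    by (auto intro!: Bochner_Integration.integral_nonneg)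
  have "ennreal (?b * (LINT x|lebesgue. indicator E x *\<^sub>R \<bar>\<phi> x\<bar>)) \<le> ennreal (measure (lebesgue_on \<Omega>) E * (LINT x|lborel. \<bar>\<phi> x\<bar>)
     + ?b * (R * l * measure (lebesgue_on \<Omega>) E + R * l powr (1 - p) * (LINT x|lborel. norm (grad \<phi> x) powr p)))"
    using test_function_set_bound_nn[OF t(1) R l p E'(2)] R l nn unfolding n1 n2 n3 mE
    by (simp add: ennreal_plus ennreal_mult mult.commute)
  then show ?thesis
    unfolding e1 e2 e3 using R l nn by (subst (asm) ennreal_le_iff) auto
qed

section \<open>Limits of test functions\<close>

lemma powr_add_le:
  fixes a b p :: real
  assumes "0 \<le> a" "0 \<le> b" "0 < p"
  shows "(a + b) powr p \<le> 2 powr p * (a powr p + b powr p)"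
proof -
  have "(a + b) powr p \<le> (2 * max a b) powr p"
    using assms by (intro powr_mono2) auto
  also have "\<dots> = 2 powr p * max a b powr p"
    by (simp add: powr_mult)
  also have "\<dots> \<le> 2 powr p * (a powr p + b powr p)"
    by (intro mult_left_mono) (auto simp: max_def)
  finally show ?thesis .
qed

lemma LpD:
  assumes "f \<in> Lp \<Omega> p"
  shows "f \<in> borel_measurable (lebesgue_on \<Omega>)" "integrable (lebesgue_on \<Omega>) (\<lambda>x. norm (f x) powr p)"
  using assms by (auto simp: Lp_def)

lemma Lp_diff:
  assumes "f \<in> Lp \<Omega> p" "g \<in> Lp \<Omega> p" "0 < p"
  shows "(\<lambda>x. f x - g x) \<in> Lp \<Omega> p"
proof -
  note [measurable] = LpD(1)[OF assms(1)] LpD(1)[OF assms(2)]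
  have "integrable (lebesgue_on \<Omega>) (\<lambda>x. norm (f x - g x) powr p)"
  proof (rule Bochner_Integration.integrable_bound)
    show "integrable (lebesgue_on \<Omega>) (\<lambda>x. 2 powr p * (norm (f x) powr p + norm (g x) powr p))"
      using assms by (intro integrable_mult_right Bochner_Integration.integrable_add LpD)
    have "norm (f x - g x) powr p \<le> 2 powr p * (norm (f x) powr p + norm (g x) powr p)" for x
      using assms(3) powr_mono2[of p "norm (f x - g x)" "norm (f x) + norm (g x)"]
        powr_add_le[of "norm (f x)" "norm (g x)" p] norm_triangle_ineq4[of "f x" "g x"] by force
    then show "AE x in lebesgue_on \<Omega>. norm (norm (f x - g x) powr p)
        \<le> norm (2 powr p * (norm (f x) powr p + norm (g x) powr p))" by simp
  qed measurable
  then show ?thesis by (simp add: Lp_def)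
qed

lemma Lp_bound:
  assumes "f \<in> Lp \<Omega> p" "g \<in> borel_measurable (lebesgue_on \<Omega>)" "0 \<le> c" "0 < p"
    "\<And>x. norm (g x) \<le> c * norm (f x)"
  shows "g \<in> Lp \<Omega> p"
proof -
  note [measurable] = LpD(1)[OF assms(1)] assms(2)
  have "integrable (lebesgue_on \<Omega>) (\<lambda>x. norm (g x) powr p)"
  proof (rule Bochner_Integration.integrable_bound)
    show "integrable (lebesgue_on \<Omega>) (\<lambda>x. c powr p * norm (f x) powr p)"
      using assms by (intro integrable_mult_right LpD)
    have "norm (g x) powr p \<le> c powr p * norm (f x) powr p" for x
      using assms(3,4) powr_mono2[OF _ _ assms(5)[of x], of p] by (simp add: powr_mult)
    then show "AE x in lebesgue_on \<Omega>. norm (norm (g x) powr p) \<le> norm (c powr p * norm (f x) powr p)"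
      by simp
  qed measurable
  then show ?thesis by (simp add: Lp_def)
qed

lemma finite_measure_lebesgue_on_bounded:
  "open \<Omega> \<Longrightarrow> bounded \<Omega> \<Longrightarrow> finite_measure (lebesgue_on (\<Omega> :: 'a::euclidean_space set))"
  by (intro finite_measure_lebesgue_on lmeasurable_open)

lemma Lp_integrable:
  assumes "open \<Omega>" "bounded \<Omega>" "f \<in> Lp \<Omega> p" "1 < p"
  shows "integrable (lebesgue_on \<Omega>) f"
proof (rule Bochner_Integration.integrable_bound)
  interpret finite_measure "lebesgue_on \<Omega>" by (rule finite_measure_lebesgue_on_bounded[OF assms(1,2)])
  show "integrable (lebesgue_on \<Omega>) (\<lambda>x. 1 + norm (f x) powr p)"
    using LpD(2)[OF assms(3)] by auto
  show "f \<in> borel_measurable (lebesgue_on \<Omega>)" by (rule LpD[OF assms(3)])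
  show "AE x in lebesgue_on \<Omega>. norm (f x) \<le> norm (1 + norm (f x) powr p)"
    using le_young_powr[of "norm (f x)" 1 p for x] assms(4) by (auto simp: abs_of_nonneg)
qed

text \<open>On a domain of finite measure, convergence in \<open>L\<^sup>p\<close> implies convergence in \<open>L\<^sup>1\<close>; by Young's
inequality with a small parameter.\<close>

lemma Lp_tendsto_L1:
  fixes f :: "nat \<Rightarrow> real^'n \<Rightarrow> 'b::euclidean_space"
  assumes \<Omega>: "open \<Omega>" "bounded \<Omega>" and p: "1 < p" and f: "\<And>n. f n \<in> Lp \<Omega> p"
    and lim: "(\<lambda>n. LINT x|lebesgue_on \<Omega>. norm (f n x) powr p) \<longlonglongrightarrow> 0"
  shows "(\<lambda>n. LINT x|lebesgue_on \<Omega>. norm (f n x)) \<longlonglongrightarrow> 0"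
proof (rule LIMSEQ_I)
  fix e :: real assume e: "0 < e"
  interpret finite_measure "lebesgue_on \<Omega>" by (rule finite_measure_lebesgue_on_bounded[OF \<Omega>])
  define m where "m = measure (lebesgue_on \<Omega>) \<Omega>"
  define l where "l = e / 2 / (m + 1)"
  have m: "0 \<le> m" by (simp add: m_def)
  have l: "0 < l" "l * m < e / 2 + e / 4"
  proof -
    show "0 < l" using e m by (simp add: l_def)
    have "l * m \<le> l * (m + 1)" using \<open>0 < l\<close> by simp
    also have "\<dots> = e / 2" unfolding l_def
      by (subst times_divide_eq_left, subst nonzero_mult_div_cancel_right) (use m in auto)
    finally show "l * m < e / 2 + e / 4" using e by simp
  qed
  define d where "d = e / 4 / l powr (1 - p)"
  have "0 < d" using e l by (simp add: d_def)
  from LIMSEQ_D[OF lim this] obtain N where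
    N': "\<forall>n\<ge>N. norm ((LINT x|lebesgue_on \<Omega>. norm (f n x) powr p) - 0) < d" by blast
  have N: "(LINT x|lebesgue_on \<Omega>. norm (f n x) powr p) < d" if "N \<le> n" for n
    using N'[rule_format, OF that] by simp
  have "norm ((LINT x|lebesgue_on \<Omega>. norm (f n x)) - 0) < e" if "N \<le> n" for n
  proof -
    have "(LINT x|lebesgue_on \<Omega>. norm (f n x)) \<le> (LINT x|lebesgue_on \<Omega>. l + l powr (1 - p) * norm (f n x) powr p)"
      using Lp_integrable[OF \<Omega> f p] LpD(2)[OF f] l(1) p
      by (intro integral_mono le_young_powr integrable_norm Bochner_Integration.integrable_add integrable_mult_right) auto
    also have "\<dots> = l * m + l powr (1 - p) * (LINT x|lebesgue_on \<Omega>. norm (f n x) powr p)"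
      using LpD(2)[OF f, of n] by (subst Bochner_Integration.integral_add) (auto simp: m_def mult.commute)
    also have "\<dots> \<le> l * m + l powr (1 - p) * d"
      using N[OF that] by (intro add_left_mono mult_left_mono) auto
    also have "\<dots> < e" using l by (simp add: d_def)
    finally show ?thesis by (simp add: abs_of_nonneg Bochner_Integration.integral_nonneg)
  qed
  then show "\<exists>N. \<forall>n\<ge>N. norm ((LINT x|lebesgue_on \<Omega>. norm (f n x)) - 0) < e" by blast
qed

text \<open>The functions of \<open>W\<^sub>0\<^sup>1\<^sup>,\<^sup>p\<close> together with a gradient. Keeping the gradient as a second argument, determined up to
null sets, avoids the choice hidden in \<^const>\<open>weak_gradient\<close>, and limits of such pairs are easy to form.\<close>

definition W0 :: "(real^'n) set \<Rightarrow> real \<Rightarrow> (real^'n \<Rightarrow> real) \<Rightarrow> (real^'n \<Rightarrow> real^'n) \<Rightarrow> bool" where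
  "W0 \<Omega> p u g \<longleftrightarrow> u \<in> Lp \<Omega> p \<and> g \<in> Lp \<Omega> p \<and>
     (\<exists>\<phi>. (\<forall>n. \<phi> n \<in> test_functions \<Omega>) \<and>
        (\<lambda>n. LINT x|lebesgue_on \<Omega>. norm (u x - \<phi> n x) powr p) \<longlonglongrightarrow> 0 \<and>
        (\<lambda>n. LINT x|lebesgue_on \<Omega>. norm (g x - grad (\<phi> n) x) powr p) \<longlonglongrightarrow> 0)"

lemma continuous_in_Lp:
  fixes g :: "real^'n \<Rightarrow> 'b::euclidean_space"
  assumes "open \<Omega>" "continuous_on UNIV g" "compact K" "K \<subseteq> \<Omega>" "\<And>x. x \<notin> K \<Longrightarrow> g x = 0" "1 < p"
  shows "g \<in> Lp \<Omega> p"
proof -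
  have m: "g \<in> borel_measurable borel" using assms(2) by (rule borel_measurable_continuous_onI)
  have i: "integrable lborel (\<lambda>x. norm (g x) powr p)"
    using assms by (intro integrable_if_compact_support[OF _ assms(3)] continuous_on_powr' continuous_intros) auto
  have "integrable (lebesgue_on \<Omega>) (\<lambda>x. norm (g x) powr p)"
    using assms i borel_measurable_integrable[OF i] by (subst integral_lebesgue_on_eq_lborel(2)) (auto simp: subset_iff)
  moreover have "g \<in> borel_measurable (lebesgue_on \<Omega>)"
    using m by (intro measurable_restrict_space1 measurable_completion) simp
  ultimately show ?thesis by (simp add: Lp_def)
qed

lemma test_in_Lp:
  assumes "open \<Omega>" "\<phi> \<in> test_functions \<Omega>" "1 < p"
  shows "\<phi> \<in> Lp \<Omega> p" "grad \<phi> \<in> Lp \<Omega> p"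
proof -
  note t = test_functionsD[OF assms(2)]
  show "\<phi> \<in> Lp \<Omega> p"
    by (rule continuous_in_Lp[OF assms(1) smooth_continuous[OF t(1)] t(2,3) supp_vanish[of _ \<phi>] assms(3)])
  show "grad \<phi> \<in> Lp \<Omega> p"
    by (rule continuous_in_Lp[OF assms(1) continuous_on_grad[OF t(1)] t(2,3) grad_vanish[of _ \<phi>] assms(3)])
qed

lemma tendsto_0_if_powr_tendsto_0:
  fixes a :: "nat \<Rightarrow> real"
  assumes "\<And>n. 0 \<le> a n" "0 < p" "(\<lambda>n. a n powr p) \<longlonglongrightarrow> 0"
  shows "a \<longlonglongrightarrow> 0"
proof -
  have "(\<lambda>n. (a n powr p) powr (1 / p)) \<longlonglongrightarrow> 0 powr (1 / p)"
    using assms by (intro tendsto_powr') auto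
  then show ?thesis using assms by (simp add: powr_powr)
qed

text \<open>Pointwise convergence, needed for compositions with nonlinear functions, holds along a subsequence.\<close>

lemma W0_AE_approx:
  assumes \<Omega>: "open \<Omega>" and p: "1 < p" and W: "W0 \<Omega> p u g"
  obtains \<phi> where "\<And>n. \<phi> n \<in> test_functions \<Omega>"
    "(\<lambda>n. LINT x|lebesgue_on \<Omega>. norm (u x - \<phi> n x) powr p) \<longlonglongrightarrow> 0"
    "(\<lambda>n. LINT x|lebesgue_on \<Omega>. norm (g x - grad (\<phi> n) x) powr p) \<longlonglongrightarrow> 0"
    "AE x in lebesgue_on \<Omega>. (\<lambda>n. \<phi> n x) \<longlonglongrightarrow> u x"
proof -
  obtain \<phi> where \<phi>: "\<And>n. \<phi> n \<in> test_functions \<Omega>"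
    "(\<lambda>n. LINT x|lebesgue_on \<Omega>. norm (u x - \<phi> n x) powr p) \<longlonglongrightarrow> 0"
    "(\<lambda>n. LINT x|lebesgue_on \<Omega>. norm (g x - grad (\<phi> n) x) powr p) \<longlonglongrightarrow> 0"
    and u: "u \<in> Lp \<Omega> p"
    using W unfolding W0_def by blast
  have "integrable (lebesgue_on \<Omega>) (\<lambda>x. norm (u x - \<phi> n x) powr p)" for n
    using p by (intro LpD(2) Lp_diff u test_in_Lp \<Omega> \<phi>) auto
  from tendsto_L1_AE_subseq[where u="\<lambda>n x. norm (u x - \<phi> n x) powr p", OF this] \<phi>(2)
  obtain r where r: "strict_mono r" "AE x in lebesgue_on \<Omega>. (\<lambda>n. norm (u x - \<phi> (r n) x) powr p) \<longlonglongrightarrow> 0"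
    by auto
  from r(2) have "AE x in lebesgue_on \<Omega>. (\<lambda>n. \<phi> (r n) x) \<longlonglongrightarrow> u x"
  proof eventually_elim
    case (elim x)
    then have "(\<lambda>n. norm (u x - \<phi> (r n) x)) \<longlonglongrightarrow> 0"
      using p by (intro tendsto_0_if_powr_tendsto_0[of "\<lambda>n. norm (u x - \<phi> (r n) x)" p]) auto
    then have "(\<lambda>n. norm (\<phi> (r n) x - u x)) \<longlonglongrightarrow> 0" by (subst norm_minus_commute)
    then show ?case by (rule LIM_zero_cancel[OF tendsto_norm_zero_cancel])
  qed
  then show thesis
    using that[of "\<lambda>n. \<phi> (r n)"] \<phi> LIMSEQ_subseq_LIMSEQ[OF \<phi>(2) r(1)] LIMSEQ_subseq_LIMSEQ[OF \<phi>(3) r(1)]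
    by (simp add: o_def)
qed

lemma tendsto_integral_mult_bounded:
  fixes f :: "real^'n \<Rightarrow> real"
  assumes "integrable (lebesgue_on \<Omega>) f" "\<And>n. integrable (lebesgue_on \<Omega>) (fn n)"
    "(\<lambda>n. LINT x|lebesgue_on \<Omega>. \<bar>f x - fn n x\<bar>) \<longlonglongrightarrow> 0"
    and \<eta>: "\<eta> \<in> borel_measurable (lebesgue_on \<Omega>)" "\<And>x. \<bar>\<eta> x\<bar> \<le> C"
  shows "(\<lambda>n. LINT x|lebesgue_on \<Omega>. fn n x * \<eta> x) \<longlonglongrightarrow> (LINT x|lebesgue_on \<Omega>. f x * \<eta> x)"
proof -
  have C: "0 \<le> C" using \<eta>(2) abs_ge_zero order_trans by blast
  have ib: "integrable (lebesgue_on \<Omega>) (\<lambda>x. h x * \<eta> x)" if h: "integrable (lebesgue_on \<Omega>) h" for h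
  proof (rule Bochner_Integration.integrable_bound)
    show "integrable (lebesgue_on \<Omega>) (\<lambda>x. C * h x)" using h by simp
    show "(\<lambda>x. h x * \<eta> x) \<in> borel_measurable (lebesgue_on \<Omega>)" using h \<eta>(1) by measurable
    show "AE x in lebesgue_on \<Omega>. norm (h x * \<eta> x) \<le> norm (C * h x)"
      using \<eta>(2) C by (intro AE_I2) (simp add: abs_mult mult.commute[of "\<bar>h _\<bar>"] mult_right_mono)
  qed
  have "(\<lambda>n. (LINT x|lebesgue_on \<Omega>. f x * \<eta> x) - (LINT x|lebesgue_on \<Omega>. fn n x * \<eta> x)) \<longlonglongrightarrow> 0"
  proof (rule Lim_null_comparison)
    show "(\<lambda>n. C * (LINT x|lebesgue_on \<Omega>. \<bar>f x - fn n x\<bar>)) \<longlonglongrightarrow> 0"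
      using tendsto_mult_left[OF assms(3), of C] by simp
    show "\<forall>\<^sub>F n in sequentially. norm ((LINT x|lebesgue_on \<Omega>. f x * \<eta> x) - (LINT x|lebesgue_on \<Omega>. fn n x * \<eta> x))
        \<le> C * (LINT x|lebesgue_on \<Omega>. \<bar>f x - fn n x\<bar>)"
    proof (rule always_eventually, rule allI)
      fix n
      have "(LINT x|lebesgue_on \<Omega>. f x * \<eta> x) - (LINT x|lebesgue_on \<Omega>. fn n x * \<eta> x)
          = (LINT x|lebesgue_on \<Omega>. (f x - fn n x) * \<eta> x)"
        using ib[OF assms(1)] ib[OF assms(2)] by (simp add: left_diff_distrib)
      also have "norm \<dots> \<le> (LINT x|lebesgue_on \<Omega>. norm ((f x - fn n x) * \<eta> x))"
        by (rule integral_norm_bound)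
      also have "\<dots> \<le> (LINT x|lebesgue_on \<Omega>. C * \<bar>f x - fn n x\<bar>)"
        using assms \<eta>(2) C
        by (intro integral_mono integrable_norm ib)
           (auto simp: abs_mult mult.commute[of C] intro!: mult_left_mono)
      finally show "norm ((LINT x|lebesgue_on \<Omega>. f x * \<eta> x) - (LINT x|lebesgue_on \<Omega>. fn n x * \<eta> x))
        \<le> C * (LINT x|lebesgue_on \<Omega>. \<bar>f x - fn n x\<bar>)" by simp
    qed
  qed
  then show ?thesis
    using tendsto_diff[OF tendsto_const[of "LINT x|lebesgue_on \<Omega>. f x * \<eta> x"]] by fastforce
qed

lemma W0_has_weak_gradient:
  fixes u :: "real^'n \<Rightarrow> real"
  assumes \<Omega>: "open \<Omega>" "bounded \<Omega>" and p: "1 < p" and W: "W0 \<Omega> p u g"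
  shows "has_weak_gradient \<Omega> u g"
proof -
  obtain \<phi> where \<phi>: "\<And>n. \<phi> n \<in> test_functions \<Omega>"
    "(\<lambda>n. LINT x|lebesgue_on \<Omega>. norm (u x - \<phi> n x) powr p) \<longlonglongrightarrow> 0"
    "(\<lambda>n. LINT x|lebesgue_on \<Omega>. norm (g x - grad (\<phi> n) x) powr p) \<longlonglongrightarrow> 0"
    and Lp: "u \<in> Lp \<Omega> p" "g \<in> Lp \<Omega> p"
    using W unfolding W0_def by blast
  note t = test_in_Lp[OF \<Omega>(1) \<phi>(1) p]
  have p0: "0 < p" using p by simp
  have int: "integrable (lebesgue_on \<Omega>) u" "integrable (lebesgue_on \<Omega>) g"
    "\<And>n. integrable (lebesgue_on \<Omega>) (\<phi> n)" "\<And>n. integrable (lebesgue_on \<Omega>) (grad (\<phi> n))"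
    using Lp_integrable[OF \<Omega> _ p] Lp t by blast+
  have l1: "(\<lambda>n. LINT x|lebesgue_on \<Omega>. norm (u x - \<phi> n x)) \<longlonglongrightarrow> 0"
    by (rule Lp_tendsto_L1[OF \<Omega> p Lp_diff[OF Lp(1) t(1) p0] \<phi>(2)])
  have l2: "(\<lambda>n. LINT x|lebesgue_on \<Omega>. norm (g x - grad (\<phi> n) x)) \<longlonglongrightarrow> 0"
    by (rule Lp_tendsto_L1[OF \<Omega> p Lp_diff[OF Lp(2) t(2) p0] \<phi>(3)])
  have l2i: "(\<lambda>n. LINT x|lebesgue_on \<Omega>. \<bar>g x $ i - grad (\<phi> n) x $ i\<bar>) \<longlonglongrightarrow> 0" for i
  proof (rule tendsto_sandwich[OF _ _ tendsto_const l2])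
    show "\<forall>\<^sub>F n in sequentially. 0 \<le> (LINT x|lebesgue_on \<Omega>. \<bar>g x $ i - grad (\<phi> n) x $ i\<bar>)"
      by (intro always_eventually allI Bochner_Integration.integral_nonneg) simp
    have "(LINT x|lebesgue_on \<Omega>. \<bar>g x $ i - grad (\<phi> n) x $ i\<bar>) \<le> (LINT x|lebesgue_on \<Omega>. norm (g x - grad (\<phi> n) x))" for n
    proof (rule integral_mono)
      show "integrable (lebesgue_on \<Omega>) (\<lambda>x. \<bar>g x $ i - grad (\<phi> n) x $ i\<bar>)"
        using int unfolding cart_eq_inner_axis by auto
      show "integrable (lebesgue_on \<Omega>) (\<lambda>x. norm (g x - grad (\<phi> n) x))" using int by auto
      show "\<bar>g x $ i - grad (\<phi> n) x $ i\<bar> \<le> norm (g x - grad (\<phi> n) x)" for x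
        using component_le_norm_cart[of "g x - grad (\<phi> n) x" i] by simp
    qed
    then show "\<forall>\<^sub>F n in sequentially. (LINT x|lebesgue_on \<Omega>. \<bar>g x $ i - grad (\<phi> n) x $ i\<bar>)
        \<le> (LINT x|lebesgue_on \<Omega>. norm (g x - grad (\<phi> n) x))" by simp
  qed
  have li: "locally_integrable \<Omega> h" if "integrable (lebesgue_on \<Omega>) h" for h :: "real^'n \<Rightarrow> 'b::euclidean_space"
    unfolding locally_integrable_def
  proof safe
    fix K :: "(real^'n) set" assume K: "compact K" "K \<subseteq> \<Omega>"
    have "integrable lebesgue (\<lambda>x. indicator \<Omega> x *\<^sub>R h x)"
      using that \<Omega> by (simp add: integrable_restrict_space)
    then have "integrable lebesgue (\<lambda>x. indicator K x *\<^sub>R (indicator \<Omega> x *\<^sub>R h x))"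
      using K by (intro integrable_mult_indicator[of K lebesgue "\<lambda>x. indicator \<Omega> x *\<^sub>R h x"]) (auto simp: compact_imp_closed)
    moreover have "(\<lambda>x. indicator K x *\<^sub>R (indicator \<Omega> x *\<^sub>R h x)) = (\<lambda>x. indicator K x *\<^sub>R h x)"
      using K by (auto simp: fun_eq_iff indicator_def)
    ultimately show "integrable (lebesgue_on K) h"
      using K by (simp add: integrable_restrict_space compact_imp_closed)
  qed
  show ?thesis
    unfolding has_weak_gradient_def
  proof (intro conjI ballI allI)
    show "locally_integrable \<Omega> u" "locally_integrable \<Omega> g" using li int by auto
    fix \<psi> i assume \<psi>: "\<psi> \<in> test_functions \<Omega>"
    note t = test_functionsD[OF \<psi>]
    obtain C where C: "\<And>x. \<bar>\<psi> x\<bar> \<le> C"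
      using bounded_if_compact_support[OF smooth_continuous[OF t(1)] t(2) supp_vanish[of _ \<psi>]] by auto
    obtain D where D: "\<And>x. \<bar>partial_deriv i \<psi> x\<bar> \<le> D"
      using bounded_if_compact_support[OF smooth_continuous[OF smooth_partial_deriv[OF t(1)]] t(2)
          partial_deriv_vanish[of _ \<psi> i]] by auto
    have m: "h \<in> borel_measurable (lebesgue_on \<Omega>)" if "smooth h" for h :: "real^'n \<Rightarrow> real"
      using that by (intro measurable_restrict_space1 measurable_completion) (simp add: borel_measurable_smooth)
    have 1: "(\<lambda>n. LINT x|lebesgue_on \<Omega>. \<phi> n x * partial_deriv i \<psi> x)
        \<longlonglongrightarrow> (LINT x|lebesgue_on \<Omega>. u x * partial_deriv i \<psi> x)"
      using l1 by (intro tendsto_integral_mult_bounded[OF int(1,3) _ m[OF smooth_partial_deriv[OF t(1)]] D]) simp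
    have 2: "(\<lambda>n. LINT x|lebesgue_on \<Omega>. grad (\<phi> n) x $ i * \<psi> x)
        \<longlonglongrightarrow> (LINT x|lebesgue_on \<Omega>. g x $ i * \<psi> x)"
      using int unfolding cart_eq_inner_axis
      by (intro tendsto_integral_mult_bounded[OF _ _ _ m[OF t(1)] C] l2i[unfolded cart_eq_inner_axis]) auto
    have 3: "(LINT x|lebesgue_on \<Omega>. \<phi> n x * partial_deriv i \<psi> x) = - (LINT x|lebesgue_on \<Omega>. grad (\<phi> n) x $ i * \<psi> x)" for n
      using has_weak_gradient_test[OF \<Omega>(1) test_functionsD(1)[OF \<phi>(1)]] \<psi> by (simp add: has_weak_gradient_def)
    show "(LINT x|lebesgue_on \<Omega>. u x * partial_deriv i \<psi> x) = - (LINT x|lebesgue_on \<Omega>. g x $ i * \<psi> x)"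
      by (rule LIMSEQ_unique[OF 1]) (use tendsto_minus[OF 2] in \<open>simp add: 3\<close>)
  qed
qed

section \<open>Zero boundary values and the chain rule\<close>

lemma measurable_AE_on:
  fixes g :: "real^'n \<Rightarrow> 'b::euclidean_space"
  assumes "open \<Omega>" "g \<in> borel_measurable (lebesgue_on \<Omega>)" "AE x in lebesgue_on \<Omega>. f x = g x"
  shows "f \<in> borel_measurable (lebesgue_on \<Omega>)"
proof -
  have m: "\<Omega> \<in> sets lebesgue" using assms by auto
  have "(\<lambda>x. if x \<in> \<Omega> then g x else 0) \<in> borel_measurable lebesgue"
    using assms(2) m by (simp add: borel_measurable_if)
  moreover have "AE x in lebesgue. (if x \<in> \<Omega> then g x else 0) = (if x \<in> \<Omega> then f x else 0)"
    using assms(3) m by (auto simp: AE_restrict_space_iff elim: eventually_mono)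
  ultimately have "(\<lambda>x. if x \<in> \<Omega> then f x else 0) \<in> borel_measurable lebesgue"
    by (rule borel_measurable_AE)
  then show ?thesis using m by (simp add: borel_measurable_if)
qed

text \<open>The Sobolev norm of the difference is defined through the gradient chosen for the difference, which is related to
\<open>g\<close> by the uniqueness of weak gradients only. With this formula, the pairs in \<^const>\<open>W0\<close> are identified with the
functions in \<^const>\<open>sobolev0\<close> and their gradients.\<close>

lemma sobolev_norm_diff_test:
  fixes u :: "real^'n \<Rightarrow> real"
  assumes \<Omega>: "open \<Omega>" and p: "1 < p" and g: "has_weak_gradient \<Omega> u g" "g \<in> Lp \<Omega> p"
    and \<phi>: "\<phi> \<in> test_functions \<Omega>"
  shows "sobolev_norm \<Omega> p (\<lambda>x. u x - \<phi> x) =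
      ((LINT x|lebesgue_on \<Omega>. norm (u x - \<phi> x) powr p) +
       (LINT x|lebesgue_on \<Omega>. norm (g x - grad \<phi> x) powr p)) powr (1 / p)"
proof -
  have d: "has_weak_gradient \<Omega> (\<lambda>x. u x - \<phi> x) (\<lambda>x. g x - grad \<phi> x)"
    by (rule has_weak_gradient_diff[OF \<Omega> g(1) has_weak_gradient_test[OF \<Omega> test_functionsD(1)[OF \<phi>]]])
  note ae = weak_gradient_AE[OF \<Omega> d]
  have gm: "(\<lambda>x. g x - grad \<phi> x) \<in> borel_measurable (lebesgue_on \<Omega>)"
    using p by (intro LpD(1)[OF Lp_diff[OF g(2) test_in_Lp(2)[OF \<Omega> \<phi>]]]) auto
  have "(LINT x|lebesgue_on \<Omega>. norm (weak_gradient \<Omega> (\<lambda>x. u x - \<phi> x) x) powr p)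
     = (LINT x|lebesgue_on \<Omega>. norm (g x - grad \<phi> x) powr p)"
  proof (rule integral_cong_AE)
    show "AE x in lebesgue_on \<Omega>. norm (weak_gradient \<Omega> (\<lambda>x. u x - \<phi> x) x) powr p = norm (g x - grad \<phi> x) powr p"
      using ae(2) by eventually_elim simp
  qed (use gm measurable_AE_on[OF \<Omega> gm ae(2)] in measurable)
  then show ?thesis by (simp add: sobolev_norm_def)
qed

lemma W0_imp_sobolev0:
  fixes u :: "real^'n \<Rightarrow> real"
  assumes \<Omega>: "open \<Omega>" "bounded \<Omega>" and p: "1 < p" and W: "W0 \<Omega> p u g"
  shows "u \<in> sobolev0 \<Omega> p" "AE x in lebesgue_on \<Omega>. weak_gradient \<Omega> u x = g x"
proof -
  have wg: "has_weak_gradient \<Omega> u g" by (rule W0_has_weak_gradient[OF \<Omega> p W])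
  show "AE x in lebesgue_on \<Omega>. weak_gradient \<Omega> u x = g x" by (rule weak_gradient_AE[OF \<Omega>(1) wg])
  obtain \<phi> where \<phi>: "\<And>n. \<phi> n \<in> test_functions \<Omega>"
    "(\<lambda>n. LINT x|lebesgue_on \<Omega>. norm (u x - \<phi> n x) powr p) \<longlonglongrightarrow> 0"
    "(\<lambda>n. LINT x|lebesgue_on \<Omega>. norm (g x - grad (\<phi> n) x) powr p) \<longlonglongrightarrow> 0"
    and Lp: "u \<in> Lp \<Omega> p" "g \<in> Lp \<Omega> p"
    using W unfolding W0_def by blast
  note norm_eq = sobolev_norm_diff_test[OF \<Omega>(1) p wg Lp(2) \<phi>(1)]
  have "(\<lambda>n. sobolev_norm \<Omega> p (\<lambda>x. u x - \<phi> n x)) \<longlonglongrightarrow> (0 + 0) powr (1 / p)"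
    unfolding norm_eq using p
    by (intro tendsto_powr' tendsto_add \<phi> tendsto_const)
       (auto intro!: always_eventually add_nonneg_nonneg Bochner_Integration.integral_nonneg)
  then have lim: "(\<lambda>n. sobolev_norm \<Omega> p (\<lambda>x. u x - \<phi> n x)) \<longlonglongrightarrow> 0" by simp
  show "u \<in> sobolev0 \<Omega> p"
    unfolding sobolev0_def
  proof (intro CollectI conjI allI impI)
    show "u \<in> sobolev \<Omega> p" using Lp wg by (auto simp: sobolev_def)
    fix e :: real assume "0 < e"
    then have "\<forall>\<^sub>F n in sequentially. sobolev_norm \<Omega> p (\<lambda>x. u x - \<phi> n x) < e"
      by (rule order_tendstoD(2)[OF lim])
    then show "\<exists>\<phi>\<in>test_functions \<Omega>. sobolev_norm \<Omega> p (\<lambda>x. u x - \<phi> x) < e"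
      using \<phi>(1) eventually_happens'[OF sequentially_bot] by blast
  qed
qed


lemma sobolev0_imp_W0:
  fixes u :: "real^'n \<Rightarrow> real"
  assumes \<Omega>: "open \<Omega>" and p: "1 < p" and u: "u \<in> sobolev0 \<Omega> p"
  shows "W0 \<Omega> p u (weak_gradient \<Omega> u)"
proof -
  obtain g where g: "u \<in> Lp \<Omega> p" "g \<in> Lp \<Omega> p" "has_weak_gradient \<Omega> u g"
    using u by (auto simp: sobolev0_def sobolev_def)
  note ae = weak_gradient_AE[OF \<Omega> g(3)]
  let ?D = "weak_gradient \<Omega> u"
  have Dm: "?D \<in> borel_measurable (lebesgue_on \<Omega>)"
    by (rule measurable_AE_on[OF \<Omega> LpD(1)[OF g(2)] ae(2)])
  have "integrable (lebesgue_on \<Omega>) (\<lambda>x. norm (?D x) powr p)"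
  proof (rule integrable_cong_AE_imp[OF LpD(2)[OF g(2)]])
    show "AE x in lebesgue_on \<Omega>. norm (g x) powr p = norm (?D x) powr p"
      using ae(2) by eventually_elim simp
  qed (use Dm in measurable)
  with Dm have DL: "?D \<in> Lp \<Omega> p" by (simp add: Lp_def)
  have "\<forall>n. \<exists>\<phi>\<in>test_functions \<Omega>. sobolev_norm \<Omega> p (\<lambda>x. u x - \<phi> x) < inverse (real (Suc n))"
    using u by (auto simp: sobolev0_def)
  then obtain \<phi> where \<phi>: "\<And>n. \<phi> n \<in> test_functions \<Omega>"
    and lt: "\<And>n. sobolev_norm \<Omega> p (\<lambda>x. u x - \<phi> n x) < inverse (real (Suc n))"
    by metis
  define a where "a n = (LINT x|lebesgue_on \<Omega>. norm (u x - \<phi> n x) powr p)" for n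
  define b where "b n = (LINT x|lebesgue_on \<Omega>. norm (?D x - grad (\<phi> n) x) powr p)" for n
  have nn: "0 \<le> a n" "0 \<le> b n" for n
    by (auto simp: a_def b_def intro!: Bochner_Integration.integral_nonneg)
  have norm_eq: "sobolev_norm \<Omega> p (\<lambda>x. u x - \<phi> n x) = (a n + b n) powr (1 / p)" for n
    unfolding a_def b_def by (rule sobolev_norm_diff_test[OF \<Omega> p ae(1) DL \<phi>])
  have le: "a n + b n \<le> inverse (real (Suc n))" for n
  proof -
    have "a n + b n = ((a n + b n) powr (1 / p)) powr p"
      using nn[of n] p by (simp add: powr_powr)
    also have "\<dots> \<le> inverse (real (Suc n)) powr p"
      using lt[of n] p unfolding norm_eq by (intro powr_mono2) auto
    also have "\<dots> \<le> inverse (real (Suc n)) powr 1"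
      using p by (intro powr_mono') (auto simp: field_simps)
    finally show ?thesis by simp
  qed
  have le': "a n \<le> inverse (real (Suc n))" "b n \<le> inverse (real (Suc n))" for n
    using nn[of n] le[of n] by linarith+
  have "a \<longlonglongrightarrow> 0"
    by (rule tendsto_sandwich[OF _ _ tendsto_const LIMSEQ_inverse_real_of_nat])
       (use nn le' in auto)
  moreover have "b \<longlonglongrightarrow> 0"
    by (rule tendsto_sandwich[OF _ _ tendsto_const LIMSEQ_inverse_real_of_nat])
       (use nn le' in auto)
  ultimately show ?thesis
    unfolding W0_def using g(1) DL \<phi> by (auto simp: a_def[abs_def] b_def[abs_def])
qed

lemma W0_uminus:
  assumes "open \<Omega>" "1 < p" "W0 \<Omega> p u g"
  shows "W0 \<Omega> p (\<lambda>x. - u x) (\<lambda>x. - g x)"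
proof -
  obtain \<phi> where \<phi>: "\<And>n. \<phi> n \<in> test_functions \<Omega>"
    "(\<lambda>n. LINT x|lebesgue_on \<Omega>. norm (u x - \<phi> n x) powr p) \<longlonglongrightarrow> 0"
    "(\<lambda>n. LINT x|lebesgue_on \<Omega>. norm (g x - grad (\<phi> n) x) powr p) \<longlonglongrightarrow> 0"
    and Lp: "u \<in> Lp \<Omega> p" "g \<in> Lp \<Omega> p"
    using assms unfolding W0_def by blast
  define \<psi> where "\<psi> n x = 0 - \<phi> n x" for n x
  have t: "\<psi> n \<in> test_functions \<Omega>" for n
    using test_functionsD[OF \<phi>(1)[of n]] unfolding \<psi>_def
    by (intro test_functionsI[of _ "supp (\<phi> n)"] smooth_diff smooth_const) (auto dest: supp_vanish[of _ "\<phi> n"])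
  have g: "grad (\<psi> n) x = - grad (\<phi> n) x" for n x
  proof -
    have "partial_deriv i (\<psi> n) x = - partial_deriv i (\<phi> n) x" for i
    proof -
      have "((\<lambda>x. - \<phi> n x) has_derivative (\<lambda>h. - (grad (\<phi> n) x \<bullet> h))) (at x)"
        by (intro has_derivative_minus has_derivative_grad smooth_differentiable test_functionsD[OF \<phi>(1)])
      from partial_deriv_eqI[OF this, of i] show ?thesis
        by (simp add: \<psi>_def[abs_def] inner_axis grad_def)
    qed
    then show ?thesis by (simp add: grad_def vec_eq_iff)
  qed
  have "norm (- u x - \<psi> n x) = norm (u x - \<phi> n x)" "norm (- g x - grad (\<psi> n) x) = norm (g x - grad (\<phi> n) x)" for n x
    unfolding g by (simp_all add: \<psi>_def norm_minus_commute)
  with \<phi> t Lp show ?thesis unfolding W0_def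
    by (intro conjI exI[of _ \<psi>]) (auto simp: Lp_def)
qed

lemma grad_compose:
  assumes "f differentiable (at x)" "(F has_real_derivative d) (at (f x))"
  shows "grad (\<lambda>x. F (f x)) x = d *\<^sub>R grad f x"
  by (simp add: grad_def vec_eq_iff partial_deriv_compose[OF assms])

text \<open>Composition with \<open>F\<close> maps test functions to test functions because \<open>F\<close> is smooth and vanishes at \<open>0\<close>. In
the gradients \<open>F'(\<phi>\<^sub>n) \<nabla>\<phi>\<^sub>n\<close> the second factor converges in \<open>L\<^sup>p\<close>, and the first converges boundedly
almost everywhere.\<close>

lemma W0_compose:
  fixes u :: "real^'n \<Rightarrow> real"
  assumes \<Omega>: "open \<Omega>" and p: "1 < p" and W: "W0 \<Omega> p u g"
    and F: "\<And>s. (F has_real_derivative F' s) (at s)" "F 0 = 0" "\<And>s. \<bar>F' s\<bar> \<le> c" "\<And>s. isCont F' s"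
    and sm: "\<And>f :: real^'n \<Rightarrow> real. smooth f \<Longrightarrow> smooth (\<lambda>x. F (f x))"
  shows "W0 \<Omega> p (\<lambda>x. F (u x)) (\<lambda>x. F' (u x) *\<^sub>R g x)"
proof -
  obtain \<phi> where \<phi>: "\<And>n. \<phi> n \<in> test_functions \<Omega>"
    "(\<lambda>n. LINT x|lebesgue_on \<Omega>. norm (u x - \<phi> n x) powr p) \<longlonglongrightarrow> 0"
    "(\<lambda>n. LINT x|lebesgue_on \<Omega>. norm (g x - grad (\<phi> n) x) powr p) \<longlonglongrightarrow> 0"
    and ae: "AE x in lebesgue_on \<Omega>. (\<lambda>n. \<phi> n x) \<longlonglongrightarrow> u x"
    by (rule W0_AE_approx[OF \<Omega> p W]) blast
  have Lp: "u \<in> Lp \<Omega> p" "g \<in> Lp \<Omega> p" using W by (auto simp: W0_def)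
  have p0: "0 < p" using p by simp
  have c: "0 \<le> c" using F(3) abs_ge_zero order_trans by blast
  have lip: "\<bar>F s - F t\<bar> \<le> c * \<bar>s - t\<bar>" for s t
  proof -
    have "norm (F s - F t) \<le> c * norm (s - t)"
    proof (rule differentiable_bound[of UNIV])
      show "(F has_derivative (\<lambda>h. F' x * h)) (at x within UNIV)" for x
        using F(1)[of x] by (simp add: has_field_derivative_def)
      show "onorm (\<lambda>h. F' x * h) \<le> c" for x
        by (rule onorm_bound[OF c]) (simp add: abs_mult mult_right_mono F(3))
    qed auto
    then show ?thesis by simp
  qed
  have "continuous_on UNIV F" "continuous_on UNIV F'"
    using DERIV_isCont[OF F(1)] F(4) by (auto simp: continuous_on_eq_continuous_at)
  then have [measurable]: "F \<in> borel_measurable borel" "F' \<in> borel_measurable borel"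
    by (auto intro: borel_measurable_continuous_onI)
  note [measurable] = LpD(1)[OF Lp(1)] LpD(1)[OF Lp(2)]
    LpD(1)[OF test_in_Lp(1)[OF \<Omega> \<phi>(1) p]] LpD(1)[OF test_in_Lp(2)[OF \<Omega> \<phi>(1) p]]
  define \<psi> where "\<psi> n x = F (\<phi> n x)" for n x
  have t: "\<psi> n \<in> test_functions \<Omega>" for n
    using test_functionsD[OF \<phi>(1)[of n]] F(2) unfolding \<psi>_def
    by (intro test_functionsI[of _ "supp (\<phi> n)"] sm) (auto dest: supp_vanish[of _ "\<phi> n"])
  have gr: "grad (\<psi> n) x = F' (\<phi> n x) *\<^sub>R grad (\<phi> n) x" for n x
    unfolding \<psi>_def using grad_compose[OF smooth_differentiable[OF test_functionsD(1)[OF \<phi>(1)]] F(1)] .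
  have L1: "(\<lambda>x. F (u x)) \<in> Lp \<Omega> p"
    by (rule Lp_bound[OF Lp(1) _ c p0]) (use lip[of _ 0] F(2) in auto)
  have L2: "(\<lambda>x. F' (u x) *\<^sub>R g x) \<in> Lp \<Omega> p"
    by (rule Lp_bound[OF Lp(2) _ c p0]) (auto intro!: mult_right_mono F(3))
  have c1: "(\<lambda>n. LINT x|lebesgue_on \<Omega>. norm (F (u x) - \<psi> n x) powr p) \<longlonglongrightarrow> 0"
  proof (rule tendsto_sandwich[OF _ _ tendsto_const])
    show "(\<lambda>n. c powr p * (LINT x|lebesgue_on \<Omega>. norm (u x - \<phi> n x) powr p)) \<longlonglongrightarrow> 0"
      using tendsto_mult_left[OF \<phi>(2), of "c powr p"] by simp
    show "\<forall>\<^sub>F n in sequentially. 0 \<le> (LINT x|lebesgue_on \<Omega>. norm (F (u x) - \<psi> n x) powr p)"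
      by (intro always_eventually allI Bochner_Integration.integral_nonneg) simp
    have "(LINT x|lebesgue_on \<Omega>. norm (F (u x) - \<psi> n x) powr p)
        \<le> (LINT x|lebesgue_on \<Omega>. c powr p * norm (u x - \<phi> n x) powr p)" for n
    proof (rule integral_mono)
      show "integrable (lebesgue_on \<Omega>) (\<lambda>x. norm (F (u x) - \<psi> n x) powr p)"
        by (rule LpD(2)[OF Lp_diff[OF L1 test_in_Lp(1)[OF \<Omega> t p] p0]])
      show "integrable (lebesgue_on \<Omega>) (\<lambda>x. c powr p * norm (u x - \<phi> n x) powr p)"
        by (intro integrable_mult_right LpD(2)[OF Lp_diff[OF Lp(1) test_in_Lp(1)[OF \<Omega> \<phi>(1) p] p0]])
      fix x
      have "norm (F (u x) - \<psi> n x) powr p \<le> (c * norm (u x - \<phi> n x)) powr p"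
        using lip p0 unfolding \<psi>_def by (intro powr_mono2) auto
      then show "norm (F (u x) - \<psi> n x) powr p \<le> c powr p * norm (u x - \<phi> n x) powr p"
        using c by (simp add: powr_mult)
    qed
    then show "\<forall>\<^sub>F n in sequentially. (LINT x|lebesgue_on \<Omega>. norm (F (u x) - \<psi> n x) powr p)
        \<le> c powr p * (LINT x|lebesgue_on \<Omega>. norm (u x - \<phi> n x) powr p)" by simp
  qed
  define d where "d n x = (\<bar>F' (u x) - F' (\<phi> n x)\<bar> * norm (g x)) powr p" for n x
  have d_le: "d n x \<le> (2 * c) powr p * norm (g x) powr p" for n x
  proof -
    have "\<bar>F' (u x) - F' (\<phi> n x)\<bar> \<le> 2 * c" using F(3)[of "u x"] F(3)[of "\<phi> n x"] by linarith
    then have "d n x \<le> (2 * c * norm (g x)) powr p"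
      unfolding d_def using p0 by (intro powr_mono2 mult_right_mono) auto
    then show ?thesis using c by (simp add: powr_mult)
  qed
  have [measurable]: "d n \<in> borel_measurable (lebesgue_on \<Omega>)" for n unfolding d_def by measurable
  have gi: "integrable (lebesgue_on \<Omega>) (\<lambda>x. (2 * c) powr p * norm (g x) powr p)"
    by (intro integrable_mult_right LpD(2) Lp)
  have di: "integrable (lebesgue_on \<Omega>) (d n)" for n
    by (rule Bochner_Integration.integrable_bound[OF gi]) (use d_le in \<open>auto simp: d_def\<close>)
  have d0: "(\<lambda>n. LINT x|lebesgue_on \<Omega>. d n x) \<longlonglongrightarrow> (LINT x|lebesgue_on \<Omega>. 0)"
  proof (rule integral_dominated_convergence[OF _ _ gi])
    show "AE x in lebesgue_on \<Omega>. (\<lambda>n. d n x) \<longlonglongrightarrow> 0"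
      using ae
    proof eventually_elim
      case (elim x)
      have "(\<lambda>n. F' (\<phi> n x)) \<longlonglongrightarrow> F' (u x)" by (rule isCont_tendsto_compose[OF F(4) elim])
      then have "(\<lambda>n. \<bar>F' (u x) - F' (\<phi> n x)\<bar> * norm (g x)) \<longlonglongrightarrow> \<bar>F' (u x) - F' (u x)\<bar> * norm (g x)"
        by (intro tendsto_intros)
      then have "(\<lambda>n. d n x) \<longlonglongrightarrow> (\<bar>F' (u x) - F' (u x)\<bar> * norm (g x)) powr p"
        unfolding d_def using p0 by (intro tendsto_powr') auto
      then show ?case by simp
    qed
    show "AE x in lebesgue_on \<Omega>. norm (d n x) \<le> (2 * c) powr p * norm (g x) powr p" for n
      using d_le by (auto simp: d_def)
  qed auto
  have c2: "(\<lambda>n. LINT x|lebesgue_on \<Omega>. norm (F' (u x) *\<^sub>R g x - grad (\<psi> n) x) powr p) \<longlonglongrightarrow> 0"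
  proof (rule tendsto_sandwich[OF _ _ tendsto_const])
    have "(\<lambda>n. 2 powr p * ((LINT x|lebesgue_on \<Omega>. d n x) + c powr p * (LINT x|lebesgue_on \<Omega>. norm (g x - grad (\<phi> n) x) powr p)))
        \<longlonglongrightarrow> 2 powr p * ((LINT x|lebesgue_on \<Omega>. 0) + c powr p * 0)"
      by (intro tendsto_intros d0 \<phi>(3))
    then show "(\<lambda>n. 2 powr p * ((LINT x|lebesgue_on \<Omega>. d n x) + c powr p * (LINT x|lebesgue_on \<Omega>. norm (g x - grad (\<phi> n) x) powr p)))
        \<longlonglongrightarrow> 0" by simp
    show "\<forall>\<^sub>F n in sequentially. 0 \<le> (LINT x|lebesgue_on \<Omega>. norm (F' (u x) *\<^sub>R g x - grad (\<psi> n) x) powr p)"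
      by (intro always_eventually allI Bochner_Integration.integral_nonneg) simp
    have gi': "integrable (lebesgue_on \<Omega>) (\<lambda>x. norm (g x - grad (\<phi> n) x) powr p)" for n
      by (rule LpD(2)[OF Lp_diff[OF Lp(2) test_in_Lp(2)[OF \<Omega> \<phi>(1) p] p0]])
    have "(LINT x|lebesgue_on \<Omega>. norm (F' (u x) *\<^sub>R g x - grad (\<psi> n) x) powr p)
        \<le> (LINT x|lebesgue_on \<Omega>. 2 powr p * (d n x + c powr p * norm (g x - grad (\<phi> n) x) powr p))" for n
    proof (rule integral_mono)
      show "integrable (lebesgue_on \<Omega>) (\<lambda>x. norm (F' (u x) *\<^sub>R g x - grad (\<psi> n) x) powr p)"
        by (rule LpD(2)[OF Lp_diff[OF L2 test_in_Lp(2)[OF \<Omega> t p] p0]])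
      show "integrable (lebesgue_on \<Omega>) (\<lambda>x. 2 powr p * (d n x + c powr p * norm (g x - grad (\<phi> n) x) powr p))"
        by (intro integrable_mult_right Bochner_Integration.integrable_add di gi')
      fix x
      have "F' (u x) *\<^sub>R g x - grad (\<psi> n) x
          = (F' (u x) - F' (\<phi> n x)) *\<^sub>R g x + F' (\<phi> n x) *\<^sub>R (g x - grad (\<phi> n) x)"
        by (simp add: gr algebra_simps)
      then have "norm (F' (u x) *\<^sub>R g x - grad (\<psi> n) x)
          \<le> norm ((F' (u x) - F' (\<phi> n x)) *\<^sub>R g x) + norm (F' (\<phi> n x) *\<^sub>R (g x - grad (\<phi> n) x))"
        by (simp only: norm_triangle_ineq)
      also have "\<dots> \<le> \<bar>F' (u x) - F' (\<phi> n x)\<bar> * norm (g x) + c * norm (g x - grad (\<phi> n) x)"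
        by (auto intro!: add_mono mult_right_mono F(3))
      finally have "norm (F' (u x) *\<^sub>R g x - grad (\<psi> n) x) powr p
          \<le> (\<bar>F' (u x) - F' (\<phi> n x)\<bar> * norm (g x) + c * norm (g x - grad (\<phi> n) x)) powr p"
        using p0 by (intro powr_mono2) auto
      also have "\<dots> \<le> 2 powr p * (d n x + (c * norm (g x - grad (\<phi> n) x)) powr p)"
        unfolding d_def using c p0 by (intro powr_add_le) auto
      finally show "norm (F' (u x) *\<^sub>R g x - grad (\<psi> n) x) powr p
          \<le> 2 powr p * (d n x + c powr p * norm (g x - grad (\<phi> n) x) powr p)"
        using c by (simp add: powr_mult)
    qed
    then have "(LINT x|lebesgue_on \<Omega>. norm (F' (u x) *\<^sub>R g x - grad (\<psi> n) x) powr p) \<le> 2 powr p * ((LINT x|lebesgue_on \<Omega>. d n x) + c powr p * (LINT x|lebesgue_on \<Omega>. norm (g x - grad (\<phi> n) x) powr p))" for n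
      using di gi' by simp
    then show "\<forall>\<^sub>F n in sequentially. (LINT x|lebesgue_on \<Omega>. norm (F' (u x) *\<^sub>R g x - grad (\<psi> n) x) powr p)
        \<le> 2 powr p * ((LINT x|lebesgue_on \<Omega>. d n x) + c powr p * (LINT x|lebesgue_on \<Omega>. norm (g x - grad (\<phi> n) x) powr p))"
      by simp
  qed
  show ?thesis unfolding W0_def using L1 L2 t c1 c2 by blast
qed

section \<open>Truncations and level sets\<close>

lemma antiderivative_flat0:
  obtains P where "\<And>t. (P has_real_derivative flat 0 t) (at t)" "P 0 = 0"
proof -
  have "isCont (flat 0) t" for t by (rule DERIV_isCont[OF flat_has_derivative])
  then obtain P where P: "\<And>t. (P has_vector_derivative flat 0 t) (at t)"
    using einterval_antiderivative[of "-\<infinity>" "\<infinity>" "flat 0"] by auto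
  then have "((\<lambda>s. P s - P 0) has_real_derivative flat 0 t) (at t)" for t
    using DERIV_diff[OF _ DERIV_const, of P "flat 0 t" t UNIV "P 0"]
    by (simp add: has_real_derivative_iff_has_vector_derivative)
  then show thesis using that[of "\<lambda>s. P s - P 0"] by simp
qed

text \<open>An antiderivative of the flat function; rescaled, it gives smooth approximations of positive parts.\<close>

definition flat_int :: "real \<Rightarrow> real" where
  "flat_int = (SOME P. (\<forall>t. (P has_real_derivative flat 0 t) (at t)) \<and> P 0 = 0)"

lemma flat_int: "(flat_int has_real_derivative flat 0 t) (at t)" "flat_int 0 = 0"
proof -
  have "\<exists>P. (\<forall>t. (P has_real_derivative flat 0 t) (at t)) \<and> P 0 = 0"
    using antiderivative_flat0 by metis
  from someI_ex[OF this] show "(flat_int has_real_derivative flat 0 t) (at t)" "flat_int 0 = 0"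
    by (auto simp: flat_int_def)
qed

lemma flat_int_nonpos:
  assumes "t \<le> 0" shows "flat_int t = 0"
proof (cases "t = 0")
  case False
  then have t: "t < 0" using assms by simp
  have "\<exists>z. t < z \<and> z < 0 \<and> flat_int 0 - flat_int t = (0 - t) * flat 0 z"
    using flat_int(1) t by (intro MVT2) auto
  then show ?thesis by (auto simp: flat_def flat_int)
qed (simp add: flat_int)

lemma flat_int_asymp: "((\<lambda>y. flat_int y / y) \<longlongrightarrow> 1) at_top"
proof (rule lhospital_at_top_at_top)
  show "filterlim (\<lambda>y::real. y) at_top at_top" by (rule filterlim_ident)
  show "\<forall>\<^sub>F x in at_top. (1::real) \<noteq> 0" by simp
  show "\<forall>\<^sub>F x in at_top. (flat_int has_real_derivative flat 0 x) (at x)" using flat_int by simp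
  show "\<forall>\<^sub>F x in at_top. ((\<lambda>y. y) has_real_derivative 1) (at x)" by simp
  have "((\<lambda>x::real. exp (- inverse x)) \<longlongrightarrow> exp (- 0)) at_top"
    by (intro tendsto_intros tendsto_inverse_0_at_top filterlim_ident)
  then have "((\<lambda>x::real. exp (- inverse x)) \<longlongrightarrow> 1) at_top" by simp
  then show "((\<lambda>x. flat 0 x / 1) \<longlongrightarrow> 1) at_top"
    by (rule Lim_transform_eventually)
       (use eventually_gt_at_top[of 0] in eventually_elim, simp add: flat_def divide_inverse)
qed

definition ramp :: "nat \<Rightarrow> real \<Rightarrow> real \<Rightarrow> real" where
  "ramp n k s = flat_int (real (Suc n) * (s - k)) / real (Suc n)"

lemma ramp_has_derivative: "(ramp n k has_real_derivative flat 0 (real (Suc n) * (s - k))) (at s)"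
proof -
  have "((\<lambda>s. flat_int (real (Suc n) * (s - k))) has_real_derivative
      flat 0 (real (Suc n) * (s - k)) * real (Suc n)) (at s)"
    by (rule DERIV_chain2[OF flat_int(1)]) (auto intro!: derivative_eq_intros)
  from DERIV_cdivide[OF this, of "real (Suc n)"] show ?thesis
    unfolding ramp_def by (simp del: of_nat_Suc)
qed

lemma ramp_le: "s \<le> k \<Longrightarrow> ramp n k s = 0"
  by (simp add: ramp_def flat_int_nonpos mult_le_0_iff)

lemma ramp_bound: "\<bar>ramp n k s\<bar> \<le> max (s - k) 0"
proof (cases "s \<le> k")
  case False
  then have "k < s" by simp
  have "\<exists>z. k < z \<and> z < s \<and> ramp n k s - ramp n k k = (s - k) * flat 0 (real (Suc n) * (z - k))"
    using \<open>k < s\<close> ramp_has_derivative by (intro MVT2) auto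
  then obtain z where z: "ramp n k s = (s - k) * flat 0 (real (Suc n) * (z - k))"
    by (auto simp: ramp_le)
  then show ?thesis
    unfolding z using False flat0_bounds[of "real (Suc n) * (z - k)"]
    by (auto simp: abs_mult max_def mult_left_le)
qed (simp add: ramp_le)

lemma ramp_limit: "(\<lambda>n. ramp n k s) \<longlonglongrightarrow> max (s - k) 0"
proof (cases "s \<le> k")
  case False
  then have c: "0 < s - k" by simp
  have "filterlim (\<lambda>n. (s - k) * real (Suc n)) at_top sequentially"
    by (rule filterlim_tendsto_pos_mult_at_top[OF tendsto_const c
          filterlim_compose[OF filterlim_real_sequentially filterlim_Suc]])
  then have "filterlim (\<lambda>n. real (Suc n) * (s - k)) at_top sequentially"
    by (simp only: mult.commute)
  from filterlim_compose[OF flat_int_asymp this]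
  have "(\<lambda>n. (s - k) * (flat_int (real (Suc n) * (s - k)) / (real (Suc n) * (s - k)))) \<longlonglongrightarrow> (s - k) * 1"
    by (intro tendsto_intros)
  moreover have "(s - k) * (flat_int (real (Suc n) * (s - k)) / (real (Suc n) * (s - k))) = ramp n k s" for n
    unfolding ramp_def using c by (simp del: of_nat_Suc)
  ultimately show ?thesis using c by simp
qed (simp add: ramp_le)

lemma flat_affine_limit: "(\<lambda>n. flat 0 (real (Suc n) * (s - k))) \<longlonglongrightarrow> (if k < s then 1 else 0)"
  using flat0_limit[of "s - k"] by simp

lemma smooth_ramp:
  assumes "smooth f" shows "smooth (\<lambda>x. ramp n k (f x))"
  by (rule smooth_compose_antiderivative[OF assms ramp_has_derivative])
     (intro smooth_flat_compose smooth_mult smooth_const smooth_diff assms)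

lemma isCont_flat_affine: "isCont (\<lambda>s. flat 0 (real (Suc n) * (s - k))) s"
  by (rule isCont_o2[OF _ DERIV_isCont[OF flat_has_derivative], of _ "\<lambda>s. real (Suc n) * (s - k)"])
     (auto intro!: continuous_intros)

lemma W0_ramp:
  fixes u :: "real^'n \<Rightarrow> real"
  assumes "open \<Omega>" "1 < p" "W0 \<Omega> p u g" "0 \<le> k"
  shows "W0 \<Omega> p (\<lambda>x. ramp n k (u x)) (\<lambda>x. flat 0 (real (Suc n) * (u x - k)) *\<^sub>R g x)"
proof (rule W0_compose[OF assms(1-3), where c=1])
  show "(ramp n k has_real_derivative flat 0 (real (Suc n) * (s - k))) (at s)" for s
    by (rule ramp_has_derivative)
  show "ramp n k 0 = 0" using assms(4) by (simp add: ramp_le)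
  show "\<bar>flat 0 (real (Suc n) * (s - k))\<bar> \<le> 1" for s using flat0_bounds by (simp add: abs_of_nonneg)
  show "isCont (\<lambda>s. flat 0 (real (Suc n) * (s - k))) s" for s by (rule isCont_flat_affine)
qed (rule smooth_ramp)

lemma W0_layer:
  fixes u :: "real^'n \<Rightarrow> real"
  assumes "open \<Omega>" "1 < p" "W0 \<Omega> p u g" "0 \<le> k" "k \<le> h"
  shows "W0 \<Omega> p (\<lambda>x. ramp n k (u x) - ramp n h (u x))
    (\<lambda>x. (flat 0 (real (Suc n) * (u x - k)) - flat 0 (real (Suc n) * (u x - h))) *\<^sub>R g x)"
proof (rule W0_compose[OF assms(1-3), where c=1])
  show "((\<lambda>s. ramp n k s - ramp n h s) has_real_derivative
      flat 0 (real (Suc n) * (s - k)) - flat 0 (real (Suc n) * (s - h))) (at s)" for s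
    by (intro DERIV_diff ramp_has_derivative)
  show "ramp n k 0 - ramp n h 0 = 0" using assms(4,5) by (simp add: ramp_le)
  show "\<bar>flat 0 (real (Suc n) * (s - k)) - flat 0 (real (Suc n) * (s - h))\<bar> \<le> 1" for s
    using flat0_bounds[of "real (Suc n) * (s - k)"] flat0_bounds[of "real (Suc n) * (s - h)"] by linarith
  show "isCont (\<lambda>s. flat 0 (real (Suc n) * (s - k)) - flat 0 (real (Suc n) * (s - h))) s" for s
    by (intro continuous_diff isCont_flat_affine)
qed (intro smooth_diff smooth_ramp)

text \<open>The equation tested with the positive part of \<open>u - k\<close>. The test function is approximated by smooth ramps of \<open>u\<close>, and
\<open>u\<close> itself is an admissible test function that supplies the dominating functions.\<close>

lemma level_identity:
  fixes u :: "real^'n \<Rightarrow> real"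
  assumes \<Omega>: "open \<Omega>" and p: "1 < p" and W: "W0 \<Omega> p u g" and k: "0 \<le> k"
    and eq: "\<And>\<phi> \<gamma>. W0 \<Omega> p \<phi> \<gamma> \<Longrightarrow> integrable (lebesgue_on \<Omega>) (\<lambda>x. a x \<bullet> \<gamma> x) \<and>
       integrable (lebesgue_on \<Omega>) (\<lambda>x. b x * \<phi> x) \<and>
       (LINT x|lebesgue_on \<Omega>. a x \<bullet> \<gamma> x) = (LINT x|lebesgue_on \<Omega>. b x * \<phi> x)"
  shows "integrable (lebesgue_on \<Omega>) (\<lambda>x. indicator {x. k < u x} x * (a x \<bullet> g x))"
    "integrable (lebesgue_on \<Omega>) (\<lambda>x. b x * max (u x - k) 0)"
    "(LINT x|lebesgue_on \<Omega>. indicator {x. k < u x} x * (a x \<bullet> g x)) = (LINT x|lebesgue_on \<Omega>. b x * max (u x - k) 0)"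
proof -
  let ?M = "lebesgue_on \<Omega>"
  define F where "F n x = flat 0 (real (Suc n) * (u x - k))" for n x
  note eq0 = eq[OF W]
  note eqn = eq[OF W0_ramp[OF \<Omega> p W k], folded F_def]
  have um[measurable]: "u \<in> borel_measurable ?M" using W by (auto simp: W0_def Lp_def)
  have ind: "(indicator {x. k < u x} x :: real) = (if k < u x then 1 else 0)" for x by simp
  have lim1: "(\<lambda>n. a x \<bullet> (F n x *\<^sub>R g x)) \<longlonglongrightarrow> indicator {x. k < u x} x * (a x \<bullet> g x)" for x
    unfolding F_def inner_scaleR_right ind by (intro tendsto_mult flat_affine_limit tendsto_const)
  have lim2: "(\<lambda>n. b x * ramp n k (u x)) \<longlonglongrightarrow> b x * max (u x - k) 0" for x
    by (intro tendsto_mult ramp_limit tendsto_const)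
  have m1[measurable]: "(\<lambda>x. indicator {x. k < u x} x * (a x \<bullet> g x)) \<in> borel_measurable ?M"
    by (rule borel_measurable_LIMSEQ_real[OF lim1]) (use eqn in auto)
  have m2[measurable]: "(\<lambda>x. b x * max (u x - k) 0) \<in> borel_measurable ?M"
    by (rule borel_measurable_LIMSEQ_real[OF lim2]) (use eqn in auto)
  have w1: "integrable ?M (\<lambda>x. \<bar>a x \<bullet> g x\<bar>)" and w2: "integrable ?M (\<lambda>x. \<bar>b x * u x\<bar>)"
    using eq0 by auto
  have b1: "norm (a x \<bullet> (F n x *\<^sub>R g x)) \<le> \<bar>a x \<bullet> g x\<bar>" for n x
    unfolding F_def using flat0_bounds[of "real (Suc n) * (u x - k)"] by (simp add: abs_mult mult_left_le_one_le)
  have b2: "norm (b x * ramp n k (u x)) \<le> \<bar>b x * u x\<bar>" for n x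
  proof -
    have "\<bar>ramp n k (u x)\<bar> \<le> \<bar>u x\<bar>" using ramp_bound[of n k "u x"] k by linarith
    then show ?thesis by (simp add: abs_mult mult_left_mono)
  qed
  show "integrable ?M (\<lambda>x. indicator {x. k < u x} x * (a x \<bullet> g x))"
    by (rule Bochner_Integration.integrable_bound[OF w1 m1]) (auto simp: indicator_def)
  show "integrable ?M (\<lambda>x. b x * max (u x - k) 0)"
    by (rule Bochner_Integration.integrable_bound[OF w2 m2]) (use k in \<open>auto simp: abs_mult max_def intro!: mult_left_mono\<close>)
  have l1: "(\<lambda>n. LINT x|?M. a x \<bullet> (F n x *\<^sub>R g x)) \<longlonglongrightarrow> (LINT x|?M. indicator {x. k < u x} x * (a x \<bullet> g x))"
    by (rule integral_dominated_convergence[OF m1 _ w1]) (use eqn lim1 b1 in auto)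
  have l2: "(\<lambda>n. LINT x|?M. b x * ramp n k (u x)) \<longlonglongrightarrow> (LINT x|?M. b x * max (u x - k) 0)"
    by (rule integral_dominated_convergence[OF m2 _ w2]) (use eqn lim2 b2 in auto)
  show "(LINT x|?M. indicator {x. k < u x} x * (a x \<bullet> g x)) = (LINT x|?M. b x * max (u x - k) 0)"
    by (rule LIMSEQ_unique[OF l1]) (use l2 eqn in simp)
qed

text \<open>The bound for test functions carries over to limits. The factor \<open>2\<^sup>p\<close> comes from
comparing the gradients by the triangle inequality only.\<close>

lemma W0_set_bound:
  fixes u :: "real^'n \<Rightarrow> real"
  assumes \<Omega>: "open \<Omega>" "bounded \<Omega>" and p: "1 < p" and W: "W0 \<Omega> p u g"
    and R: "0 < R" and l: "0 < l" and E: "E \<in> sets (lebesgue_on \<Omega>)"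
  shows "measure lborel (cball (0::real^'n) R) * (LINT x|lebesgue_on \<Omega>. indicator E x * \<bar>u x\<bar>)
    \<le> measure (lebesgue_on \<Omega>) E * (LINT x|lebesgue_on \<Omega>. \<bar>u x\<bar>)
     + measure lborel (cball (0::real^'n) R) * (R * l * measure (lebesgue_on \<Omega>) E
     + R * l powr (1 - p) * (2 powr p * (LINT x|lebesgue_on \<Omega>. norm (g x) powr p)))"
proof -
  let ?M = "lebesgue_on \<Omega>"
  let ?b = "measure lborel (cball (0::real^'n) R)"
  obtain \<phi> where \<phi>: "\<And>n. \<phi> n \<in> test_functions \<Omega>"
    "(\<lambda>n. LINT x|?M. norm (u x - \<phi> n x) powr p) \<longlonglongrightarrow> 0"
    "(\<lambda>n. LINT x|?M. norm (g x - grad (\<phi> n) x) powr p) \<longlonglongrightarrow> 0"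
    and Lp: "u \<in> Lp \<Omega> p" "g \<in> Lp \<Omega> p"
    using W unfolding W0_def by blast
  have p0: "0 < p" using p by simp
  note t = test_in_Lp[OF \<Omega>(1) \<phi>(1) p]
  have ui0: "integrable ?M u" and \<phi>i0: "\<And>n. integrable ?M (\<phi> n)"
    using Lp_integrable[OF \<Omega> _ p] Lp t by auto
  then have ui: "integrable ?M (\<lambda>x. \<bar>u x\<bar>)" and \<phi>i: "\<And>n. integrable ?M (\<lambda>x. \<bar>\<phi> n x\<bar>)"
    by auto
  have di: "integrable ?M (\<lambda>x. norm (u x - \<phi> n x))" for n
    by (intro integrable_norm Lp_integrable[OF \<Omega> Lp_diff[OF Lp(1) t(1) p0] p])
  have L1: "(\<lambda>n. LINT x|?M. norm (u x - \<phi> n x)) \<longlonglongrightarrow> 0"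
    by (rule Lp_tendsto_L1[OF \<Omega> p Lp_diff[OF Lp(1) t(1) p0] \<phi>(2)])
  have abs: "(\<lambda>n. LINT x|?M. \<bar>\<bar>u x\<bar> - \<bar>\<phi> n x\<bar>\<bar>) \<longlonglongrightarrow> 0"
  proof (rule tendsto_sandwich[OF _ _ tendsto_const L1])
    show "\<forall>\<^sub>F n in sequentially. 0 \<le> (LINT x|?M. \<bar>\<bar>u x\<bar> - \<bar>\<phi> n x\<bar>\<bar>)"
      by (intro always_eventually allI Bochner_Integration.integral_nonneg) simp
    have "(LINT x|?M. \<bar>\<bar>u x\<bar> - \<bar>\<phi> n x\<bar>\<bar>) \<le> (LINT x|?M. norm (u x - \<phi> n x))" for n
      using ui \<phi>i ui0 \<phi>i0 by (intro integral_mono integrable_abs Bochner_Integration.integrable_diff) auto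
    then show "\<forall>\<^sub>F n in sequentially. (LINT x|?M. \<bar>\<bar>u x\<bar> - \<bar>\<phi> n x\<bar>\<bar>) \<le> (LINT x|?M. norm (u x - \<phi> n x))"
      by simp
  qed
  have E1: "(\<lambda>n. LINT x|?M. \<bar>\<phi> n x\<bar> * indicator E x) \<longlonglongrightarrow> (LINT x|?M. \<bar>u x\<bar> * indicator E x)"
    by (rule tendsto_integral_mult_bounded[OF ui \<phi>i abs, where C=1]) (use E in auto)
  have E2: "(\<lambda>n. LINT x|?M. \<bar>\<phi> n x\<bar> * 1) \<longlonglongrightarrow> (LINT x|?M. \<bar>u x\<bar> * 1)"
    by (rule tendsto_integral_mult_bounded[OF ui \<phi>i abs, where C=1]) auto
  define G where "G = (LINT x|?M. norm (g x) powr p)"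
  define e where "e n = (LINT x|?M. norm (g x - grad (\<phi> n) x) powr p)" for n
  have gr: "(LINT x|?M. norm (grad (\<phi> n) x) powr p) \<le> 2 powr p * (G + e n)" for n
  proof -
    have i: "integrable ?M (\<lambda>x. norm (g x) powr p)" "integrable ?M (\<lambda>x. norm (g x - grad (\<phi> n) x) powr p)"
      using LpD(2)[OF Lp(2)] LpD(2)[OF Lp_diff[OF Lp(2) t(2) p0]] by auto
    have "(LINT x|?M. norm (grad (\<phi> n) x) powr p)
        \<le> (LINT x|?M. 2 powr p * (norm (g x) powr p + norm (g x - grad (\<phi> n) x) powr p))"
    proof (rule integral_mono[OF LpD(2)[OF t(2)]])
      show "integrable ?M (\<lambda>x. 2 powr p * (norm (g x) powr p + norm (g x - grad (\<phi> n) x) powr p))"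
        using i by auto
      fix x
      have "norm (grad (\<phi> n) x) \<le> norm (g x) + norm (g x - grad (\<phi> n) x)"
        using norm_triangle_ineq4[of "g x" "g x - grad (\<phi> n) x"] by simp
      then have "norm (grad (\<phi> n) x) powr p \<le> (norm (g x) + norm (g x - grad (\<phi> n) x)) powr p"
        using p0 by (intro powr_mono2) auto
      also have "\<dots> \<le> 2 powr p * (norm (g x) powr p + norm (g x - grad (\<phi> n) x) powr p)"
        using p0 by (intro powr_add_le) auto
      finally show "norm (grad (\<phi> n) x) powr p \<le> 2 powr p * (norm (g x) powr p + norm (g x - grad (\<phi> n) x) powr p)" .
    qed
    also have "\<dots> = 2 powr p * (G + e n)" using i by (simp add: G_def e_def)
    finally show ?thesis .
  qed
  have "?b * (LINT x|?M. \<bar>u x\<bar> * indicator E x) \<le> measure ?M E * (LINT x|?M. \<bar>u x\<bar> * 1)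
     + ?b * (R * l * measure ?M E + R * l powr (1 - p) * (2 powr p * (G + 0)))"
  proof (rule LIMSEQ_le)
    show "(\<lambda>n. ?b * (LINT x|?M. \<bar>\<phi> n x\<bar> * indicator E x)) \<longlonglongrightarrow> ?b * (LINT x|?M. \<bar>u x\<bar> * indicator E x)"
      by (intro tendsto_mult tendsto_const E1)
    show "(\<lambda>n. measure ?M E * (LINT x|?M. \<bar>\<phi> n x\<bar> * 1)
        + ?b * (R * l * measure ?M E + R * l powr (1 - p) * (2 powr p * (G + e n)))) \<longlonglongrightarrow>
        measure ?M E * (LINT x|?M. \<bar>u x\<bar> * 1)
        + ?b * (R * l * measure ?M E + R * l powr (1 - p) * (2 powr p * (G + 0)))"
      using \<phi>(3) unfolding e_def[symmetric] by (intro tendsto_mult tendsto_add tendsto_const E2)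
    have "?b * (LINT x|?M. \<bar>\<phi> n x\<bar> * indicator E x) \<le> measure ?M E * (LINT x|?M. \<bar>\<phi> n x\<bar> * 1)
        + ?b * (R * l * measure ?M E + R * l powr (1 - p) * (2 powr p * (G + e n)))" for n
    proof -
      have "?b * (LINT x|?M. \<bar>\<phi> n x\<bar> * indicator E x) \<le> measure ?M E * (LINT x|?M. \<bar>\<phi> n x\<bar> * 1)
        + ?b * (R * l * measure ?M E + R * l powr (1 - p) * (LINT x|?M. norm (grad (\<phi> n) x) powr p))"
        using test_function_set_bound[OF \<Omega> \<phi>(1) R l p E, of n] by (simp add: mult.commute)
      also have "\<dots> \<le> measure ?M E * (LINT x|?M. \<bar>\<phi> n x\<bar> * 1)
        + ?b * (R * l * measure ?M E + R * l powr (1 - p) * (2 powr p * (G + e n)))"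
        using R gr by (intro add_left_mono mult_left_mono) auto
      finally show ?thesis .
    qed
    then show "\<exists>N. \<forall>n\<ge>N. ?b * (LINT x|?M. \<bar>\<phi> n x\<bar> * indicator E x) \<le> measure ?M E * (LINT x|?M. \<bar>\<phi> n x\<bar> * 1)
        + ?b * (R * l * measure ?M E + R * l powr (1 - p) * (2 powr p * (G + e n)))" by blast
  qed
  then show ?thesis by (simp add: G_def mult.commute)
qed


text \<open>The bound for the truncation of \<open>u\<close> between the levels \<open>k\<close> and \<open>h\<close>, which is \<open>h - k\<close> on \<open>{u > h}\<close>, at most \<open>h - k\<close>, and
zero outside \<open>{u > k}\<close>. Its gradient is \<open>g\<close> between the levels and zero elsewhere.\<close>

lemma layer_set_bound:
  fixes u :: "real^'n \<Rightarrow> real"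
  assumes \<Omega>: "open \<Omega>" "bounded \<Omega>" and p: "1 < p" and W: "W0 \<Omega> p u g"
    and R: "0 < R" and l: "0 < l" and k: "0 \<le> k" and h: "k < h"
  defines "a \<equiv> \<lambda>t. measure (lebesgue_on \<Omega>) {x \<in> \<Omega>. t < u x}"
  shows "measure lborel (cball (0::real^'n) R) * ((h - k) * a h)
    \<le> a h * ((h - k) * a k)
     + measure lborel (cball (0::real^'n) R) * (R * l * a h
     + R * l powr (1 - p) * (2 powr p * (LINT x|lebesgue_on \<Omega>. indicator {x. k < u x \<and> u x \<le> h} x * norm (g x) powr p)))"
proof -
  let ?M = "lebesgue_on \<Omega>"
  let ?b = "measure lborel (cball (0::real^'n) R)"
  interpret finite_measure ?M by (rule finite_measure_lebesgue_on_bounded[OF \<Omega>])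
  have Lp: "u \<in> Lp \<Omega> p" "g \<in> Lp \<Omega> p" using W by (auto simp: W0_def)
  note [measurable] = LpD(1)[OF Lp(1)] LpD(1)[OF Lp(2)]
  define E where "E t = {x \<in> \<Omega>. t < u x}" for t
  have Em[measurable]: "E t \<in> sets ?M" for t
  proof -
    have "{x \<in> space ?M. t < u x} \<in> sets ?M" by measurable
    then show ?thesis by (simp add: E_def)
  qed
  define T where "T n x = ramp n k (u x) - ramp n h (u x)" for n x
  define t where "t n x = flat 0 (real (Suc n) * (u x - k)) - flat 0 (real (Suc n) * (u x - h))" for n x
  define T' where "T' x = max (u x - k) 0 - max (u x - h) 0" for x
  have WT: "W0 \<Omega> p (T n) (\<lambda>x. t n x *\<^sub>R g x)" for n
    unfolding T_def t_def by (rule W0_layer[OF \<Omega>(1) p W k less_imp_le[OF h]])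
  note LT = WT[unfolded W0_def, THEN conjunct1] WT[unfolded W0_def, THEN conjunct2, THEN conjunct1]
  note [measurable] = LpD(1)[OF LT(1)] LpD(1)[OF LT(2)]
  have lim1: "(\<lambda>n. T n x) \<longlonglongrightarrow> T' x" for x
    unfolding T_def T'_def by (intro tendsto_diff ramp_limit)
  have lim2: "(\<lambda>n. t n x) \<longlonglongrightarrow> indicator {x. k < u x \<and> u x \<le> h} x" for x
  proof -
    have "(\<lambda>n. t n x) \<longlonglongrightarrow> (if k < u x then 1 else 0) - (if h < u x then 1 else 0)"
      unfolding t_def by (intro tendsto_diff flat_affine_limit)
    also have "(if k < u x then 1 else 0) - (if h < u x then 1 else 0) = (indicator {x. k < u x \<and> u x \<le> h} x :: real)"
      using h by (auto simp: indicator_def)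
    finally show ?thesis .
  qed
  have t1: "\<bar>t n x\<bar> \<le> 1" for n x
    using flat0_bounds[of "real (Suc n) * (u x - k)"] flat0_bounds[of "real (Suc n) * (u x - h)"]
    unfolding t_def by linarith
  have T2: "\<bar>T n x\<bar> \<le> 2 * \<bar>u x\<bar>" for n x
    using ramp_bound[of n k "u x"] ramp_bound[of n h "u x"] k h unfolding T_def by linarith
  have ui: "integrable ?M (\<lambda>x. 2 * \<bar>u x\<bar>)"
    using Lp_integrable[OF \<Omega> Lp(1) p] by auto
  have T'm[measurable]: "T' \<in> borel_measurable ?M" unfolding T'_def by measurable
  have c1: "(\<lambda>n. LINT x|?M. indicator (E h) x * \<bar>T n x\<bar>) \<longlonglongrightarrow> (LINT x|?M. indicator (E h) x * \<bar>T' x\<bar>)"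
  proof (rule integral_dominated_convergence[OF _ _ ui])
    show "AE x in ?M. (\<lambda>n. indicator (E h) x * \<bar>T n x\<bar>) \<longlonglongrightarrow> indicator (E h) x * \<bar>T' x\<bar>"
      by (intro AE_I2 tendsto_intros lim1)
    show "AE x in ?M. norm (indicator (E h) x * \<bar>T n x\<bar>) \<le> 2 * \<bar>u x\<bar>" for n
      using T2 by (intro AE_I2) (auto simp: indicator_def abs_mult)
  qed measurable
  have c2: "(\<lambda>n. LINT x|?M. \<bar>T n x\<bar>) \<longlonglongrightarrow> (LINT x|?M. \<bar>T' x\<bar>)"
  proof (rule integral_dominated_convergence[OF _ _ ui])
    show "AE x in ?M. (\<lambda>n. \<bar>T n x\<bar>) \<longlonglongrightarrow> \<bar>T' x\<bar>"
      by (intro AE_I2 tendsto_intros lim1)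
    show "AE x in ?M. norm (\<bar>T n x\<bar>) \<le> 2 * \<bar>u x\<bar>" for n
      using T2 by (intro AE_I2) auto
  qed measurable
  define D where "D = (LINT x|?M. indicator {x. k < u x \<and> u x \<le> h} x * norm (g x) powr p)"
  have c3: "(\<lambda>n. LINT x|?M. norm (t n x *\<^sub>R g x) powr p) \<longlonglongrightarrow> D"
    unfolding D_def
  proof (rule integral_dominated_convergence[OF _ _ LpD(2)[OF Lp(2)]])
    show "AE x in ?M. (\<lambda>n. norm (t n x *\<^sub>R g x) powr p) \<longlonglongrightarrow> indicator {x. k < u x \<and> u x \<le> h} x * norm (g x) powr p"
    proof (rule AE_I2)
      fix x
      have "(\<lambda>n. norm (t n x *\<^sub>R g x)) \<longlonglongrightarrow> norm (indicat_real {x. k < u x \<and> u x \<le> h} x *\<^sub>R g x)"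
        by (intro tendsto_intros lim2)
      then have "(\<lambda>n. norm (t n x *\<^sub>R g x) powr p) \<longlonglongrightarrow> norm (indicat_real {x. k < u x \<and> u x \<le> h} x *\<^sub>R g x) powr p"
        using p by (intro tendsto_powr') auto
      moreover have "norm (indicat_real {x. k < u x \<and> u x \<le> h} x *\<^sub>R g x) powr p
          = indicator {x. k < u x \<and> u x \<le> h} x * norm (g x) powr p"
        by (simp add: indicator_def)
      ultimately show "(\<lambda>n. norm (t n x *\<^sub>R g x) powr p) \<longlonglongrightarrow> indicator {x. k < u x \<and> u x \<le> h} x * norm (g x) powr p"
        by (simp only:)
    qed
    show "AE x in ?M. norm (norm (t n x *\<^sub>R g x) powr p) \<le> norm (g x) powr p" for n
      using p t1 by (auto intro!: powr_mono2 mult_left_le_one_le)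
  qed measurable
  have lim: "?b * (LINT x|?M. indicator (E h) x * \<bar>T' x\<bar>) \<le> measure ?M (E h) * (LINT x|?M. \<bar>T' x\<bar>)
     + ?b * (R * l * measure ?M (E h) + R * l powr (1 - p) * (2 powr p * D))"
  proof (rule LIMSEQ_le)
    show "(\<lambda>n. ?b * (LINT x|?M. indicator (E h) x * \<bar>T n x\<bar>)) \<longlonglongrightarrow> ?b * (LINT x|?M. indicator (E h) x * \<bar>T' x\<bar>)"
      by (intro tendsto_mult tendsto_const c1)
    show "(\<lambda>n. measure ?M (E h) * (LINT x|?M. \<bar>T n x\<bar>)
        + ?b * (R * l * measure ?M (E h) + R * l powr (1 - p) * (2 powr p * (LINT x|?M. norm (t n x *\<^sub>R g x) powr p))))
      \<longlonglongrightarrow> measure ?M (E h) * (LINT x|?M. \<bar>T' x\<bar>)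
        + ?b * (R * l * measure ?M (E h) + R * l powr (1 - p) * (2 powr p * D))"
      by (intro tendsto_mult tendsto_add tendsto_const c2 c3)
    show "\<exists>N. \<forall>n\<ge>N. ?b * (LINT x|?M. indicator (E h) x * \<bar>T n x\<bar>) \<le> measure ?M (E h) * (LINT x|?M. \<bar>T n x\<bar>)
        + ?b * (R * l * measure ?M (E h) + R * l powr (1 - p) * (2 powr p * (LINT x|?M. norm (t n x *\<^sub>R g x) powr p)))"
      using W0_set_bound[OF \<Omega> p WT R l Em] by blast
  qed
  have i1: "(LINT x|?M. indicator (E h) x * \<bar>T' x\<bar>) = (h - k) * measure ?M (E h)"
  proof -
    have "(LINT x|?M. indicator (E h) x * \<bar>T' x\<bar>) = (LINT x|?M. (h - k) * indicator (E h) x)"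
      using h by (intro Bochner_Integration.integral_cong) (auto simp: indicator_def T'_def E_def)
    also have "\<dots> = (h - k) * measure ?M (E h)"
      using sets.sets_into_space[OF Em] by (simp add: Int_absorb2)
    finally show ?thesis .
  qed
  have i2: "(LINT x|?M. \<bar>T' x\<bar>) \<le> (h - k) * measure ?M (E k)"
  proof -
    have "(LINT x|?M. \<bar>T' x\<bar>) \<le> (LINT x|?M. (h - k) * indicator (E k) x)"
    proof (rule integral_mono')
      show "integrable ?M (\<lambda>x. (h - k) * indicator (E k) x)"
        using Em by (intro integrable_mult_right integrable_real_indicator) (auto simp: less_top[symmetric])
      show "\<bar>T' x\<bar> \<le> (h - k) * indicator (E k) x" if "x \<in> space ?M" for x
        using h that by (auto simp: indicator_def T'_def E_def)
    qed (use h in auto)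
    also have "\<dots> = (h - k) * measure ?M (E k)"
      using sets.sets_into_space[OF Em] by (simp add: Int_absorb2)
    finally show ?thesis .
  qed
  have "?b * ((h - k) * measure ?M (E h)) \<le> measure ?M (E h) * ((h - k) * measure ?M (E k))
     + ?b * (R * l * measure ?M (E h) + R * l powr (1 - p) * (2 powr p * D))"
    using lim mult_left_mono[OF i2, of "measure ?M (E h)"] unfolding i1 by simp
  then show ?thesis unfolding a_def E_def D_def .
qed

text \<open>The substitute for the Sobolev inequality: for \<open>p < N\<close> the largest admissible \<open>\<theta>\<close> is \<open>p/N = 1 - p/p\<^sup>*\<close>, and
smaller values are possible because the measures are bounded.\<close>

lemma level_inequality:
  fixes u :: "real^'n \<Rightarrow> real"
  assumes \<Omega>: "open \<Omega>" "bounded \<Omega>" and p: "1 < p" and W: "W0 \<Omega> p u g"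
    and \<theta>: "\<theta> \<le> p / real CARD('n)"
  defines "a \<equiv> \<lambda>t. measure (lebesgue_on \<Omega>) {x \<in> \<Omega>. t < u x}"
  obtains C where "0 < C" "\<And>k h. 0 \<le> k \<Longrightarrow> k < h \<Longrightarrow> (h - k) powr p * a h
    \<le> C * a k powr \<theta> * (LINT x|lebesgue_on \<Omega>. indicator {x. k < u x \<and> u x \<le> h} x * norm (g x) powr p)"
proof -
  let ?M = "lebesgue_on \<Omega>"
  let ?N = "real CARD('n)"
  interpret finite_measure ?M by (rule finite_measure_lebesgue_on_bounded[OF \<Omega>])
  have Lp: "u \<in> Lp \<Omega> p" "g \<in> Lp \<Omega> p" using W by (auto simp: W0_def)
  note [measurable] = LpD(1)[OF Lp(1)] LpD(1)[OF Lp(2)]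
  have am: "{x \<in> \<Omega>. t < u x} \<in> sets ?M" for t
  proof -
    have "{x \<in> space ?M. t < u x} \<in> sets ?M" by measurable
    then show ?thesis by simp
  qed
  define w where "w = unit_ball_vol ?N"
  have w: "0 < w" by (simp add: w_def)
  have N: "0 < ?N" by simp
  define m where "m = measure ?M \<Omega> + 1"
  have a0: "0 \<le> a t" for t by (simp add: a_def)
  have am1: "a t \<le> m" for t
    using bounded_measure[of "{x \<in> \<Omega>. t < u x}"] by (simp add: a_def m_def)
  have m: "0 < m" by (simp add: m_def add_nonneg_pos)
  define C where "C = 8 powr p * (2 / w) powr (p / ?N) * m powr (p / ?N - \<theta>)"
  have C: "0 < C" using w m by (simp add: C_def)
  have "(h - k) powr p * a h \<le> C * a k powr \<theta> * (LINT x|?M. indicator {x. k < u x \<and> u x \<le> h} x * norm (g x) powr p)"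
    (is "_ \<le> _ * ?D") if k: "0 \<le> k" and h: "k < h" for k h
  proof (cases "a k = 0")
    case True
    have "a h \<le> a k" unfolding a_def using h am by (intro finite_measure_mono) auto
    with True a0[of h] have "a h = 0" by simp
    then show ?thesis using C by (simp add: Bochner_Integration.integral_nonneg)
  next
    case False
    then have ak: "0 < a k" using a0[of k] by simp
    \<comment> \<open>the ball of radius \<open>R\<close> has twice the measure of \<open>{u > k}\<close>\<close>
    define R where "R = (2 * a k / w) powr (1 / ?N)"
    have R: "0 < R" using ak w by (simp add: R_def)
    \<comment> \<open>so that the terms with \<open>a h\<close> on the right add up to three quarters of the left-hand side\<close>
    define l where "l = (h - k) / (4 * R)"
    have l: "0 < l" using h R by (simp add: l_def)
    have D0: "0 \<le> ?D" by (intro Bochner_Integration.integral_nonneg) simp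
    have "R ^ CARD('n) = R powr ?N" using R by (simp add: powr_realpow)
    also have "\<dots> = 2 * a k / w" using ak w by (simp add: R_def powr_powr)
    finally have b: "measure lborel (cball (0::real^'n) R) = 2 * a k"
      using R w by (simp add: content_cball flip: w_def)
    have hk: "h - k = 4 * (R * l)" using R by (simp add: l_def)
    have "2 * a k * ((h - k) * a h) \<le> a h * ((h - k) * a k) + 2 * a k * (R * l * a h + R * l powr (1 - p) * (2 powr p * ?D))"
      using layer_set_bound[OF \<Omega> p W R l k h] unfolding b a_def .
    then have "2 * a k * (4 * (R * l) * a h) \<le> 2 * a k * (2 * (R * l) * a h + (R * l * a h + R * l powr (1 - p) * (2 powr p * ?D)))"
      unfolding hk by (simp add: algebra_simps)
    then have "4 * (R * l) * a h \<le> 2 * (R * l) * a h + (R * l * a h + R * l powr (1 - p) * (2 powr p * ?D))"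
      using ak by (subst (asm) mult_le_cancel_left_pos) auto
    then have "R * (l * a h) \<le> R * (l powr (1 - p) * (2 powr p * ?D))"
      by (simp add: algebra_simps)
    then have "l * a h \<le> l powr (1 - p) * (2 powr p * ?D)"
      using R by (subst (asm) mult_le_cancel_left_pos) auto
    then have "l powr (p - 1) * (l * a h) \<le> l powr (p - 1) * (l powr (1 - p) * (2 powr p * ?D))"
      by (intro mult_left_mono) auto
    moreover have "l powr (p - 1) * l = l powr p" using l powr_add[of l "p - 1" 1] by simp
    moreover have "l powr (p - 1) * l powr (1 - p) = 1" using l by (simp flip: powr_add)
    ultimately have 1: "l powr p * a h \<le> 2 powr p * ?D" by (simp flip: mult.assoc)
    have "(h - k) powr p * a h = (4 * R) powr p * (l powr p * a h)"
      using R l unfolding hk by (simp add: powr_mult)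
    also have "\<dots> \<le> (4 * R) powr p * (2 powr p * ?D)"
      using 1 by (intro mult_left_mono) auto
    also have "\<dots> = 8 powr p * R powr p * ?D"
      using R by (simp add: powr_mult[symmetric])
    also have "R powr p = (2 / w * a k) powr (p / ?N)"
      using ak w by (simp add: R_def powr_powr mult.commute)
    also have "\<dots> = (2 / w) powr (p / ?N) * (a k powr \<theta> * a k powr (p / ?N - \<theta>))"
      using ak w powr_mult[of "2 / w" "a k" "p / ?N"] by (simp flip: powr_add)
    also have "8 powr p * \<dots> * ?D \<le> 8 powr p * ((2 / w) powr (p / ?N) * (a k powr \<theta> * m powr (p / ?N - \<theta>))) * ?D"
      using am1[of k] \<theta> ak by (intro mult_right_mono[OF _ D0] mult_left_mono powr_mono2) auto
    finally show ?thesis by (simp add: C_def mult_ac)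
  qed
  with C that show thesis by blast
qed

section \<open>Elementary inequalities and recursions\<close>

text \<open>Jensen's inequality for \<open>t\<close>-th powers up to the factor \<open>2\<close>. Up to this factor it follows from the
pointwise bound \<open>h\<^sup>t \<le> l\<^sup>t + l\<^sup>t\<^sup>-\<^sup>1 h\<close>, where \<open>l\<close> is the mean of \<open>h\<close> over \<open>A\<close>.\<close>

lemma integral_powr_concave:
  fixes h :: "'a \<Rightarrow> real"
  assumes "finite_measure M" and h: "integrable M h" "\<And>x. 0 \<le> h x" and A[measurable]: "A \<in> sets M"
    and t: "0 < t" "t < 1"
  shows "integrable M (\<lambda>x. indicator A x * h x powr t)"
    "(LINT x|M. indicator A x * h x powr t) \<le> 2 * (LINT x|M. indicator A x * h x) powr t * measure M A powr (1 - t)"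
proof -
  interpret finite_measure M by fact
  note [measurable] = borel_measurable_integrable[OF h(1)]
  let ?I = "LINT x|M. indicator A x * h x"
  have hA: "integrable M (\<lambda>x. indicator A x * h x)"
    using integrable_mult_indicator[OF A h(1)] by simp
  have split: "indicator A x * h x powr t \<le> l powr t * indicator A x + l powr (t - 1) * (indicator A x * h x)"
    if l: "0 < l" for l x
  proof (cases "h x \<le> l")
    case True
    then have "h x powr t \<le> l powr t" using t h by (intro powr_mono2) auto
    moreover have "0 \<le> l powr (t - 1) * h x" using h by simp
    ultimately show ?thesis by (auto simp: indicator_def intro: add_increasing2)
  next
    case False
    then have hx: "0 < h x" "l \<le> h x" using l by auto
    have "h x powr t = h x powr (t - 1) * h x" using hx powr_add[of "h x" "t - 1" 1] by simp
    also have "\<dots> \<le> l powr (t - 1) * h x"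
      using t l hx by (intro mult_right_mono powr_mono2') auto
    finally show ?thesis by (auto simp: indicator_def intro: add_increasing)
  qed
  have int_r: "integrable M (\<lambda>x. l powr t * indicator A x + l powr (t - 1) * (indicator A x * h x))" for l
    using hA by (intro Bochner_Integration.integrable_add integrable_mult_right integrable_real_indicator)
      (auto simp: less_top[symmetric])
  show int: "integrable M (\<lambda>x. indicator A x * h x powr t)"
  proof (rule Bochner_Integration.integrable_bound[OF int_r[of 1]])
    show "AE x in M. norm (indicator A x * h x powr t) \<le> norm (1 powr t * indicator A x + 1 powr (t - 1) * (indicator A x * h x))"
      using split[of 1] h(2) by (auto simp: abs_mult intro!: AE_I2 order_trans[OF _ abs_ge_self])
  qed measurable
  have key: "(LINT x|M. indicator A x * h x powr t) \<le> l powr t * measure M A + l powr (t - 1) * ?I" if l: "0 < l" for l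
  proof -
    have "(LINT x|M. indicator A x * h x powr t) \<le> (LINT x|M. l powr t * indicator A x + l powr (t - 1) * (indicator A x * h x))"
      by (intro integral_mono int int_r split l)
    also have "\<dots> = l powr t * measure M A + l powr (t - 1) * ?I"
      using hA sets.sets_into_space[OF A]
      by (subst Bochner_Integration.integral_add)
         (auto intro!: integrable_real_indicator simp: less_top[symmetric] Int_absorb2)
    finally show ?thesis .
  qed
  have I0: "0 \<le> ?I" by (intro Bochner_Integration.integral_nonneg) (simp add: h)
  show "(LINT x|M. indicator A x * h x powr t) \<le> 2 * ?I powr t * measure M A powr (1 - t)"
  proof (cases "measure M A = 0 \<or> ?I = 0")
    case True
    then have "AE x in M. indicator A x * h x powr t = 0"
    proof
      assume "measure M A = 0"
      then have "A \<in> null_sets M" using emeasure_eq_measure[of A] by (intro null_setsI) auto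
      from AE_not_in[OF this] show ?thesis by eventually_elim simp
    next
      assume "?I = 0"
      then have "AE x in M. indicator A x * h x = 0"
        using integral_nonneg_eq_0_iff_AE[OF hA] h by simp
      then show ?thesis by eventually_elim (auto simp: indicator_def)
    qed
    then have "(LINT x|M. indicator A x * h x powr t) = 0"
      by (intro integral_eq_zero_AE)
    then show ?thesis by simp
  next
    case False
    then have pos: "0 < measure M A" "0 < ?I" using I0 by (auto simp: zero_less_measure_iff)
    define l where "l = ?I / measure M A"
    have l: "0 < l" using pos by (simp add: l_def)
    have "l powr (t - 1) * ?I = l powr t * measure M A"
      using pos l powr_add[of l "t - 1" 1] by (simp add: l_def)
    then have "(LINT x|M. indicator A x * h x powr t) \<le> 2 * (l powr t * measure M A)"
      using key[OF l] by (simp add: mult.commute)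
    also have "l powr t * measure M A = ?I powr t * measure M A powr (1 - t)"
      using pos by (simp add: l_def powr_divide powr_diff)
    finally show ?thesis by (simp add: mult.assoc)
  qed
qed

lemma seq_summable:
  fixes c d :: "nat \<Rightarrow> real"
  assumes "\<And>j. 0 \<le> c j" "\<And>j. 0 \<le> d j" "summable d" "0 \<le> C" "\<And>j. c (Suc j) \<le> c j / 2 + C * d j"
  shows "summable c"
proof (rule summableI_nonneg_bounded[OF assms(1)])
  fix n
  have dn: "(\<Sum>j<n. d j) \<le> suminf d" by (rule sum_le_suminf[OF assms(3)]) (use assms in auto)
  have "(\<Sum>j<n. c j) \<le> (\<Sum>j<Suc n. c j)" using assms(1) by simp
  also have "\<dots> = c 0 + (\<Sum>j<n. c (Suc j))" by (rule sum.lessThan_Suc_shift)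
  also have "\<dots> \<le> c 0 + (\<Sum>j<n. c j / 2 + C * d j)"
    by (intro add_left_mono sum_mono assms(5))
  also have "\<dots> = c 0 + (\<Sum>j<n. c j) / 2 + C * (\<Sum>j<n. d j)"
    by (simp add: sum.distrib sum_distrib_left sum_divide_distrib)
  also have "\<dots> \<le> c 0 + (\<Sum>j<n. c j) / 2 + C * suminf d"
    by (intro add_left_mono mult_left_mono dn assms(4))
  finally show "(\<Sum>j<n. c j) \<le> 2 * (c 0 + C * suminf d)" by simp
qed

text \<open>The tail sums \<open>S\<close> of \<open>c\<close> and \<open>D\<close> of \<open>d\<close> satisfy \<open>S\<^sub>j\<^sub>+\<^sub>1 \<le> \<eta> S\<^sub>j + C D\<^sub>j\<close>. If the weight of \<open>D\<close> in
\<open>K D + S\<close> is \<open>K = C/\<eta>\<close>, this combination shrinks by the factor \<open>2 \<eta>\<close> in every step, once \<open>K D \<le> S\<close> holds for all later tails.\<close>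

lemma seq_decay:
  fixes c d :: "nat \<Rightarrow> real"
  assumes c: "\<And>j. 0 \<le> c j" "summable c" and d: "\<And>j. 0 \<le> d j" "summable d"
    and rec: "\<And>\<eta>. 0 < \<eta> \<Longrightarrow> \<exists>C>0. \<forall>j. c (Suc j) \<le> \<eta> * c j + C * d j"
    and small: "\<And>\<epsilon>. 0 < \<epsilon> \<Longrightarrow> \<exists>J. \<forall>j\<ge>J. (\<Sum>i. d (i + j)) \<le> \<epsilon> * (\<Sum>i. c (i + j))"
    and \<delta>: "0 < \<delta>" "\<delta> < 1"
  shows "\<exists>K>0. \<forall>j. c j \<le> K * \<delta> ^ j"
proof -
  define \<eta> where "\<eta> = \<delta> / 2"
  have \<eta>: "0 < \<eta>" using \<delta> by (simp add: \<eta>_def)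
  obtain C where C: "0 < C" "\<And>j. c (Suc j) \<le> \<eta> * c j + C * d j" using rec[OF \<eta>] by blast
  define K where "K = C / \<eta>"
  have K: "0 < K" using C \<eta> by (simp add: K_def)
  define S where "S j = (\<Sum>i. c (i + j))" for j
  define D where "D j = (\<Sum>i. d (i + j))" for j
  have cs: "summable (\<lambda>i. c (i + j))" and ds: "summable (\<lambda>i. d (i + j))" for j
    using c(2) d(2) by simp_all
  have S0: "0 \<le> S j" "0 \<le> D j" "c j \<le> S j" for j
    using sum_le_suminf[OF cs[of j], of "{0}"] c d
    unfolding S_def D_def by (auto intro!: suminf_nonneg cs ds)
  have SS: "S (Suc j) \<le> \<eta> * S j + C * D j" for j
  proof -
    have "S (Suc j) \<le> (\<Sum>i. \<eta> * c (i + j) + C * d (i + j))"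
      unfolding S_def using C(2) cs[of "Suc j"] by (intro suminf_le summable_add summable_mult cs ds) auto
    also have "\<dots> = \<eta> * S j + C * D j"
      unfolding S_def D_def
      by (subst suminf_add[symmetric]) (auto simp del: summable_iff_shift intro!: summable_mult cs ds simp: suminf_mult[OF cs] suminf_mult[OF ds])
    finally show ?thesis .
  qed
  obtain J where J: "\<And>j. J \<le> j \<Longrightarrow> D j \<le> (1 / K) * S j"
    using small[of "1 / K"] K unfolding D_def S_def by auto
  define Y where "Y j = K * D j + S j" for j
  have Y0: "0 \<le> Y j" for j using S0 K by (simp add: Y_def)
  have step: "Y (Suc j) \<le> \<delta> * Y j" if "J \<le> j" for j
  proof -
    have "K * D (Suc j) \<le> K * ((1 / K) * S (Suc j))"
      using J[of "Suc j"] that K by (intro mult_left_mono) auto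
    then have "Y (Suc j) \<le> 2 * S (Suc j)" using K by (simp add: Y_def)
    also have "\<dots> \<le> 2 * (\<eta> * S j + C * D j)" using SS[of j] by simp
    also have "\<dots> = \<delta> * Y j" using \<eta> by (simp add: Y_def K_def \<eta>_def field_simps)
    finally show ?thesis .
  qed
  have Yn: "Y (J + n) \<le> \<delta> ^ n * Y J" for n
  proof (induction n)
    case (Suc n)
    have "Y (J + Suc n) \<le> \<delta> * Y (J + n)" using step[of "J + n"] by simp
    also have "\<dots> \<le> \<delta> * (\<delta> ^ n * Y J)" using Suc \<delta> by (intro mult_left_mono) auto
    finally show ?case by (simp add: mult.assoc)
  qed simp
  define L where "L = (Y J + suminf c + 1) / \<delta> ^ J"
  have sc: "0 \<le> suminf c" using c by (intro suminf_nonneg) auto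
  have L: "0 < L" using Y0[of J] sc \<delta> by (simp add: L_def add_nonneg_pos)
  have "c j \<le> L * \<delta> ^ j" for j
  proof (cases "J \<le> j")
    case True
    then obtain n where n: "j = J + n" using le_Suc_ex by blast
    have "c j \<le> Y j" using S0[of j] K by (simp add: Y_def add_increasing)
    also have "\<dots> \<le> \<delta> ^ n * Y J" unfolding n by (rule Yn)
    also have "\<dots> \<le> \<delta> ^ n * (Y J + suminf c + 1)" using sc \<delta> by (intro mult_left_mono) auto
    also have "\<dots> = L * \<delta> ^ j" using \<delta> by (simp add: L_def n power_add)
    finally show ?thesis .
  next
    case False
    have "c j \<le> suminf c" using sum_le_suminf[OF c(2), of "{j}"] c(1) by simp
    also have "\<dots> \<le> L * \<delta> ^ J" using Y0[of J] \<delta> by (simp add: L_def)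
    also have "\<dots> \<le> L * \<delta> ^ j" using False \<delta> L by (intro mult_left_mono power_decreasing) auto
    finally show ?thesis .
  qed
  with L show ?thesis by blast
qed

lemma young_absorb:
  fixes K s \<eta> :: real
  assumes "0 < K" "0 < s" "s < 1" "0 < \<eta>"
  shows "\<exists>C>0. \<forall>x\<ge>0. \<forall>y\<ge>0. K * x powr (1 - s) * y powr s \<le> \<eta> * x + C * y"
proof (intro exI conjI allI impI)
  define C where "C = K * ((K / \<eta>) powr (1 / s)) powr (1 - s)"
  show "0 < K * ((K / \<eta>) powr (1 / s)) powr (1 - s)" using assms by simp
  fix x y :: real assume xy: "0 \<le> x" "0 \<le> y"
  define z where "z = (K / \<eta>) powr (1 / s) * y"
  have z0: "0 \<le> z" using xy by (simp add: z_def)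
  show "K * x powr (1 - s) * y powr s \<le> \<eta> * x + K * ((K / \<eta>) powr (1 / s)) powr (1 - s) * y"
  proof (cases "x \<le> z")
    case True
    have "K * x powr (1 - s) * y powr s \<le> K * z powr (1 - s) * y powr s"
      using True xy assms by (intro mult_right_mono mult_left_mono powr_mono2) auto
    also have "\<dots> = C * (y powr (1 - s) * y powr s)"
      using xy by (simp add: C_def z_def powr_mult mult_ac)
    also have "y powr (1 - s) * y powr s = y" using xy by (simp flip: powr_add)
    finally show ?thesis using xy assms by (simp add: C_def add_increasing)
  next
    case False
    then have x: "z < x" by simp
    have "z powr s = K / \<eta> * y powr s"
      using xy assms by (simp add: z_def powr_mult powr_powr)
    then have "K * y powr s = \<eta> * z powr s" using assms by simp
    also have "\<dots> \<le> \<eta> * x powr s" using x z0 assms by (intro mult_left_mono powr_mono2) auto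
    finally have "x powr (1 - s) * (K * y powr s) \<le> x powr (1 - s) * (\<eta> * x powr s)"
      by (intro mult_left_mono) auto
    also have "\<dots> = \<eta> * (x powr (1 - s) * x powr s)" by simp
    also have "x powr (1 - s) * x powr s = x" using xy by (simp flip: powr_add)
    finally have "K * x powr (1 - s) * y powr s \<le> \<eta> * x" by (simp add: mult_ac)
    moreover have "0 \<le> K * ((K / \<eta>) powr (1 / s)) powr (1 - s) * y" using xy assms by simp
    ultimately show ?thesis by linarith
  qed
qed

text \<open>Along the levels \<open>k0 + d (1 - 2\<^sup>-\<^sup>j)\<close> the superlinear recursion gives geometric decay of \<open>a\<close>, provided that
\<open>d\<close> is large enough.\<close>

lemma stampacchia:
  fixes a :: "real \<Rightarrow> real"
  assumes a0: "\<And>k. 0 \<le> a k" and mono: "\<And>k h. k \<le> h \<Longrightarrow> a h \<le> a k"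
    and C: "0 < C" and p: "0 < p" and \<beta>: "1 < \<beta>"
    and rec: "\<And>k h. k0 \<le> k \<Longrightarrow> k < h \<Longrightarrow> (h - k) powr p * a h \<le> C * a k powr \<beta>"
  shows "\<exists>K. a K = 0"
proof -
  \<comment> \<open>the rate for which the factor \<open>2\<^sup>j\<^sup>p\<close> from the level differences is compensated by \<open>(r\<^sup>j)\<^sup>\<beta>\<^sup>-\<^sup>1\<close>\<close>
  define r where "r = 2 powr (- p / (\<beta> - 1))"
  have r: "0 < r" "r < 1" using p \<beta> powr_less_mono[of "- p / (\<beta> - 1)" 0 2] by (auto simp: r_def divide_neg_pos)
  define A where "A = a k0 + 1"
  have A: "0 < A" using a0[of k0] by (simp add: A_def add_nonneg_pos)
  define d where "d = (C * A powr (\<beta> - 1) * 2 powr p / r) powr (1 / p)"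
  have d: "0 < d" using C A r by (simp add: d_def)
  have dp: "d powr p = C * A powr (\<beta> - 1) * 2 powr p / r"
    using C A r p by (simp add: d_def powr_powr)
  define k where "k j = k0 + d * (1 - (1 / 2) ^ j)" for j :: nat
  have kk: "k0 \<le> k j" "k j < k (Suc j)" "k (Suc j) - k j = d * (1 / 2) ^ Suc j" "k j \<le> k0 + d" for j
    using d by (auto simp: k_def field_simps power_le_one)
  have bnd: "a (k j) \<le> A * r ^ j" for j
  proof (induction j)
    case 0 then show ?case by (simp add: k_def A_def)
  next
    case (Suc j)
    have half: "(d * (1 / 2) ^ Suc j) powr p = d powr p * (1 / 2) powr (p * Suc j)"
    proof -
      have "(1 / 2) ^ Suc j = (1 / 2 :: real) powr real (Suc j)" by (subst powr_realpow) auto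
      then show ?thesis by (simp only: powr_mult powr_powr mult.commute[of "real (Suc j)"])
    qed
    have rb: "(r ^ j) powr (\<beta> - 1) = (1 / 2) powr (p * j)"
    proof -
      have "r ^ j = r powr real j" using r by (simp add: powr_realpow)
      then have "(r ^ j) powr (\<beta> - 1) = 2 powr (- p / (\<beta> - 1) * real j * (\<beta> - 1))"
        by (simp only: r_def powr_powr)
      also have "- p / (\<beta> - 1) * real j * (\<beta> - 1) = - (p * j)" using \<beta> by (simp add: field_simps)
      finally show ?thesis by (simp add: powr_minus_divide powr_divide)
    qed
    have "d powr p * (1 / 2) powr (p * Suc j) * a (k (Suc j)) \<le> C * a (k j) powr \<beta>"
      using rec[OF kk(1,2), of j] unfolding kk(3) half .
    also have "\<dots> \<le> C * (A * r ^ j) powr \<beta>"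
      using Suc C a0 \<beta> by (intro mult_left_mono powr_mono2) auto
    also have "(A * r ^ j) powr \<beta> = (A * r ^ j) powr (\<beta> - 1) * (A * r ^ j)"
      using A r powr_add[of "A * r ^ j" "\<beta> - 1" 1] by simp
    also have "(A * r ^ j) powr (\<beta> - 1) = A powr (\<beta> - 1) * (1 / 2) powr (p * j)"
      using A r rb by (simp add: powr_mult)
    also have "C * (A powr (\<beta> - 1) * (1 / 2) powr (p * j) * (A * r ^ j))
        = d powr p * (1 / 2) powr (p * Suc j) * (A * r ^ Suc j)"
    proof -
      have "(1 / 2) powr (p * Suc j) * (2::real) powr p = (1 / 2) powr (p * j)"
      proof -
        have "(1 / 2) powr (p * Suc j) = (1 / 2) powr (p * j) * (1 / 2 :: real) powr p"
          by (simp only: powr_add[symmetric]) (simp add: algebra_simps)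
        moreover have "(1 / 2 :: real) powr p * 2 powr p = 1" by (simp flip: powr_mult)
        ultimately show ?thesis by simp
      qed
      then have "C * (A powr (\<beta> - 1) * (1 / 2) powr (p * j) * (A * r ^ j))
          = (C * A powr (\<beta> - 1) * 2 powr p) * (1 / 2) powr (p * Suc j) * (A * r ^ j)"
        by (simp only: mult_ac)
      also have "C * A powr (\<beta> - 1) * 2 powr p = d powr p * r" using dp r by simp
      finally show ?thesis by (simp only: power_Suc mult_ac)
    qed
    finally show ?case
      using d by (subst (asm) mult_le_cancel_left_pos) auto
  qed
  have "(\<lambda>j. A * r ^ j) \<longlonglongrightarrow> A * 0"
    using r by (intro tendsto_mult tendsto_const LIMSEQ_realpow_zero) auto
  moreover have "a (k0 + d) \<le> A * r ^ j" for j
    using mono[OF kk(4)] bnd order_trans by blast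
  ultimately have "a (k0 + d) \<le> A * 0"
    by (intro LIMSEQ_le_const[of "\<lambda>j. A * r ^ j"]) auto
  then have "a (k0 + d) = 0" using a0[of "k0 + d"] by simp
  then show ?thesis by blast
qed

section \<open>From level estimates to boundedness\<close>

text \<open>The set \<open>{u > 2\<^sup>j}\<close> is cut into dyadic layers, and on each of them \<open>u\<close> is replaced by the upper end of the layer.\<close>

lemma dyadic_integral:
  fixes u F :: "'a \<Rightarrow> real" and s :: "nat \<Rightarrow> real"
  assumes [measurable]: "u \<in> borel_measurable M" "F \<in> borel_measurable M"
    and F: "\<And>x. 0 \<le> F x" and m: "0 \<le> m" and s: "summable s"
    and int: "\<And>i. integrable M (\<lambda>x. indicator {x. 2 ^ i < u x} x * F x)"
    and le: "\<And>i. 2 powr (real (Suc i) * m) * (LINT x|M. indicator {x. 2 ^ i < u x} x * F x) \<le> s i"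
  shows "integrable M (\<lambda>x. indicator {x. 2 ^ j < u x} x * (u x powr m * F x))"
    "(LINT x|M. indicator {x. 2 ^ j < u x} x * (u x powr m * F x)) \<le> (\<Sum>i. s (i + j))"
proof -
  define T where "T i x = 2 powr (real (Suc i) * m) * (indicator {x. 2 ^ i < u x} x * F x)" for i x
  let ?f = "\<lambda>x. indicator {x. 2 ^ j < u x} x * (u x powr m * F x)"
  have T0: "0 \<le> T i x" for i x using F by (simp add: T_def)
  have Ti: "integrable M (T i)" for i unfolding T_def using int by simp
  have [measurable]: "T i \<in> borel_measurable M" for i using Ti by auto
  have Tle: "integral\<^sup>L M (T i) \<le> s i" for i using le unfolding T_def by simp
  have s0: "0 \<le> s i" for i
    using Tle[of i] Bochner_Integration.integral_nonneg[of M "T i"] T0 by (meson order_trans)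
  have ss: "summable (\<lambda>i. s (i + j))" using s by simp
  have sum0: "0 \<le> (\<Sum>i. s (i + j))" by (intro suminf_nonneg ss s0)
  have f0: "0 \<le> ?f x" for x using F by simp
  have pt: "ennreal (?f x) \<le> (\<Sum>i. ennreal (T (i + j) x))" for x
  proof (cases "2 ^ j < u x")
    case True
    obtain n where n: "u x < 2 ^ n" using real_arch_pow[of 2 "u x"] by auto
    define N where "N = (LEAST n. u x \<le> 2 ^ n)"
    have N: "u x \<le> 2 ^ N" unfolding N_def by (rule LeastI[of _ n]) (use n in simp)
    have jN: "j < N"
    proof (rule ccontr)
      assume "\<not> j < N"
      then have "(2::real) ^ N \<le> 2 ^ j" by (intro power_increasing) auto
      with N True show False by simp
    qed
    then obtain i where i: "N = Suc (i + j)" using less_imp_Suc_add by (metis add.commute)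
    have "\<not> u x \<le> 2 ^ (i + j)" using not_less_Least[of "i + j" "\<lambda>n. u x \<le> 2 ^ n"] i unfolding N_def by auto
    then have low: "2 ^ (i + j) < u x" by simp
    have "u x powr m \<le> (2 ^ N) powr m"
      using N m low by (intro powr_mono2) (auto intro: order_trans[of 0 "2 ^ (i + j)"] less_imp_le)
    also have "(2 ^ N) powr m = 2 powr (real (Suc (i + j)) * m)"
      unfolding i by (simp add: powr_powr del: power_Suc flip: powr_realpow)
    finally have "?f x \<le> T (i + j) x"
      using True low F by (simp add: T_def mult_right_mono)
    then have "ennreal (?f x) \<le> ennreal (T (i + j) x)" by (rule ennreal_leI)
    also have "\<dots> \<le> (\<Sum>i. ennreal (T (i + j) x))"
      using sum_le_suminf[of "\<lambda>i. ennreal (T (i + j) x)" "{i}"] by simp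
    finally show ?thesis .
  qed simp
  have nn: "(\<integral>\<^sup>+x. ennreal (?f x) \<partial>M) \<le> ennreal (\<Sum>i. s (i + j))"
  proof -
    have "(\<integral>\<^sup>+x. ennreal (?f x) \<partial>M) \<le> (\<integral>\<^sup>+x. (\<Sum>i. ennreal (T (i + j) x)) \<partial>M)"
      by (intro nn_integral_mono pt)
    also have "\<dots> = (\<Sum>i. \<integral>\<^sup>+x. ennreal (T (i + j) x) \<partial>M)"
      by (rule nn_integral_suminf) measurable
    also have "\<dots> = (\<Sum>i. ennreal (integral\<^sup>L M (T (i + j))))"
      by (intro suminf_cong nn_integral_eq_integral Ti) (simp add: T0)
    also have "\<dots> \<le> (\<Sum>i. ennreal (s (i + j)))"
      by (intro suminf_le ennreal_leI Tle) auto
    also have "\<dots> = ennreal (\<Sum>i. s (i + j))"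
      by (rule suminf_ennreal2[OF s0 ss])
    finally show ?thesis .
  qed
  show fi: "integrable M ?f"
  proof (rule integrableI_nonneg)
    show "(\<integral>\<^sup>+x. ennreal (?f x) \<partial>M) < \<infinity>" using nn by (rule order.strict_trans1) simp
  qed (use f0 in auto)
  have "ennreal (integral\<^sup>L M ?f) \<le> ennreal (\<Sum>i. s (i + j))"
    using nn nn_integral_eq_integral[OF fi] f0 by simp
  then show "integral\<^sup>L M ?f \<le> (\<Sum>i. s (i + j))" using sum0 by simp
qed

text \<open>In this section the domain is an arbitrary finite measure space; \<open>G\<close> stands for \<open>|\<nabla>u|\<^sup>p\<close> and \<open>ps\<close> for the critical exponent.\<close>

locale level_estimate = finite_measure M for M :: "'a measure" +
  fixes u G :: "'a \<Rightarrow> real" and p ps C :: real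
  assumes u_meas[measurable]: "u \<in> borel_measurable M"
    and G_int: "integrable M G" and G_nonneg: "\<And>x. 0 \<le> G x"
    and p: "1 < p" "p < ps" and C: "0 < C"
    and level: "\<And>k h. 0 \<le> k \<Longrightarrow> k < h \<Longrightarrow> (h - k) powr p * measure M {x \<in> space M. h < u x}
      \<le> C * measure M {x \<in> space M. k < u x} powr (1 - p / ps) * (LINT x|M. indicator {x. k < u x \<and> u x \<le> h} x * G x)"
begin

text \<open>The energy \<open>d\<close> of a dyadic layer and the quantity \<open>c\<close> have the same homogeneity: \<open>c j\<close> is the power \<open>p/ps\<close> of
\<open>2\<^sup>j\<^sup>p\<^sup>s a(2\<^sup>j)\<close>, which up to a constant bounds the contribution of the layer to the integral of \<open>u\<^sup>p\<^sup>s\<close>.\<close>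

definition "a k = measure M {x \<in> space M. k < u x}"
definition "d j = (LINT x|M. indicator {x. 2 ^ j < u x \<and> u x \<le> 2 ^ Suc j} x * G x)" for j :: nat
definition "c j = 2 powr (real j * p) * a (2 ^ j) powr (p / ps)" for j :: nat

abbreviation "D k \<equiv> (LINT x|M. indicator {x. k < u x} x * G x)"

lemma sigma: "0 < p / ps" "p / ps < 1" using p by auto

lemma G_meas[measurable]: "G \<in> borel_measurable M" using G_int by auto

lemma a_nonneg: "0 \<le> a k" by (simp add: a_def)

lemma a_mono: "k \<le> h \<Longrightarrow> a h \<le> a k"
  unfolding a_def by (intro finite_measure_mono) auto

lemma indicator_integrable:
  assumes f: "integrable M (f :: 'a \<Rightarrow> real)" and [measurable]: "Measurable.pred M P"
  shows "integrable M (\<lambda>x. indicator {x. P x} x * f x)"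
proof (rule Bochner_Integration.integrable_bound[OF f])
  have [measurable]: "f \<in> borel_measurable M" using f by auto
  show "(\<lambda>x. indicator {x. P x} x * f x) \<in> borel_measurable M" by measurable
qed (auto simp: indicator_def)

lemma d_nonneg: "0 \<le> d j" "0 \<le> c j"
  by (auto simp: d_def c_def G_nonneg intro!: Bochner_Integration.integral_nonneg)

lemma d_eq: "d j = D (2 ^ j) - D (2 ^ Suc j)"
proof -
  have le: "2 ^ j < y" if "2 ^ Suc j < y" for y :: real
    using that power_strict_increasing[of j "Suc j" "2::real"] by linarith
  have "d j = (LINT x|M. indicator {x. 2 ^ j < u x} x * G x - indicator {x. 2 ^ Suc j < u x} x * G x)"
    unfolding d_def
    by (intro Bochner_Integration.integral_cong) (auto simp: indicator_def simp del: power_Suc dest: le)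
  then show ?thesis
    by (subst (asm) Bochner_Integration.integral_diff) (auto intro!: indicator_integrable G_int)
qed

lemma D_to_0:
  assumes f: "integrable M (f :: 'a \<Rightarrow> real)"
  shows "(\<lambda>j. LINT x|M. indicator {x. 2 ^ j < u x} x * f x) \<longlonglongrightarrow> 0"
proof -
  have [measurable]: "f \<in> borel_measurable M" using f by auto
  have "(\<lambda>j. LINT x|M. indicator {x. 2 ^ j < u x} x * f x) \<longlonglongrightarrow> (LINT x|M. 0)"
  proof (rule integral_dominated_convergence)
    show "integrable M (\<lambda>x. norm (f x))" using f by simp
    show "AE x in M. (\<lambda>j. indicator {x. 2 ^ j < u x} x * f x) \<longlonglongrightarrow> 0"
    proof (rule AE_I2)
      fix x
      obtain n where n: "u x < 2 ^ n" using real_arch_pow[of 2 "u x"] by auto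
      have "indicator {x. 2 ^ j < u x} x * f x = 0" if "n \<le> j" for j
      proof -
        have "\<not> 2 ^ j < u x" using n power_increasing[OF that, of "2::real"] by linarith
        then show ?thesis by simp
      qed
      then show "(\<lambda>j. indicator {x. 2 ^ j < u x} x * f x) \<longlonglongrightarrow> 0"
        by (intro tendsto_eventually) (auto simp: eventually_sequentially)
    qed
    show "AE x in M. norm (indicator {x. 2 ^ j < u x} x * f x) \<le> norm (f x)" for j
      by (auto simp: indicator_def)
  qed measurable
  then show ?thesis by simp
qed

lemma d_sums: "(\<lambda>i. d (i + j)) sums D (2 ^ j)"
proof -
  have "(\<lambda>i. D (2 ^ (i + j)) - D (2 ^ (Suc i + j))) sums (D (2 ^ (0 + j)) - 0)"
    by (rule telescope_sums') (rule LIMSEQ_ignore_initial_segment[OF D_to_0[OF G_int]])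
  then show ?thesis by (simp add: d_eq)
qed

lemma d_summable: "summable d" using d_sums[of 0] by (simp add: sums_iff)

text \<open>The level estimate between \<open>2\<^sup>j\<close> and \<open>2\<^sup>j\<^sup>+\<^sup>1\<close>, raised to the power \<open>p/ps\<close>. The powers of \<open>2\<close> cancel because \<open>c\<close> is
scale invariant.\<close>

lemma c_step:
  obtains K where "0 < K" "\<And>j. c (Suc j) \<le> K * c j powr (1 - p / ps) * d j powr (p / ps)"
proof
  let ?s = "p / ps"
  define K where "K = 2 powr p * C powr ?s"
  show "0 < K" using C by (simp add: K_def)
  fix j
  define P where "P = 2 powr (real j * p)"
  have P: "0 < P" by (simp add: P_def)
  have pw: "(2 ^ Suc j - 2 ^ j) powr p = P"
    by (simp add: P_def powr_powr flip: powr_realpow)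
  have "P * a (2 ^ Suc j) \<le> C * a (2 ^ j) powr (1 - ?s) * d j"
    using level[of "2 ^ j" "2 ^ Suc j"] unfolding pw a_def[symmetric] d_def[symmetric] by simp
  then have "(P * a (2 ^ Suc j)) powr ?s \<le> (C * a (2 ^ j) powr (1 - ?s) * d j) powr ?s"
    using P a_nonneg sigma by (intro powr_mono2) auto
  moreover have "P powr ?s * a (2 ^ Suc j) powr ?s \<le> C powr ?s * (a (2 ^ j) powr ?s) powr (1 - ?s) * d j powr ?s"
    if "(P * a (2 ^ Suc j)) powr ?s \<le> (C * a (2 ^ j) powr (1 - ?s) * d j) powr ?s"
  proof -
    have "(a (2 ^ j) powr (1 - ?s)) powr ?s = (a (2 ^ j) powr ?s) powr (1 - ?s)"
      by (simp only: powr_powr mult.commute)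
    with that show ?thesis by (simp only: powr_mult)
  qed
  ultimately have 1: "P powr ?s * a (2 ^ Suc j) powr ?s \<le> C powr ?s * (a (2 ^ j) powr ?s) powr (1 - ?s) * d j powr ?s"
    by blast
  have "P powr (1 - ?s) * P powr ?s = P" using P by (simp flip: powr_add)
  moreover have "2 powr (real (Suc j) * p) = 2 powr p * P" by (simp add: P_def algebra_simps flip: powr_add)
  ultimately have "c (Suc j) = 2 powr p * P powr (1 - ?s) * (P powr ?s * a (2 ^ Suc j) powr ?s)"
    unfolding c_def by (simp only: mult.assoc[symmetric]) (simp add: mult.assoc)
  also have "\<dots> \<le> 2 powr p * P powr (1 - ?s) * (C powr ?s * (a (2 ^ j) powr ?s) powr (1 - ?s) * d j powr ?s)"
    using 1 by (intro mult_left_mono) auto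
  also have "\<dots> = K * (P * a (2 ^ j) powr ?s) powr (1 - ?s) * d j powr ?s"
    by (simp add: K_def powr_mult mult_ac)
  finally show "c (Suc j) \<le> K * c j powr (1 - ?s) * d j powr ?s" by (simp add: c_def P_def)
qed

lemma c_rec:
  assumes "0 < \<eta>" shows "\<exists>K>0. \<forall>j. c (Suc j) \<le> \<eta> * c j + K * d j"
proof -
  obtain K where K: "0 < K" "\<And>j. c (Suc j) \<le> K * c j powr (1 - p / ps) * d j powr (p / ps)" by (rule c_step) blast
  from young_absorb[OF K(1) sigma assms] obtain B where
    B: "0 < B" "\<And>x y. 0 \<le> x \<Longrightarrow> 0 \<le> y \<Longrightarrow> K * x powr (1 - p / ps) * y powr (p / ps) \<le> \<eta> * x + B * y" by blast
  have "c (Suc j) \<le> \<eta> * c j + B * d j" for j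
    using K(2)[of j] B(2)[OF d_nonneg(2) d_nonneg(1), of j j] by linarith
  with B(1) show ?thesis by blast
qed

text \<open>This is the embedding into \<open>L\<^sup>p\<^sup>s\<close> in disguise: the recursion with \<open>\<eta> = 1/2\<close> transfers summability from \<open>d\<close> to \<open>c\<close>.\<close>

lemma c_summable: "summable c"
proof -
  obtain K where "0 < K" "\<And>j. c (Suc j) \<le> c j / 2 + K * d j" using c_rec[of "1/2"] by auto
  then show ?thesis using d_nonneg d_summable by (intro seq_summable[of c d K]) auto
qed

lemma c_to_0: "c \<longlonglongrightarrow> 0" by (rule summable_LIMSEQ_zero[OF c_summable])

lemma ps_pos: "0 < ps" using p by simp

lemma a_eq_c: "2 powr (real j * ps) * a (2 ^ j) = c j powr (ps / p)"
  using p a_nonneg by (simp add: c_def powr_mult powr_powr)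

lemma measure_indicator: "(LINT x|M. indicat_real {x. k < u x} x * 1) = a k"
proof -
  have "(LINT x|M. indicat_real {x. k < u x} x * 1) = (LINT x|M. indicat_real {x \<in> space M. k < u x} x)"
    by (intro Bochner_Integration.integral_cong) (auto simp: indicator_def)
  also have "\<dots> = a k"
    unfolding a_def by (simp add: Int_absorb2 subset_iff)
  finally show ?thesis .
qed

lemma power_integral:
  assumes m: "0 \<le> m" and s: "summable s" and le: "\<And>i. 2 powr (real (Suc i) * m) * a (2 ^ i) \<le> s i"
  shows "integrable M (\<lambda>x. indicator {x. 2 ^ j < u x} x * u x powr m)"
    "(LINT x|M. indicator {x. 2 ^ j < u x} x * u x powr m) \<le> (\<Sum>i. s (i + j))"
proof -
  have i: "integrable M (\<lambda>x. indicator {x. 2 ^ i < u x} x * (1::real))" for i :: nat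
    by (intro indicator_integrable) auto
  note * = dyadic_integral[of u M "\<lambda>_. 1" m s j, OF _ _ _ m s i, unfolded measure_indicator]
  show "integrable M (\<lambda>x. indicator {x. 2 ^ j < u x} x * u x powr m)"
    "(LINT x|M. indicator {x. 2 ^ j < u x} x * u x powr m) \<le> (\<Sum>i. s (i + j))"
    using *[OF u_meas _ _ le] by auto
qed

text \<open>The critical power is \<open>c\<close> times a factor that tends to zero. This smallness makes the critical growth admissible.\<close>

lemma critical_term: "2 powr (real (Suc i) * ps) * a (2 ^ i) = 2 powr ps * (c i powr (ps / p - 1) * c i)"
proof -
  have "2 powr (real (Suc i) * ps) = 2 powr ps * 2 powr (real i * ps)" by (simp add: algebra_simps flip: powr_add)
  moreover have "c i powr (ps / p) = c i powr (ps / p - 1) * c i"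
    using d_nonneg(2)[of i] powr_add[of "c i" "ps / p - 1" 1] by (cases "c i = 0") auto
  ultimately show ?thesis using a_eq_c[of i] by (simp add: mult.assoc)
qed

lemma critical_factor_to_0: "(\<lambda>i. c i powr (ps / p - 1)) \<longlonglongrightarrow> 0"
proof -
  have "(\<lambda>i. c i powr (ps / p - 1)) \<longlonglongrightarrow> 0 powr (ps / p - 1)"
    using p d_nonneg by (intro tendsto_powr' c_to_0) auto
  then show ?thesis by simp
qed

lemma critical_summable: "summable (\<lambda>i. 2 powr ps * (c i powr (ps / p - 1) * c i))"
proof (rule summable_mult, rule summable_comparison_test_ev[OF _ c_summable])
  have "\<forall>\<^sub>F i in sequentially. c i powr (ps / p - 1) < 1"
    using order_tendstoD(2)[OF critical_factor_to_0, of 1] by simp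
  then show "\<forall>\<^sub>F i in sequentially. norm (c i powr (ps / p - 1) * c i) \<le> c i"
    by eventually_elim (use d_nonneg in \<open>auto simp: abs_mult intro!: mult_left_le_one_le\<close>)
qed

lemma critical_integrable: "integrable M (\<lambda>x. indicator {x. 2 ^ j < u x} x * u x powr ps)"
  using power_integral(1)[OF less_imp_le[OF ps_pos] critical_summable] critical_term by simp

lemma level_powr_integral:
  assumes H: "integrable M H" "\<And>x. 0 \<le> H x" and t: "0 < t" "t < 1"
  shows "integrable M (\<lambda>x. indicator {x. k < u x} x * H x powr t)"
    "(LINT x|M. indicator {x. k < u x} x * H x powr t)
      \<le> 2 * (LINT x|M. indicator {x. k < u x} x * H x) powr t * a k powr (1 - t)"
proof -
  let ?A = "{x \<in> space M. k < u x}"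
  have eq: "(LINT x|M. indicat_real {x. k < u x} x * f x) = (LINT x|M. indicator ?A x * f x)"
    "integrable M (\<lambda>x. indicat_real {x. k < u x} x * f x) \<longleftrightarrow> integrable M (\<lambda>x. indicator ?A x * f x)" for f
    by (auto intro!: Bochner_Integration.integral_cong Bochner_Integration.integrable_cong simp: indicator_def)
  show "integrable M (\<lambda>x. indicator {x. k < u x} x * H x powr t)"
    "(LINT x|M. indicator {x. k < u x} x * H x powr t)
      \<le> 2 * (LINT x|M. indicator {x. k < u x} x * H x) powr t * a k powr (1 - t)"
    unfolding eq a_def using integral_powr_concave[OF finite_measure_axioms H _ t, of ?A] by auto
qed

end

text \<open>The second ingredient: the energy above a level is controlled by a critical power of \<open>u\<close> and by a lower order term.
That the integrals on the right exist is part of what has to be proved first, hence the premises of \<open>energy\<close>.\<close>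

locale level_energy_estimate = level_estimate +
  fixes H :: "'a \<Rightarrow> real" and \<theta> B :: real
  assumes H_int: "integrable M H" and H_ge1: "\<And>x. 1 \<le> H x"
    and \<theta>: "0 \<le> \<theta>" "\<theta> < 1 - p / ps" and B: "0 < B"
    and energy: "\<And>k. 1 \<le> k \<Longrightarrow> integrable M (\<lambda>x. indicator {x. k < u x} x * u x powr ps) \<Longrightarrow>
      integrable M (\<lambda>x. indicator {x. k < u x} x * (u x * H x powr \<theta>)) \<Longrightarrow>
      (LINT x|M. indicator {x. k < u x} x * G x) \<le> B * ((LINT x|M. indicator {x. k < u x} x * u x powr ps)
        + (LINT x|M. indicator {x. k < u x} x * (u x * H x powr \<theta>)))"
begin

lemma H_meas[measurable]: "H \<in> borel_measurable M" using H_int by auto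

lemma H_nonneg: "0 \<le> H x" using H_ge1[of x] by linarith

definition "h j = (LINT x|M. indicator {x. 2 ^ j < u x} x * H x)" for j :: nat

lemma h_nonneg: "0 \<le> h j"
  by (auto simp: h_def H_nonneg intro!: Bochner_Integration.integral_nonneg)

lemma h_le: "h j \<le> integral\<^sup>L M H"
  unfolding h_def by (intro integral_mono indicator_integrable H_int) (auto simp: indicator_def H_nonneg)

text \<open>The lower order term over a layer is \<open>c\<close> times a power of the integral of \<open>H\<close> over \<open>{u > 2\<^sup>i}\<close>, which tends to
zero. The exponent \<open>\<theta>\<close> may be raised to \<open>1 - p/ps\<close> here, since \<open>H \<ge> 1\<close>.\<close>

lemma subcritical_term:
  "2 powr (real (Suc i) * 1) * (LINT x|M. indicator {x. 2 ^ i < u x} x * H x powr (1 - p / ps))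
    \<le> 4 * h i powr (1 - p / ps) * c i"
proof -
  have t: "0 < 1 - p / ps" "1 - p / ps < 1" using sigma by auto
  have "2 powr (real (Suc i) * 1) * (LINT x|M. indicator {x. 2 ^ i < u x} x * H x powr (1 - p / ps))
      \<le> 2 powr (real (Suc i) * 1) * (2 * h i powr (1 - p / ps) * a (2 ^ i) powr (p / ps))"
    using level_powr_integral(2)[OF H_int H_nonneg t, of "2 ^ i"] unfolding h_def
    by (intro mult_left_mono) auto
  also have "\<dots> = 4 * h i powr (1 - p / ps) * (2 powr real i * a (2 ^ i) powr (p / ps))"
    by (simp add: powr_add)
  also have "\<dots> \<le> 4 * h i powr (1 - p / ps) * (2 powr (real i * p) * a (2 ^ i) powr (p / ps))"
    using p by (intro mult_left_mono mult_right_mono powr_mono) (auto intro: mult_left_le simp: mult_le_cancel_left1)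
  finally show ?thesis by (simp add: c_def)
qed

lemma subcritical_summable: "summable (\<lambda>i. 4 * h i powr (1 - p / ps) * c i)"
proof (rule summable_comparison_test'[of "\<lambda>i. 4 * integral\<^sup>L M H powr (1 - p / ps) * c i" 0])
  show "summable (\<lambda>i. 4 * integral\<^sup>L M H powr (1 - p / ps) * c i)" by (intro summable_mult c_summable)
  show "norm (4 * h i powr (1 - p / ps) * c i) \<le> 4 * integral\<^sup>L M H powr (1 - p / ps) * c i" for i
    using h_le[of i] h_nonneg[of i] d_nonneg(2)[of i] sigma
    by (auto simp: abs_mult intro!: mult_right_mono powr_mono2)
qed

lemma subcritical_integral:
  shows "integrable M (\<lambda>x. indicator {x. 2 ^ j < u x} x * (u x * H x powr (1 - p / ps)))"
    "(LINT x|M. indicator {x. 2 ^ j < u x} x * (u x * H x powr (1 - p / ps)))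
      \<le> (\<Sum>i. 4 * h (i + j) powr (1 - p / ps) * c (i + j))"
proof -
  have t: "0 < 1 - p / ps" "1 - p / ps < 1" using sigma by auto
  note * = dyadic_integral[of u M "\<lambda>x. H x powr (1 - p / ps)" 1 "\<lambda>i. 4 * h i powr (1 - p / ps) * c i" j,
      OF _ _ _ _ subcritical_summable level_powr_integral(1)[OF H_int H_nonneg t] subcritical_term]
  have e: "indicat_real {x. 2 ^ j < u x} x * (u x powr 1 * y) = indicator {x. 2 ^ j < u x} x * (u x * y)" for x y
  proof (cases "2 ^ j < u x")
    case True
    then have "0 < u x" by (meson less_trans zero_less_numeral zero_less_power)
    then show ?thesis by simp
  qed simp
  show "integrable M (\<lambda>x. indicator {x. 2 ^ j < u x} x * (u x * H x powr (1 - p / ps)))"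
    "(LINT x|M. indicator {x. 2 ^ j < u x} x * (u x * H x powr (1 - p / ps)))
      \<le> (\<Sum>i. 4 * h (i + j) powr (1 - p / ps) * c (i + j))"
    using * unfolding e by auto
qed

lemma energy_dyadic:
  "(\<Sum>i. d (i + j)) \<le> B * ((\<Sum>i. 2 powr ps * (c (i + j) powr (ps / p - 1) * c (i + j)))
      + (\<Sum>i. 4 * h (i + j) powr (1 - p / ps) * c (i + j)))"
proof -
  have le: "indicator {x. 2 ^ j < u x} x * (u x * H x powr \<theta>)
      \<le> indicator {x. 2 ^ j < u x} x * (u x * H x powr (1 - p / ps))"
    and nn: "0 \<le> indicator {x. 2 ^ j < u x} x * (u x * H x powr \<theta>)" for x
  proof -
    have "0 < u x" if "2 ^ j < u x" using that by (meson less_trans zero_less_numeral zero_less_power)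
    then show "indicator {x. 2 ^ j < u x} x * (u x * H x powr \<theta>)
        \<le> indicator {x. 2 ^ j < u x} x * (u x * H x powr (1 - p / ps))"
      "0 \<le> indicator {x. 2 ^ j < u x} x * (u x * H x powr \<theta>)"
      using \<theta> H_ge1 by (auto simp: indicator_def intro!: mult_left_mono powr_mono)
  qed
  have i: "integrable M (\<lambda>x. indicator {x. 2 ^ j < u x} x * (u x * H x powr \<theta>))"
    by (rule Bochner_Integration.integrable_bound[OF subcritical_integral(1)])
       (use le nn in \<open>auto intro!: AE_I2 order_trans[OF _ abs_ge_self] simp: abs_of_nonneg simp del: mult_cancel_left mult_le_cancel_left\<close>)
  have "(\<Sum>i. d (i + j)) = D (2 ^ j)" using d_sums[of j] by (simp add: sums_iff)
  also have "\<dots> \<le> B * ((LINT x|M. indicator {x. 2 ^ j < u x} x * u x powr ps)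
        + (LINT x|M. indicator {x. 2 ^ j < u x} x * (u x * H x powr \<theta>)))"
    by (intro energy critical_integrable i) simp
  also have "\<dots> \<le> B * ((\<Sum>i. 2 powr ps * (c (i + j) powr (ps / p - 1) * c (i + j)))
      + (\<Sum>i. 4 * h (i + j) powr (1 - p / ps) * c (i + j)))"
  proof (intro mult_left_mono add_mono)
    show "(LINT x|M. indicator {x. 2 ^ j < u x} x * u x powr ps)
        \<le> (\<Sum>i. 2 powr ps * (c (i + j) powr (ps / p - 1) * c (i + j)))"
      using power_integral(2)[OF less_imp_le[OF ps_pos] critical_summable] critical_term by simp
    show "(LINT x|M. indicator {x. 2 ^ j < u x} x * (u x * H x powr \<theta>))
        \<le> (\<Sum>i. 4 * h (i + j) powr (1 - p / ps) * c (i + j))"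
      by (rule order_trans[OF integral_mono[OF i subcritical_integral(1) le] subcritical_integral(2)])
  qed (use B in simp)
  finally show ?thesis .
qed

text \<open>Both factors in front of \<open>c\<close> tend to zero, so far up in the level sets the energy is a small fraction of the tail of \<open>c\<close>.\<close>

lemma energy_small:
  assumes "0 < \<epsilon>"
  shows "\<exists>J. \<forall>j\<ge>J. (\<Sum>i. d (i + j)) \<le> \<epsilon> * (\<Sum>i. c (i + j))"
proof -
  define e where "e = \<epsilon> / (2 * B)"
  have e: "0 < e" using assms B by (simp add: e_def)
  have "(\<lambda>i. 2 powr ps * c i powr (ps / p - 1)) \<longlonglongrightarrow> 2 powr ps * 0"
    by (intro tendsto_mult tendsto_const critical_factor_to_0)
  then have ev1: "\<forall>\<^sub>F i in sequentially. 2 powr ps * c i powr (ps / p - 1) < e"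
    using e by (intro order_tendstoD) auto
  have "h \<longlonglongrightarrow> 0" unfolding h_def by (rule D_to_0[OF H_int])
  then have "(\<lambda>i. 4 * h i powr (1 - p / ps)) \<longlonglongrightarrow> 4 * 0 powr (1 - p / ps)"
    using sigma h_nonneg by (intro tendsto_mult tendsto_const tendsto_powr') auto
  then have ev2: "\<forall>\<^sub>F i in sequentially. 4 * h i powr (1 - p / ps) < e"
    using e by (intro order_tendstoD) auto
  obtain J where J: "\<And>i. J \<le> i \<Longrightarrow> 2 powr ps * c i powr (ps / p - 1) < e"
    "\<And>i. J \<le> i \<Longrightarrow> 4 * h i powr (1 - p / ps) < e"
    using eventually_conj[OF ev1 ev2] by (auto simp: eventually_sequentially)
  have "(\<Sum>i. d (i + j)) \<le> \<epsilon> * (\<Sum>i. c (i + j))" if j: "J \<le> j" for j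
  proof -
    have cs: "summable (\<lambda>i. c (i + j))" using c_summable by simp
    have 1: "(\<Sum>i. 2 powr ps * (c (i + j) powr (ps / p - 1) * c (i + j))) \<le> (\<Sum>i. e * c (i + j))"
    proof (rule suminf_le)
      show "summable (\<lambda>i. 2 powr ps * (c (i + j) powr (ps / p - 1) * c (i + j)))"
        using summable_ignore_initial_segment[OF critical_summable, of j] .
      show "2 powr ps * (c (i + j) powr (ps / p - 1) * c (i + j)) \<le> e * c (i + j)" for i
        using mult_right_mono[OF less_imp_le[OF J(1)[of "i + j"]] d_nonneg(2)[of "i + j"]] j by (simp add: mult.assoc)
    qed (intro summable_mult cs)
    have 2: "(\<Sum>i. 4 * h (i + j) powr (1 - p / ps) * c (i + j)) \<le> (\<Sum>i. e * c (i + j))"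
    proof (rule suminf_le)
      show "summable (\<lambda>i. 4 * h (i + j) powr (1 - p / ps) * c (i + j))"
        using summable_ignore_initial_segment[OF subcritical_summable, of j] .
      show "4 * h (i + j) powr (1 - p / ps) * c (i + j) \<le> e * c (i + j)" for i
        using mult_right_mono[OF less_imp_le[OF J(2)[of "i + j"]] d_nonneg(2)[of "i + j"]] j by simp
    qed (intro summable_mult cs)
    have s: "(\<Sum>i. e * c (i + j)) = e * (\<Sum>i. c (i + j))" by (rule suminf_mult[OF cs])
    have "(\<Sum>i. d (i + j)) \<le> B * (e * (\<Sum>i. c (i + j)) + e * (\<Sum>i. c (i + j)))"
      using 1 2 B unfolding s by (intro order_trans[OF energy_dyadic] mult_left_mono add_mono) auto
    also have "\<dots> = \<epsilon> * (\<Sum>i. c (i + j))" using B by (simp add: e_def)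
    finally show ?thesis .
  qed
  then show ?thesis by blast
qed

text \<open>Geometric decay of \<open>c\<close> at a sufficiently fast rate beats the factors \<open>2\<^sup>i\<^sup>m\<close> of the dyadic layers.\<close>

lemma all_powers_integrable:
  assumes m: "0 \<le> m"
  shows "integrable M (\<lambda>x. indicator {x. 1 < u x} x * u x powr m)"
proof -
  \<comment> \<open>chosen such that \<open>2\<^sup>i\<^sup>m (\<delta>\<^sup>i)\<^sup>p\<^sup>s\<^sup>/\<^sup>p = 2\<^sup>-\<^sup>i\<close>\<close>
  define \<delta> where "\<delta> = 2 powr (- (m + 1) * (p / ps))"
  have neg: "- (m + 1) * (p / ps) < 0" using m sigma by (intro mult_neg_pos) auto
  have \<delta>: "0 < \<delta>" "\<delta> < 1" using powr_less_mono[OF neg, of 2] by (auto simp: \<delta>_def)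
  obtain K where K: "0 < K" "\<And>j. c j \<le> K * \<delta> ^ j"
    using seq_decay[OF d_nonneg(2) c_summable d_nonneg(1) d_summable c_rec energy_small \<delta>] by blast
  define s where "s i = 2 powr m * K powr (ps / p) * (1 / 2) ^ i" for i :: nat
  have "summable s" unfolding s_def by (intro summable_mult summable_geometric) auto
  moreover have "2 powr (real (Suc i) * m) * a (2 ^ i) \<le> s i" for i
  proof -
    have "\<delta> ^ i = 2 powr (- (m + 1) * (p / ps) * real i)"
      using \<delta> by (simp add: \<delta>_def powr_powr flip: powr_realpow)
    then have "(K * \<delta> ^ i) powr (ps / p) = K powr (ps / p) * 2 powr (- (m + 1) * (p / ps) * real i * (ps / p))"
      by (simp only: powr_mult powr_powr)
    also have "- (m + 1) * (p / ps) * real i * (ps / p) = - (m + 1) * real i" using p by simp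
    finally have K': "(K * \<delta> ^ i) powr (ps / p) = K powr (ps / p) * 2 powr (- (m + 1) * real i)" .
    have "a (2 ^ i) \<le> 2 powr (real i * ps) * a (2 ^ i)"
      using mult_right_mono[OF _ a_nonneg, of 1 "2 powr (real i * ps)" "2 ^ i"] ps_pos ge_one_powr_ge_zero[of 2 "real i * ps"]
      by simp
    also have "\<dots> \<le> (K * \<delta> ^ i) powr (ps / p)"
      unfolding a_eq_c using K p d_nonneg by (intro powr_mono2) auto
    finally have "2 powr (real (Suc i) * m) * a (2 ^ i) \<le> 2 powr (real (Suc i) * m) * (K powr (ps / p) * 2 powr (- (m + 1) * real i))"
      unfolding K' by (intro mult_left_mono) auto
    also have "\<dots> = K powr (ps / p) * 2 powr (m + - real i)"
      by (simp add: algebra_simps flip: powr_add)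
    also have "\<dots> = s i"
      by (simp add: s_def powr_diff powr_realpow power_one_over)
    finally show ?thesis .
  qed
  ultimately show ?thesis using power_integral(1)[OF m, of s 0] by simp
qed

text \<open>With all powers of \<open>u\<close> integrable, one integrable function \<open>Q\<close> dominates \<open>H\<close> and a high power of \<open>u\<close>. Both terms of the
energy estimate are then at most \<open>Q\<close> to a power below \<open>1 - p/ps\<close>, which makes the recursion for \<open>a\<close> superlinear.\<close>

lemma essentially_bounded_above: "\<exists>K. AE x in M. u x \<le> K"
proof -
  define \<theta>\<^sub>0 where "\<theta>\<^sub>0 = 1 - p / ps"
  define \<theta>\<^sub>1 where "\<theta>\<^sub>1 = (\<theta> + \<theta>\<^sub>0) / 2"
  \<comment> \<open>large enough for \<open>1/m + \<theta> \<le> \<theta>\<^sub>1\<close> and \<open>ps/m \<le> \<theta>\<^sub>1\<close>\<close>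
  define m where "m = 2 * (1 + ps) / (\<theta>\<^sub>0 - \<theta>)"
  have gap: "0 < \<theta>\<^sub>0 - \<theta>" using \<theta> by (simp add: \<theta>\<^sub>0_def)
  have "\<theta>\<^sub>0 < 1" using sigma by (simp add: \<theta>\<^sub>0_def)
  then have \<theta>\<^sub>1: "0 < \<theta>\<^sub>1" "\<theta>\<^sub>1 < 1" "\<theta>\<^sub>1 < \<theta>\<^sub>0" using gap \<theta>(1) by (auto simp: \<theta>\<^sub>1_def)
  have m: "0 < m" using gap ps_pos by (simp add: m_def)
  have m1: "(1 + ps) / m = (\<theta>\<^sub>0 - \<theta>) / 2"
    using gap ps_pos unfolding m_def by (simp add: field_simps)
  have "1 / m \<le> (1 + ps) / m" "ps / m \<le> (1 + ps) / m"
    using m ps_pos by (auto intro!: divide_right_mono)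
  then have m2: "1 / m + \<theta> \<le> \<theta>\<^sub>1" "ps / m \<le> \<theta>\<^sub>1"
    unfolding m1 \<theta>\<^sub>1_def using \<theta> by (auto simp: field_simps)
  define Q where "Q x = H x + indicator {x. 1 < u x} x * u x powr m" for x
  have Qi: "integrable M Q"
    unfolding Q_def using m by (intro Bochner_Integration.integrable_add H_int all_powers_integrable) simp
  then have [measurable]: "Q \<in> borel_measurable M" by auto
  have HQ: "H x \<le> Q x" for x by (simp add: Q_def)
  have Q1: "1 \<le> Q x" and Q0: "0 \<le> Q x" for x using HQ[of x] H_ge1[of x] by linarith+
  have uQ: "u x \<le> Q x powr (1 / m)" if "1 < u x" for x
  proof -
    have "u x = (u x powr m) powr (1 / m)" using m that by (simp add: powr_powr)
    also have "\<dots> \<le> Q x powr (1 / m)"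
      using m that H_nonneg[of x] by (intro powr_mono2) (auto simp: Q_def)
    finally show ?thesis .
  qed
  have b1: "u x powr ps \<le> Q x powr \<theta>\<^sub>1" if "1 < u x" for x
  proof -
    have "u x powr ps \<le> (Q x powr (1 / m)) powr ps"
      using uQ[OF that] ps_pos that by (intro powr_mono2) auto
    also have "\<dots> \<le> Q x powr \<theta>\<^sub>1" using m2(2) Q1 by (simp add: powr_powr powr_mono)
    finally show ?thesis .
  qed
  have b2: "u x * H x powr \<theta> \<le> Q x powr \<theta>\<^sub>1" if "1 < u x" for x
  proof -
    have "u x * H x powr \<theta> \<le> Q x powr (1 / m) * Q x powr \<theta>"
      using uQ[OF that] HQ[of x] H_nonneg[of x] \<theta> that by (intro mult_mono powr_mono2) auto
    also have "\<dots> = Q x powr (1 / m + \<theta>)" by (simp add: powr_add)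
    also have "\<dots> \<le> Q x powr \<theta>\<^sub>1" using m2(1) Q1 by (intro powr_mono) auto
    finally show ?thesis .
  qed
  note Qt = level_powr_integral[OF Qi Q0 \<theta>\<^sub>1(1,2)]
  define W where "W = 4 * B * integral\<^sup>L M Q powr \<theta>\<^sub>1"
  have W0: "0 \<le> W" using B by (simp add: W_def)
  have Dk: "D k \<le> W * a k powr (1 - \<theta>\<^sub>1)" if k: "1 \<le> k" for k
  proof -
    let ?ind = "indicat_real {x. k < u x}"
    have l1: "?ind x * u x powr ps \<le> ?ind x * Q x powr \<theta>\<^sub>1"
      and l2: "?ind x * (u x * H x powr \<theta>) \<le> ?ind x * Q x powr \<theta>\<^sub>1"
      and n2: "0 \<le> ?ind x * (u x * H x powr \<theta>)" for x
      using b1[of x] b2[of x] k by (auto simp: indicator_def)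
    have i1: "integrable M (\<lambda>x. ?ind x * u x powr ps)"
      by (rule Bochner_Integration.integrable_bound[OF Qt(1)[of k]]) (use l1 in \<open>auto intro!: AE_I2 simp: abs_of_nonneg\<close>)
    have i2: "integrable M (\<lambda>x. ?ind x * (u x * H x powr \<theta>))"
      by (rule Bochner_Integration.integrable_bound[OF Qt(1)[of k]])
         (use l2 n2 in \<open>auto intro!: AE_I2 order_trans[OF _ abs_ge_self] simp: abs_of_nonneg simp del: mult_le_cancel_left\<close>)
    have "D k \<le> B * ((LINT x|M. ?ind x * u x powr ps) + (LINT x|M. ?ind x * (u x * H x powr \<theta>)))"
      by (rule energy[OF k i1 i2])
    also have "\<dots> \<le> B * ((LINT x|M. ?ind x * Q x powr \<theta>\<^sub>1) + (LINT x|M. ?ind x * Q x powr \<theta>\<^sub>1))"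
      using B by (intro mult_left_mono add_mono integral_mono i1 i2 Qt(1) l1 l2) auto
    also have "\<dots> = 2 * B * (LINT x|M. ?ind x * Q x powr \<theta>\<^sub>1)" by simp
    also have "\<dots> \<le> 2 * B * (2 * (LINT x|M. ?ind x * Q x) powr \<theta>\<^sub>1 * a k powr (1 - \<theta>\<^sub>1))"
      using B Qt(2)[of k] by (intro mult_left_mono) auto
    also have "\<dots> \<le> 2 * B * (2 * integral\<^sup>L M Q powr \<theta>\<^sub>1 * a k powr (1 - \<theta>\<^sub>1))"
    proof -
      have "(LINT x|M. ?ind x * Q x) \<le> integral\<^sup>L M Q"
        using Q0 by (intro integral_mono indicator_integrable Qi) (auto simp: indicator_def)
      moreover have "0 \<le> (LINT x|M. ?ind x * Q x)"
        using Q0 by (intro Bochner_Integration.integral_nonneg) auto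
      ultimately show ?thesis
        using B \<theta>\<^sub>1 by (intro mult_left_mono mult_right_mono powr_mono2) auto
    qed
    finally show ?thesis by (simp add: W_def)
  qed
  have "\<exists>K. a K = 0"
  proof (rule stampacchia[of a "C * (W + 1)" p "1 + (\<theta>\<^sub>0 - \<theta>\<^sub>1)" 1])
    show "(h - k) powr p * a h \<le> C * (W + 1) * a k powr (1 + (\<theta>\<^sub>0 - \<theta>\<^sub>1))" if "1 \<le> k" "k < h" for k h
    proof -
      have "(LINT x|M. indicator {x. k < u x \<and> u x \<le> h} x * G x) \<le> D k"
        by (intro integral_mono indicator_integrable G_int) (auto simp: indicator_def G_nonneg)
      also have "\<dots> \<le> (W + 1) * a k powr (1 - \<theta>\<^sub>1)"
        using Dk[OF that(1)] by (simp add: distrib_right add_increasing2)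
      finally have "(h - k) powr p * a h \<le> C * a k powr \<theta>\<^sub>0 * ((W + 1) * a k powr (1 - \<theta>\<^sub>1))"
        using that C unfolding a_def \<theta>\<^sub>0_def by (intro order_trans[OF level] mult_left_mono) auto
      also have "\<dots> = C * (W + 1) * (a k powr \<theta>\<^sub>0 * a k powr (1 - \<theta>\<^sub>1))" by simp
      also have "a k powr \<theta>\<^sub>0 * a k powr (1 - \<theta>\<^sub>1) = a k powr (1 + (\<theta>\<^sub>0 - \<theta>\<^sub>1))"
        by (simp add: algebra_simps flip: powr_add)
      finally show ?thesis .
    qed
  qed (use a_nonneg a_mono C W0 p \<theta>\<^sub>1 in auto)
  then obtain K where K: "measure M {x \<in> space M. K < u x} = 0" by (auto simp: a_def)
  have "{x \<in> space M. K < u x} \<in> null_sets M"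
    using K by (intro null_setsI) (auto simp: emeasure_eq_measure)
  from AE_not_in[OF this] have "AE x in M. u x \<le> K"
    by (rule AE_mp) (auto intro!: AE_I2)
  then show ?thesis by blast
qed

end

section \<open>Bounded solutions of the system\<close>

lemma W0_level_estimate:
  fixes u :: "real^'n \<Rightarrow> real"
  assumes \<Omega>: "open \<Omega>" "bounded \<Omega>" and p: "1 < p" "p < ps" and W: "W0 \<Omega> p u g"
    and N: "1 - p / ps \<le> p / real CARD('n)"
  obtains C where "level_estimate (lebesgue_on \<Omega>) u (\<lambda>x. norm (g x) powr p) p ps C"
proof -
  interpret finite_measure "lebesgue_on \<Omega>" by (rule finite_measure_lebesgue_on_bounded[OF \<Omega>])
  have Lp: "u \<in> Lp \<Omega> p" "g \<in> Lp \<Omega> p" using W by (auto simp: W0_def)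
  obtain C where C: "0 < C" "\<And>k h. 0 \<le> k \<Longrightarrow> k < h \<Longrightarrow> (h - k) powr p * measure (lebesgue_on \<Omega>) {x \<in> \<Omega>. h < u x}
    \<le> C * measure (lebesgue_on \<Omega>) {x \<in> \<Omega>. k < u x} powr (1 - p / ps) * (LINT x|lebesgue_on \<Omega>. indicator {x. k < u x \<and> u x \<le> h} x * norm (g x) powr p)"
    by (rule level_inequality[OF \<Omega> p(1) W N]) blast
  have "level_estimate (lebesgue_on \<Omega>) u (\<lambda>x. norm (g x) powr p) p ps C"
    by unfold_locales (use C p LpD[OF Lp(1)] LpD[OF Lp(2)] in auto)
  then show thesis by (rule that)
qed

text \<open>The Sobolev embedding into \<open>L\<^sup>p\<^sup>s\<close>, obtained from the level estimates of \<open>u\<close> and of \<open>- u\<close>.\<close>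

lemma W0_critical_integrable:
  fixes u :: "real^'n \<Rightarrow> real"
  assumes \<Omega>: "open \<Omega>" "bounded \<Omega>" and p: "1 < p" "p < ps" and W: "W0 \<Omega> p u g"
    and N: "1 - p / ps \<le> p / real CARD('n)"
  shows "integrable (lebesgue_on \<Omega>) (\<lambda>x. \<bar>u x\<bar> powr ps)"
proof -
  interpret finite_measure "lebesgue_on \<Omega>" by (rule finite_measure_lebesgue_on_bounded[OF \<Omega>])
  have [measurable]: "u \<in> borel_measurable (lebesgue_on \<Omega>)" using W by (auto simp: W0_def Lp_def)
  have *: "integrable (lebesgue_on \<Omega>) (\<lambda>x. indicator {x. 1 < w x} x * w x powr ps)"
    if W: "W0 \<Omega> p w \<gamma>" for w \<gamma>
  proof -
    obtain C where "level_estimate (lebesgue_on \<Omega>) w (\<lambda>x. norm (\<gamma> x) powr p) p ps C"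
      by (rule W0_level_estimate[OF \<Omega> p W N])
    then interpret level_estimate "lebesgue_on \<Omega>" w "\<lambda>x. norm (\<gamma> x) powr p" p ps C .
    show ?thesis using critical_integrable[of 0] by simp
  qed
  show ?thesis
  proof (rule Bochner_Integration.integrable_bound)
    show "integrable (lebesgue_on \<Omega>) (\<lambda>x. 1 + indicator {x. 1 < u x} x * u x powr ps
        + indicator {x. 1 < - u x} x * (- u x) powr ps)"
      by (intro Bochner_Integration.integrable_add *[OF W] *[OF W0_uminus[OF \<Omega>(1) p(1) W]]) simp
    have "\<bar>u x\<bar> powr ps \<le> 1 + indicator {x. 1 < u x} x * u x powr ps
        + indicator {x. 1 < - u x} x * (- u x) powr ps" for x
    proof (cases "\<bar>u x\<bar> \<le> 1")
      case True
      then have "\<bar>u x\<bar> powr ps \<le> 1 powr ps" using p by (intro powr_mono2) auto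
      then show ?thesis by (simp add: add_increasing2)
    next
      case False
      then show ?thesis by (auto simp: indicator_def abs_if)
    qed
    then show "AE x in lebesgue_on \<Omega>. norm (\<bar>u x\<bar> powr ps) \<le> norm (1 + indicator {x. 1 < u x} x * u x powr ps
        + indicator {x. 1 < - u x} x * (- u x) powr ps)"
      by (intro AE_I2) (auto intro: order_trans[OF _ abs_ge_self])
  qed measurable
qed

lemma young_gradient:
  fixes x y p e :: real
  assumes "0 \<le> x" "0 \<le> y" "0 < e" "1 < p"
  shows "x powr (p - 1) * y \<le> e * x powr p + e powr (1 - p) * y powr p"
proof (cases "y \<le> e * x")
  case True
  have "x powr (p - 1) * y \<le> x powr (p - 1) * (e * x)" using True by (intro mult_left_mono) auto
  also have "\<dots> = e * x powr p"
    using assms powr_add[of x "p - 1" 1] by (cases "x = 0") auto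
  finally show ?thesis by (simp add: add_increasing2)
next
  case False
  then have y: "x \<le> y / e" "0 < y" using assms by (auto simp: field_simps intro: le_less_trans[of 0 "e * x"])
  have "x powr (p - 1) * y \<le> (y / e) powr (p - 1) * y"
    using y assms by (intro mult_right_mono powr_mono2) auto
  also have "\<dots> = e powr (1 - p) * (y powr (p - 1) * y)"
    using assms powr_minus_divide[of e "p - 1"] by (simp add: powr_divide)
  also have "y powr (p - 1) * y = y powr p" using y powr_add[of y "p - 1" 1] by simp
  finally show ?thesis using assms by (simp add: add_increasing)
qed

text \<open>On \<open>{u > k}\<close> with \<open>k \<ge> 1\<close> constants and all powers of \<open>u\<close> up to \<open>ps\<close> are at most \<open>u\<^sup>p\<^sup>s\<close>. The term with the
gradient is split by Young's inequality, and half of the coercivity absorbs its gradient part.\<close>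

lemma equation_bounded_above:
  fixes u :: "real^'n \<Rightarrow> real"
  assumes \<Omega>: "open \<Omega>" "bounded \<Omega>" and p: "1 < p" "p < ps" and W: "W0 \<Omega> p u g"
    and N: "1 - p / ps \<le> p / real CARD('n)"
    and eq: "\<And>\<phi> \<gamma>. W0 \<Omega> p \<phi> \<gamma> \<Longrightarrow> integrable (lebesgue_on \<Omega>) (\<lambda>x. a x \<bullet> \<gamma> x) \<and>
       integrable (lebesgue_on \<Omega>) (\<lambda>x. b x * \<phi> x) \<and>
       (LINT x|lebesgue_on \<Omega>. a x \<bullet> \<gamma> x) = (LINT x|lebesgue_on \<Omega>. b x * \<phi> x)"
    and \<alpha>: "0 < \<alpha>" and L: "0 < L"
    and coercive: "AE x in lebesgue_on \<Omega>. \<alpha> * norm (g x) powr p - L * (\<bar>u x\<bar> powr ps + 1) \<le> a x \<bullet> g x"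
    and growth: "AE x in lebesgue_on \<Omega>. \<bar>b x\<bar> \<le> L * (\<bar>u x\<bar> powr (ps - 1) + norm (g x) powr (p - 1) + H x powr \<theta>)"
    and H: "integrable (lebesgue_on \<Omega>) H" "\<And>x. 1 \<le> H x" and \<theta>: "0 \<le> \<theta>" "\<theta> < 1 - p / ps"
  shows "\<exists>K. AE x in lebesgue_on \<Omega>. u x \<le> K"
proof -
  let ?M = "lebesgue_on \<Omega>"
  obtain C where "level_estimate ?M u (\<lambda>x. norm (g x) powr p) p ps C"
    by (rule W0_level_estimate[OF \<Omega> p W N])
  then interpret level_estimate ?M u "\<lambda>x. norm (g x) powr p" p ps C .
  define e where "e = \<alpha> / (2 * L)"
  have e: "0 < e" using \<alpha> L by (simp add: e_def)
  define A where "A = L * (3 + e powr (1 - p))"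
  have A: "L \<le> A" "0 < A" using L by (auto simp: A_def intro!: mult_pos_pos add_pos_nonneg)
  define B where "B = 2 * A / \<alpha>"
  have B: "0 < B" using A \<alpha> by (simp add: B_def)
  have "level_energy_estimate ?M u (\<lambda>x. norm (g x) powr p) p ps C H \<theta> B"
  proof
    fix k :: real assume k: "1 \<le> k"
    let ?ind = "indicat_real {x. k < u x}"
    assume i1: "integrable ?M (\<lambda>x. ?ind x * u x powr ps)"
      and i2: "integrable ?M (\<lambda>x. ?ind x * (u x * H x powr \<theta>))"
    have k0: "0 \<le> k" using k by simp
    have li: "integrable ?M (\<lambda>x. ?ind x * (a x \<bullet> g x))" "integrable ?M (\<lambda>x. b x * max (u x - k) 0)"
      "(LINT x|?M. ?ind x * (a x \<bullet> g x)) = (LINT x|?M. b x * max (u x - k) 0)"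
      by (rule level_identity[OF \<Omega>(1) p(1) W k0]; rule eq; assumption)+
    have i3: "integrable ?M (\<lambda>x. ?ind x * norm (g x) powr p)"
      by (intro indicator_integrable G_int) simp
    have comb1: "(LINT x|?M. \<alpha> * f1 x - f2 x + f3 x) = \<alpha> * integral\<^sup>L ?M f1 - integral\<^sup>L ?M f2 + integral\<^sup>L ?M f3"
      and comb2: "(LINT x|?M. \<alpha> / 2 * f1 x + A * f2 x + A * f3 x) = \<alpha> / 2 * integral\<^sup>L ?M f1 + A * integral\<^sup>L ?M f2 + A * integral\<^sup>L ?M f3"
      if "integrable ?M f1" "integrable ?M f2" "integrable ?M f3" for f1 f2 f3 :: "real^'n \<Rightarrow> real"
      using that by simp_all
    have "AE x in ?M. \<alpha> * (?ind x * norm (g x) powr p) - ?ind x * (a x \<bullet> g x) + b x * max (u x - k) 0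
        \<le> \<alpha> / 2 * (?ind x * norm (g x) powr p) + A * (?ind x * u x powr ps) + A * (?ind x * (u x * H x powr \<theta>))"
      using coercive growth
    proof eventually_elim
      case (elim x)
      show ?case
      proof (cases "k < u x")
        case True
        then have u: "1 < u x" using k by simp
        have up: "u x powr p \<le> u x powr ps" "1 \<le> u x powr ps"
          using u p powr_mono[of 0 ps "u x"] by (auto intro!: powr_mono)
        have "b x * (u x - k) \<le> \<bar>b x\<bar> * u x"
        proof -
          have "b x * (u x - k) \<le> \<bar>b x\<bar> * (u x - k)" using True by (intro mult_right_mono) auto
          also have "\<dots> \<le> \<bar>b x\<bar> * u x" using k by (intro mult_left_mono) auto
          finally show ?thesis .
        qed
        also have "\<dots> \<le> L * (\<bar>u x\<bar> powr (ps - 1) + norm (g x) powr (p - 1) + H x powr \<theta>) * u x"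
          using elim(2) u by (intro mult_right_mono) auto
        also have "\<dots> = L * (u x powr (ps - 1) * u x) + L * (norm (g x) powr (p - 1) * u x) + L * (u x * H x powr \<theta>)"
          using u by (simp add: algebra_simps)
        also have "u x powr (ps - 1) * u x = u x powr ps" using u powr_add[of "u x" "ps - 1" 1] by simp
        also have "L * (norm (g x) powr (p - 1) * u x) \<le> L * (e * norm (g x) powr p + e powr (1 - p) * u x powr ps)"
          using L u e p up by (intro mult_left_mono order_trans[OF young_gradient[of _ _ e p]] add_left_mono) auto
        also have "L * (e * norm (g x) powr p + e powr (1 - p) * u x powr ps)
            = \<alpha> / 2 * norm (g x) powr p + L * e powr (1 - p) * u x powr ps"
          using L by (simp add: e_def field_simps)
        finally have "b x * (u x - k) \<le> L * u x powr ps + (\<alpha> / 2 * norm (g x) powr p + L * e powr (1 - p) * u x powr ps)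
            + L * (u x * H x powr \<theta>)" by simp
        moreover have "\<alpha> * norm (g x) powr p - a x \<bullet> g x \<le> L * (2 * u x powr ps)"
        proof -
          have "L * (\<bar>u x\<bar> powr ps + 1) \<le> L * (2 * u x powr ps)"
            using L u up by (intro mult_left_mono) auto
          with elim(1) show ?thesis by linarith
        qed
        moreover have "L * (u x * H x powr \<theta>) \<le> A * (u x * H x powr \<theta>)"
          using A u by (intro mult_right_mono) auto
        moreover have "A * u x powr ps = L * u x powr ps + L * e powr (1 - p) * u x powr ps + L * (2 * u x powr ps)"
          by (simp add: A_def algebra_simps)
        ultimately show ?thesis using True by simp
      qed simp
    qed
    then have "(LINT x|?M. \<alpha> * (?ind x * norm (g x) powr p) - ?ind x * (a x \<bullet> g x) + b x * max (u x - k) 0)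
        \<le> (LINT x|?M. \<alpha> / 2 * (?ind x * norm (g x) powr p) + A * (?ind x * u x powr ps) + A * (?ind x * (u x * H x powr \<theta>)))"
      by (intro integral_mono_AE Bochner_Integration.integrable_add Bochner_Integration.integrable_diff integrable_mult_right i1 i2 i3 li(1,2))
    then have "\<alpha> * D k - (LINT x|?M. ?ind x * (a x \<bullet> g x)) + (LINT x|?M. b x * max (u x - k) 0)
        \<le> \<alpha> / 2 * D k + A * (LINT x|?M. ?ind x * u x powr ps) + A * (LINT x|?M. ?ind x * (u x * H x powr \<theta>))"
      unfolding comb1[OF i3 li(1,2)] comb2[OF i3 i1 i2] .
    then have "\<alpha> / 2 * D k \<le> A * ((LINT x|?M. ?ind x * u x powr ps) + (LINT x|?M. ?ind x * (u x * H x powr \<theta>)))"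
      using li(3) by (simp add: algebra_simps)
    then have "2 / \<alpha> * (\<alpha> / 2 * D k) \<le> 2 / \<alpha> * (A * ((LINT x|?M. ?ind x * u x powr ps) + (LINT x|?M. ?ind x * (u x * H x powr \<theta>))))"
      using \<alpha> by (intro mult_left_mono) auto
    then show "D k \<le> B * ((LINT x|?M. ?ind x * u x powr ps) + (LINT x|?M. ?ind x * (u x * H x powr \<theta>)))"
      using \<alpha> by (simp add: B_def)
  qed (use H \<theta> B in auto)
  then interpret E: level_energy_estimate ?M u "\<lambda>x. norm (g x) powr p" p ps C H \<theta> B .
  show ?thesis by (rule E.essentially_bounded_above)
qed

lemma equation_bounded:
  fixes u :: "real^'n \<Rightarrow> real"
  assumes \<Omega>: "open \<Omega>" "bounded \<Omega>" and p: "1 < p" "p < ps" and W: "W0 \<Omega> p u g"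
    and N: "1 - p / ps \<le> p / real CARD('n)"
    and eq: "\<And>\<phi> \<gamma>. W0 \<Omega> p \<phi> \<gamma> \<Longrightarrow> integrable (lebesgue_on \<Omega>) (\<lambda>x. a x \<bullet> \<gamma> x) \<and>
       integrable (lebesgue_on \<Omega>) (\<lambda>x. b x * \<phi> x) \<and>
       (LINT x|lebesgue_on \<Omega>. a x \<bullet> \<gamma> x) = (LINT x|lebesgue_on \<Omega>. b x * \<phi> x)"
    and \<alpha>: "0 < \<alpha>" and L: "0 < L"
    and coercive: "AE x in lebesgue_on \<Omega>. \<alpha> * norm (g x) powr p - L * (\<bar>u x\<bar> powr ps + 1) \<le> a x \<bullet> g x"
    and growth: "AE x in lebesgue_on \<Omega>. \<bar>b x\<bar> \<le> L * (\<bar>u x\<bar> powr (ps - 1) + norm (g x) powr (p - 1) + H x powr \<theta>)"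
    and H: "integrable (lebesgue_on \<Omega>) H" "\<And>x. 1 \<le> H x" and \<theta>: "0 \<le> \<theta>" "\<theta> < 1 - p / ps"
  shows "\<exists>K. AE x in lebesgue_on \<Omega>. \<bar>u x\<bar> \<le> K"
proof -
  obtain K1 where K1: "AE x in lebesgue_on \<Omega>. u x \<le> K1"
    using equation_bounded_above[OF \<Omega> p W N eq \<alpha> L coercive growth H \<theta>] by blast
  have "\<exists>K. AE x in lebesgue_on \<Omega>. - u x \<le> K"
  proof (rule equation_bounded_above[OF \<Omega> p W0_uminus[OF \<Omega>(1) p(1) W] N _ \<alpha> L _ _ H \<theta>])
    show "integrable (lebesgue_on \<Omega>) (\<lambda>x. - a x \<bullet> \<gamma> x) \<and> integrable (lebesgue_on \<Omega>) (\<lambda>x. - b x * \<phi> x) \<and>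
       (LINT x|lebesgue_on \<Omega>. - a x \<bullet> \<gamma> x) = (LINT x|lebesgue_on \<Omega>. - b x * \<phi> x)"
      if "W0 \<Omega> p \<phi> \<gamma>" for \<phi> \<gamma>
      using eq[OF that] by simp
  qed (use coercive growth in simp_all)
  then obtain K2 where K2: "AE x in lebesgue_on \<Omega>. - u x \<le> K2" by blast
  have "AE x in lebesgue_on \<Omega>. \<bar>u x\<bar> \<le> max K1 K2"
    using K1 K2 by eventually_elim auto
  then show ?thesis by blast
qed

lemma rpow_le_one_add:
  assumes "0 \<le> x" "0 \<le> e" "e \<le> E" shows "rpow x e \<le> 1 + x powr E"
proof (cases "e = 0")
  case False
  then have "x powr e \<le> 1 + x powr E"
  proof (cases "x \<le> 1")
    case True
    then have "x powr e \<le> 1 powr e" using assms by (intro powr_mono2) auto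
    then show ?thesis by (simp add: add_increasing2)
  next
    case False
    then have "x powr e \<le> x powr E" using assms by (intro powr_mono) auto
    then show ?thesis by simp
  qed
  with False show ?thesis by (simp add: rpow_def)
qed (simp add: rpow_def)

lemma rpow_le_powr:
  assumes "0 \<le> x" "0 \<le> e" "0 < r" "x powr r \<le> h" "1 \<le> h"
  shows "rpow x e \<le> h powr (e / r)"
proof (cases "e = 0")
  case False
  have "x powr e = (x powr r) powr (e / r)" using assms by (simp add: powr_powr)
  also have "\<dots> \<le> h powr (e / r)" using assms by (intro powr_mono2) auto
  finally show ?thesis using False by (simp add: rpow_def)
qed (use assms in \<open>simp add: rpow_def\<close>)

lemma rpow_nonneg: "0 \<le> rpow x e" by (simp add: rpow_def)

text \<open>All lower order terms are bounded by one power of \<open>H\<close>, because each quantity that occurs is at most a power of \<open>H\<close> and the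
exponents add up to at most \<open>\<theta>\<close>. The bounds are symmetric in the two components, so the lemma
serves both equations.\<close>

lemma system_component_bounded:
  fixes u v :: "real^'n \<Rightarrow> real"
  assumes \<Omega>: "open \<Omega>" "bounded \<Omega>" and p: "1 < p" "p < ps" and q: "1 < q" "q < qs"
    and W: "W0 \<Omega> p u g" and V: "W0 \<Omega> q v h"
    and N: "1 - p / ps \<le> p / real CARD('n)" "1 - q / qs \<le> q / real CARD('n)"
    and eq: "\<And>\<phi> \<gamma>. W0 \<Omega> p \<phi> \<gamma> \<Longrightarrow> integrable (lebesgue_on \<Omega>) (\<lambda>x. a x \<bullet> \<gamma> x) \<and>
       integrable (lebesgue_on \<Omega>) (\<lambda>x. b x * \<phi> x) \<and>
       (LINT x|lebesgue_on \<Omega>. a x \<bullet> \<gamma> x) = (LINT x|lebesgue_on \<Omega>. b x * \<phi> x)"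
    and A: "0 < A4" "0 \<le> A5" "0 \<le> A6" and r: "0 \<le> r" "r \<le> ps"
    and B: "0 \<le> B1" "0 \<le> B2" "0 \<le> B3" "0 \<le> B4" "0 \<le> B5" "0 \<le> B6" "0 \<le> B7"
    and e: "0 \<le> e1" "0 \<le> e2" "0 \<le> e3" "0 \<le> e4" "0 \<le> e5" "0 \<le> e6" "0 \<le> e7" "0 \<le> e8"
    and sub: "e1 \<le> ps - 1" "e2 / qs < 1 - p / ps" "e3 / ps + e4 / qs < 1 - p / ps"
      "e5 \<le> p - 1" "e6 / q < 1 - p / ps" "e7 / p + e8 / q < 1 - p / ps"
    and coercive: "AE x in lebesgue_on \<Omega>. A4 * rpow (norm (g x)) p - A5 * rpow \<bar>u x\<bar> r - A6 \<le> a x \<bullet> g x"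
    and growth: "AE x in lebesgue_on \<Omega>. \<bar>b x\<bar> \<le> B1 * rpow \<bar>u x\<bar> e1 + B2 * rpow \<bar>v x\<bar> e2
        + B3 * rpow \<bar>u x\<bar> e3 * rpow \<bar>v x\<bar> e4 + B4 * rpow (norm (g x)) e5 + B5 * rpow (norm (h x)) e6
        + B6 * rpow (norm (g x)) e7 * rpow (norm (h x)) e8 + B7"
  shows "\<exists>K. AE x in lebesgue_on \<Omega>. \<bar>u x\<bar> \<le> K"
proof -
  let ?M = "lebesgue_on \<Omega>"
  interpret finite_measure ?M by (rule finite_measure_lebesgue_on_bounded[OF \<Omega>])
  define H where "H x = 1 + \<bar>u x\<bar> powr ps + \<bar>v x\<bar> powr qs + norm (g x) powr p + norm (h x) powr q" for x
  have Hi: "integrable ?M H"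
    unfolding H_def using W V
    by (intro Bochner_Integration.integrable_add W0_critical_integrable[OF \<Omega> p W N(1)] W0_critical_integrable[OF \<Omega> q V N(2)])
      (auto simp: W0_def Lp_def)
  have Hb: "\<bar>u x\<bar> powr ps \<le> H x" "\<bar>v x\<bar> powr qs \<le> H x" "norm (g x) powr p \<le> H x" "norm (h x) powr q \<le> H x" "1 \<le> H x" for x
    by (simp_all add: H_def add_nonneg_nonneg add_increasing add_increasing2)
  define \<theta> where "\<theta> = Max {e2 / qs, e3 / ps + e4 / qs, e6 / q, e7 / p + e8 / q}"
  have \<theta>: "e2 / qs \<le> \<theta>" "e3 / ps + e4 / qs \<le> \<theta>" "e6 / q \<le> \<theta>" "e7 / p + e8 / q \<le> \<theta>" "\<theta> < 1 - p / ps"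
    unfolding \<theta>_def using sub by auto
  have \<theta>0: "0 \<le> \<theta>" using \<theta>(1) e q by (intro order_trans[OF _ \<theta>(1)]) auto
  define L where "L = 1 + A5 + A6 + B1 + B2 + B3 + B4 + B5 + B6 + B7"
  have L: "0 < L" using A B by (simp add: L_def)
  have mono: "y \<le> H x powr \<theta>" if "y \<le> H x powr t" "t \<le> \<theta>" for x y t
    using that Hb(5)[of x] powr_mono[of t \<theta> "H x"] by linarith
  show ?thesis
  proof (rule equation_bounded[OF \<Omega> p W N(1) eq A(1) L _ _ Hi Hb(5) \<theta>0 \<theta>(5)])
    show "AE x in ?M. A4 * norm (g x) powr p - L * (\<bar>u x\<bar> powr ps + 1) \<le> a x \<bullet> g x"
      using coercive
    proof eventually_elim
      case (elim x)
      have "A5 * rpow \<bar>u x\<bar> r \<le> A5 * (1 + \<bar>u x\<bar> powr ps)"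
        using A r by (intro mult_left_mono rpow_le_one_add) auto
      moreover have "A6 * 1 \<le> A6 * (1 + \<bar>u x\<bar> powr ps)" using A by (intro mult_left_mono) auto
      moreover have "(A5 + A6) * (1 + \<bar>u x\<bar> powr ps) \<le> L * (1 + \<bar>u x\<bar> powr ps)"
        using B by (intro mult_right_mono) (auto simp: L_def)
      moreover have "rpow (norm (g x)) p = norm (g x) powr p" using p by (simp add: rpow_def)
      ultimately show ?case using elim by (simp add: algebra_simps)
    qed
    show "AE x in ?M. \<bar>b x\<bar> \<le> L * (\<bar>u x\<bar> powr (ps - 1) + norm (g x) powr (p - 1) + H x powr \<theta>)"
      using growth
    proof eventually_elim
      case (elim x)
      define Z where "Z = \<bar>u x\<bar> powr (ps - 1) + norm (g x) powr (p - 1) + H x powr \<theta>"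
      have one: "1 \<le> H x powr \<theta>" using Hb(5) \<theta>0 by (rule ge_one_powr_ge_zero)
      have Z: "1 + \<bar>u x\<bar> powr (ps - 1) \<le> Z" "1 + norm (g x) powr (p - 1) \<le> Z" "H x powr \<theta> \<le> Z" "1 \<le> Z"
        using one by (auto simp: Z_def add_increasing add_increasing2)
      have 1: "rpow \<bar>u x\<bar> e1 \<le> Z"
        using e sub by (intro order_trans[OF rpow_le_one_add Z(1)]) auto
      have 4: "rpow (norm (g x)) e5 \<le> Z"
        using e sub by (intro order_trans[OF rpow_le_one_add Z(2)]) auto
      have 2: "rpow \<bar>v x\<bar> e2 \<le> Z"
        using e q Hb by (intro order_trans[OF mono[OF rpow_le_powr \<theta>(1)] Z(3)]) auto
      have 5: "rpow (norm (h x)) e6 \<le> Z"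
        using e q Hb by (intro order_trans[OF mono[OF rpow_le_powr \<theta>(3)] Z(3)]) auto
      have 3: "rpow \<bar>u x\<bar> e3 * rpow \<bar>v x\<bar> e4 \<le> Z"
      proof (rule order_trans[OF mono[OF _ \<theta>(2)] Z(3)])
        have "rpow \<bar>u x\<bar> e3 * rpow \<bar>v x\<bar> e4 \<le> H x powr (e3 / ps) * H x powr (e4 / qs)"
          using e p q Hb by (intro mult_mono rpow_le_powr rpow_nonneg) auto
        then show "rpow \<bar>u x\<bar> e3 * rpow \<bar>v x\<bar> e4 \<le> H x powr (e3 / ps + e4 / qs)" by (simp add: powr_add)
      qed
      have 6: "rpow (norm (g x)) e7 * rpow (norm (h x)) e8 \<le> Z"
      proof (rule order_trans[OF mono[OF _ \<theta>(4)] Z(3)])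
        have "rpow (norm (g x)) e7 * rpow (norm (h x)) e8 \<le> H x powr (e7 / p) * H x powr (e8 / q)"
          using e p q Hb by (intro mult_mono rpow_le_powr rpow_nonneg) auto
        then show "rpow (norm (g x)) e7 * rpow (norm (h x)) e8 \<le> H x powr (e7 / p + e8 / q)" by (simp add: powr_add)
      qed
      have "\<bar>b x\<bar> \<le> B1 * Z + B2 * Z + B3 * Z + B4 * Z + B5 * Z + B6 * Z + B7 * Z"
        using B Z(4) mult_left_mono[OF 1 B(1)] mult_left_mono[OF 2 B(2)] mult_left_mono[OF 3 B(3)]
          mult_left_mono[OF 4 B(4)] mult_left_mono[OF 5 B(5)] mult_left_mono[OF 6 B(6)] mult_left_mono[OF Z(4) B(7)] elim
        by (simp only: mult.assoc mult_1_right)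
      also have "\<dots> = (B1 + B2 + B3 + B4 + B5 + B6 + B7) * Z" by (simp add: algebra_simps)
      also have "\<dots> \<le> L * Z" using Z(4) A by (intro mult_right_mono) (auto simp: L_def)
      finally show ?case by (simp add: Z_def)
    qed
  qed
qed

lemma critical_exponent_ratio:
  assumes "critical_exponent n r m" "1 < r" "1 < n"
  shows "0 < m" "r < m \<Longrightarrow> 1 - r / m \<le> r / n"
proof -
  show m: "0 < m" using assms by (auto simp: critical_exponent_def split: if_splits)
  show "1 - r / m \<le> r / n" if "r < m"
  proof (cases "r < n")
    case True
    then have "m = n * r / (n - r)" using assms by (simp add: critical_exponent_def)
    then have "r / m = (n - r) / n" using True assms by simp
    then show ?thesis using assms by (simp add: diff_divide_distrib)
  next
    case False
    then have "1 \<le> r / n" using assms by simp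
    moreover have "0 < r / m" using m assms by simp
    ultimately show ?thesis by linarith
  qed
qed

text \<open>The approximating test functions vanish on the boundary.\<close>

lemma sobolev0_trace_zero:
  assumes "open \<Omega>" "u \<in> sobolev0 \<Omega> p"
  shows "is_trace \<Omega> p u (\<lambda>x. 0)"
  unfolding is_trace_def
proof (intro conjI allI impI)
  show "u \<in> sobolev \<Omega> p" using assms by (simp add: sobolev0_def)
  fix e :: real assume e: "0 < e"
  then obtain \<phi> where \<phi>: "\<phi> \<in> test_functions \<Omega>" "sobolev_norm \<Omega> p (\<lambda>x. u x - \<phi> x) < e"
    using assms(2) by (auto simp: sobolev0_def)
  have "(\<integral>\<^sup>+x. ennreal (\<bar>0 - \<phi> x\<bar> powr p) \<partial>surface_measure \<Omega>) = (\<integral>\<^sup>+x. 0 \<partial>surface_measure \<Omega>)"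
  proof (rule nn_integral_cong)
    fix x assume "x \<in> space (surface_measure \<Omega>)"
    then have "x \<notin> \<Omega>"
      using assms(1) by (auto simp: surface_measure_def space_restrict_space frontier_def interior_open)
    then show "ennreal (\<bar>0 - \<phi> x\<bar> powr p) = 0" using test_functionsD(4)[OF \<phi>(1)] by simp
  qed
  then show "\<exists>\<phi>. smooth \<phi> \<and> sobolev_norm \<Omega> p (\<lambda>x. u x - \<phi> x) < e \<and>
      (\<integral>\<^sup>+x. ennreal (\<bar>0 - \<phi> x\<bar> powr p) \<partial>surface_measure \<Omega>) < ennreal e"
    using \<phi> e test_functionsD(1)[OF \<phi>(1)] by auto
qed simp

lemma bounded_imp_Linfty_closure:
  assumes "open \<Omega>" "u \<in> sobolev0 \<Omega> p" "AE x in lebesgue_on \<Omega>. \<bar>u x\<bar> \<le> K"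
  shows "u \<in> Linfty_closure \<Omega> p"
proof -
  have "u \<in> borel_measurable (lebesgue_on \<Omega>)"
    using assms(2) by (auto simp: sobolev0_def sobolev_def Lp_def)
  moreover have "(\<lambda>x. 0) \<in> Linfty (surface_measure \<Omega>)" by (auto simp: Linfty_def intro!: exI[of _ 0])
  ultimately show ?thesis
    using sobolev0_trace_zero[OF assms(1,2)] assms(3) unfolding Linfty_closure_def
    by (intro CollectI conjI exI[of _ "\<lambda>x. 0"]) (auto simp: Linfty_def)
qed

text \<open>The identities of a weak solution refer to chosen gradients; they hold for every version of the gradient.\<close>

lemma weak_identity_W0:
  fixes a :: "real^'n \<Rightarrow> real^'n"
  assumes \<Omega>: "open \<Omega>" "bounded \<Omega>" and p: "1 < p" and W: "W0 \<Omega> p \<phi> \<gamma>"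
    and eq: "\<And>\<phi>. \<phi> \<in> sobolev0 \<Omega> p \<Longrightarrow> integrable (lebesgue_on \<Omega>) (\<lambda>x. a x \<bullet> weak_gradient \<Omega> \<phi> x) \<and>
       integrable (lebesgue_on \<Omega>) (\<lambda>x. b x * \<phi> x) \<and>
       (LINT x|lebesgue_on \<Omega>. a x \<bullet> weak_gradient \<Omega> \<phi> x) = (LINT x|lebesgue_on \<Omega>. b x * \<phi> x)"
  shows "integrable (lebesgue_on \<Omega>) (\<lambda>x. a x \<bullet> \<gamma> x) \<and> integrable (lebesgue_on \<Omega>) (\<lambda>x. b x * \<phi> x) \<and>
       (LINT x|lebesgue_on \<Omega>. a x \<bullet> \<gamma> x) = (LINT x|lebesgue_on \<Omega>. b x * \<phi> x)"
proof -
  note s = W0_imp_sobolev0[OF \<Omega> p W]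
  note e = eq[OF s(1)]
  have ae: "AE x in lebesgue_on \<Omega>. a x \<bullet> \<gamma> x = a x \<bullet> weak_gradient \<Omega> \<phi> x"
    using s(2) by eventually_elim simp
  have m: "(\<lambda>x. a x \<bullet> weak_gradient \<Omega> \<phi> x) \<in> borel_measurable (lebesgue_on \<Omega>)" using e by auto
  have m': "(\<lambda>x. a x \<bullet> \<gamma> x) \<in> borel_measurable (lebesgue_on \<Omega>)"
    by (rule measurable_AE_on[OF \<Omega>(1) m ae])
  have "integrable (lebesgue_on \<Omega>) (\<lambda>x. a x \<bullet> \<gamma> x) \<longleftrightarrow> integrable (lebesgue_on \<Omega>) (\<lambda>x. a x \<bullet> weak_gradient \<Omega> \<phi> x)"
    by (rule integrable_cong_AE[OF m' m ae])
  moreover have "(LINT x|lebesgue_on \<Omega>. a x \<bullet> \<gamma> x) = (LINT x|lebesgue_on \<Omega>. a x \<bullet> weak_gradient \<Omega> \<phi> x)"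
    by (rule integral_cong_AE[OF m' m ae])
  ultimately show ?thesis using e by simp
qed

theorem theorem3p4:
  fixes \<Omega> :: "(real^'n) set"
    and p q ps qs r\<^sub>1 r\<^sub>2 :: real
    and \<A>\<^sub>1 \<A>\<^sub>2 :: "real^'n \<Rightarrow> real \<Rightarrow> real^'n \<Rightarrow> real^'n"
    and \<B>\<^sub>1 \<B>\<^sub>2 :: "real^'n \<Rightarrow> real \<Rightarrow> real \<Rightarrow> real^'n \<Rightarrow> real^'n \<Rightarrow> real"
    and A A' B B' b b' :: "nat \<Rightarrow> real"
    and u v :: "real^'n \<Rightarrow> real"
  assumes "CARD('n) > 1"
    and "open \<Omega>" "connected \<Omega>" "\<Omega> \<noteq> {}" "bounded \<Omega>" "lipschitz_boundary \<Omega>"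
    and "1 < p" "1 < q"
    and "critical_exponent (real CARD('n)) p ps" "critical_exponent (real CARD('n)) q qs"
    and "caratheodory \<Omega> (\<lambda>x (s, \<xi>). \<A>\<^sub>1 x s \<xi>)"
    and "caratheodory \<Omega> (\<lambda>x (t, \<zeta>). \<A>\<^sub>2 x t \<zeta>)"
    and "caratheodory \<Omega> (\<lambda>x (s, t, \<xi>, \<zeta>). \<B>\<^sub>1 x s t \<xi> \<zeta>)"
    and "caratheodory \<Omega> (\<lambda>x (s, t, \<xi>, \<zeta>). \<B>\<^sub>2 x s t \<xi> \<zeta>)"
    and "AE x in lebesgue_on \<Omega>. \<forall>s t \<xi> \<zeta>.
        norm (\<A>\<^sub>1 x s \<xi>) \<le> A 1 * rpow (norm \<xi>) (p - 1) + A 2 * rpow (abs s) (r\<^sub>1 * ((p - 1) / p)) + A 3 \<and>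
        norm (\<A>\<^sub>2 x t \<zeta>) \<le> A' 1 * rpow (norm \<zeta>) (q - 1) + A' 2 * rpow (abs t) (r\<^sub>2 * ((q - 1) / q)) + A' 3 \<and>
        \<A>\<^sub>1 x s \<xi> \<bullet> \<xi> \<ge> A 4 * rpow (norm \<xi>) p - A 5 * rpow (abs s) r\<^sub>1 - A 6 \<and>
        \<A>\<^sub>2 x t \<zeta> \<bullet> \<zeta> \<ge> A' 4 * rpow (norm \<zeta>) q - A' 5 * rpow (abs t) r\<^sub>2 - A' 6 \<and>
        abs (\<B>\<^sub>1 x s t \<xi> \<zeta>) \<le>
          B 1 * rpow (abs s) (b 1) + B 2 * rpow (abs t) (b 2) + B 3 * rpow (abs s) (b 3) * rpow (abs t) (b 4)
          + B 4 * rpow (norm \<xi>) (b 5) + B 5 * rpow (norm \<zeta>) (b 6)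
          + B 6 * rpow (norm \<xi>) (b 7) * rpow (norm \<zeta>) (b 8) + B 7 \<and>
        abs (\<B>\<^sub>2 x s t \<xi> \<zeta>) \<le>
          B' 1 * rpow (abs s) (b' 1) + B' 2 * rpow (abs t) (b' 2) + B' 3 * rpow (abs s) (b' 3) * rpow (abs t) (b' 4)
          + B' 4 * rpow (norm \<xi>) (b' 5) + B' 5 * rpow (norm \<zeta>) (b' 6)
          + B' 6 * rpow (norm \<xi>) (b' 7) * rpow (norm \<zeta>) (b' 8) + B' 7"
    and "\<forall>i\<in>{1..6}. 0 \<le> A i \<and> 0 \<le> A' i" "0 < A 4" "0 < A' 4"
    and "\<forall>j\<in>{1..7}. 0 \<le> B j \<and> 0 \<le> B' j"
    and "\<forall>i\<in>{1..8}. 0 \<le> b i \<and> 0 \<le> b' i" "0 \<le> r\<^sub>1" "0 \<le> r\<^sub>2"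
    and "r\<^sub>1 \<le> ps" "r\<^sub>2 \<le> qs"
    and "b 1 \<le> ps - 1" "b 2 < qs / ps * (ps - p)" "b 3 / ps + b 4 / qs < (ps - p) / ps"
    and "b 5 \<le> p - 1" "b 6 < q / ps * (ps - p)" "b 7 / p + b 8 / q < (ps - p) / ps"
    and "b' 1 < ps / qs * (qs - q)" "b' 2 \<le> qs - 1" "b' 3 / ps + b' 4 / qs < (qs - q) / qs"
    and "b' 5 < p / qs * (qs - q)" "b' 6 \<le> q - 1" "b' 7 / p + b' 8 / q < (qs - q) / qs"
    and "weak_solution \<Omega> p q \<A>\<^sub>1 \<A>\<^sub>2 \<B>\<^sub>1 \<B>\<^sub>2 u v"
  shows "u \<in> Linfty_closure \<Omega> p \<and> v \<in> Linfty_closure \<Omega> q"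
proof -
  note hyps = assms
  note dim = hyps(1) and \<Omega> = hyps(2,5) and p = hyps(7) and q = hyps(8)
    and ps = hyps(9) and qs = hyps(10) and growth = hyps(15)
    and A_nonneg = hyps(16) and A4 = hyps(17,18) and B_nonneg = hyps(19) and b_nonneg = hyps(20)
    and r = hyps(21-24) and sub = hyps(25-30) and sub' = hyps(31-36) and sol = hyps(37)
  define Du where "Du = weak_gradient \<Omega> u"
  define Dv where "Dv = weak_gradient \<Omega> v"
  have u0: "u \<in> sobolev0 \<Omega> p" and v0: "v \<in> sobolev0 \<Omega> q"
    using sol by (auto simp: weak_solution_def)
  have W: "W0 \<Omega> p u Du" and V: "W0 \<Omega> q v Dv"
    unfolding Du_def Dv_def using sobolev0_imp_W0[OF \<Omega>(1)] p q u0 v0 by auto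
  have sys: "integrable (lebesgue_on \<Omega>) (\<lambda>x. \<A>\<^sub>1 x (u x) (Du x) \<bullet> weak_gradient \<Omega> \<phi> x) \<and>
        integrable (lebesgue_on \<Omega>) (\<lambda>x. \<B>\<^sub>1 x (u x) (v x) (Du x) (Dv x) * \<phi> x) \<and>
        integrable (lebesgue_on \<Omega>) (\<lambda>x. \<A>\<^sub>2 x (v x) (Dv x) \<bullet> weak_gradient \<Omega> \<psi> x) \<and>
        integrable (lebesgue_on \<Omega>) (\<lambda>x. \<B>\<^sub>2 x (u x) (v x) (Du x) (Dv x) * \<psi> x) \<and>
        (LINT x|lebesgue_on \<Omega>. \<A>\<^sub>1 x (u x) (Du x) \<bullet> weak_gradient \<Omega> \<phi> x) =
          (LINT x|lebesgue_on \<Omega>. \<B>\<^sub>1 x (u x) (v x) (Du x) (Dv x) * \<phi> x) \<and>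
        (LINT x|lebesgue_on \<Omega>. \<A>\<^sub>2 x (v x) (Dv x) \<bullet> weak_gradient \<Omega> \<psi> x) =
          (LINT x|lebesgue_on \<Omega>. \<B>\<^sub>2 x (u x) (v x) (Du x) (Dv x) * \<psi> x)"
    if "\<phi> \<in> sobolev0 \<Omega> p" "\<psi> \<in> sobolev0 \<Omega> q" for \<phi> \<psi>
    using sol that unfolding weak_solution_def Let_def Du_def Dv_def by blast
  have n: "1 < real CARD('n)" using dim by simp
  have pos: "0 < ps" "0 < qs"
    using critical_exponent_ratio(1)[OF ps p n] critical_exponent_ratio(1)[OF qs q n] .
  \<comment> \<open>for \<open>p \<ge> N\<close> the exponent \<open>ps\<close> is arbitrary, but the conditions on \<open>b 2\<close> and \<open>b' 1\<close> force \<open>p < ps\<close> and \<open>q < qs\<close>\<close>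
  have b0: "0 \<le> b 2" "0 \<le> b' 1" using b_nonneg by auto
  have "0 < qs / ps * (ps - p)" "0 < ps / qs * (qs - q)" using b0 sub(2) sub'(1) by linarith+
  then have sup: "p < ps" "q < qs" using pos by (auto simp: zero_less_mult_iff zero_less_divide_iff)
  note N = critical_exponent_ratio(2)[OF ps p n sup(1)] critical_exponent_ratio(2)[OF qs q n sup(2)]
  have gap: "(ps - p) / ps = 1 - p / ps" "(qs - q) / qs = 1 - q / qs"
    using pos by (auto simp: diff_divide_distrib)
  have s: "b 2 / qs < 1 - p / ps" "b 6 / q < 1 - p / ps" "b' 1 / ps < 1 - q / qs" "b' 5 / p < 1 - q / qs"
    unfolding gap[symmetric] using sub(2,5) sub'(1,4) pos p q by (auto simp: field_simps)
  have g1: "AE x in lebesgue_on \<Omega>. A 4 * rpow (norm (Du x)) p - A 5 * rpow \<bar>u x\<bar> r\<^sub>1 - A 6 \<le> \<A>\<^sub>1 x (u x) (Du x) \<bullet> Du x"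
    using growth by eventually_elim blast
  have g2: "AE x in lebesgue_on \<Omega>. A' 4 * rpow (norm (Dv x)) q - A' 5 * rpow \<bar>v x\<bar> r\<^sub>2 - A' 6 \<le> \<A>\<^sub>2 x (v x) (Dv x) \<bullet> Dv x"
    using growth by eventually_elim blast
  have g3: "AE x in lebesgue_on \<Omega>. \<bar>\<B>\<^sub>1 x (u x) (v x) (Du x) (Dv x)\<bar> \<le>
      B 1 * rpow \<bar>u x\<bar> (b 1) + B 2 * rpow \<bar>v x\<bar> (b 2) + B 3 * rpow \<bar>u x\<bar> (b 3) * rpow \<bar>v x\<bar> (b 4)
      + B 4 * rpow (norm (Du x)) (b 5) + B 5 * rpow (norm (Dv x)) (b 6)
      + B 6 * rpow (norm (Du x)) (b 7) * rpow (norm (Dv x)) (b 8) + B 7"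
    using growth by eventually_elim blast
  have g4: "AE x in lebesgue_on \<Omega>. \<bar>\<B>\<^sub>2 x (u x) (v x) (Du x) (Dv x)\<bar> \<le>
      B' 2 * rpow \<bar>v x\<bar> (b' 2) + B' 1 * rpow \<bar>u x\<bar> (b' 1) + B' 3 * rpow \<bar>v x\<bar> (b' 4) * rpow \<bar>u x\<bar> (b' 3)
      + B' 5 * rpow (norm (Dv x)) (b' 6) + B' 4 * rpow (norm (Du x)) (b' 5)
      + B' 6 * rpow (norm (Dv x)) (b' 8) * rpow (norm (Du x)) (b' 7) + B' 7"
    using growth
  proof eventually_elim
    case (elim x)
    then have "\<bar>\<B>\<^sub>2 x (u x) (v x) (Du x) (Dv x)\<bar> \<le>
      B' 1 * rpow \<bar>u x\<bar> (b' 1) + B' 2 * rpow \<bar>v x\<bar> (b' 2) + B' 3 * rpow \<bar>u x\<bar> (b' 3) * rpow \<bar>v x\<bar> (b' 4)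
      + B' 4 * rpow (norm (Du x)) (b' 5) + B' 5 * rpow (norm (Dv x)) (b' 6)
      + B' 6 * rpow (norm (Du x)) (b' 7) * rpow (norm (Dv x)) (b' 8) + B' 7" by blast
    then show ?case by (simp add: mult_ac)
  qed
  have "\<exists>K. AE x in lebesgue_on \<Omega>. \<bar>u x\<bar> \<le> K"
  proof (rule system_component_bounded[where a="\<lambda>x. \<A>\<^sub>1 x (u x) (Du x)"
        and b="\<lambda>x. \<B>\<^sub>1 x (u x) (v x) (Du x) (Dv x)", OF \<Omega> p sup(1) q sup(2) W V N _ A4(1) _ _ r(1,3) _ _ _ _ _ _ _
        _ _ _ _ _ _ _ _ sub(1) s(1) sub(3)[unfolded gap] sub(4) s(2) sub(6)[unfolded gap] g1 g3])
    fix \<phi> \<gamma> assume "W0 \<Omega> p \<phi> \<gamma>"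
    then show "integrable (lebesgue_on \<Omega>) (\<lambda>x. \<A>\<^sub>1 x (u x) (Du x) \<bullet> \<gamma> x) \<and>
        integrable (lebesgue_on \<Omega>) (\<lambda>x. \<B>\<^sub>1 x (u x) (v x) (Du x) (Dv x) * \<phi> x) \<and>
        (LINT x|lebesgue_on \<Omega>. \<A>\<^sub>1 x (u x) (Du x) \<bullet> \<gamma> x) =
          (LINT x|lebesgue_on \<Omega>. \<B>\<^sub>1 x (u x) (v x) (Du x) (Dv x) * \<phi> x)"
      by (rule weak_identity_W0[OF \<Omega> p]) (use sys v0 in blast)
  qed (use A_nonneg B_nonneg b_nonneg in auto)
  moreover have "\<exists>K. AE x in lebesgue_on \<Omega>. \<bar>v x\<bar> \<le> K"
  proof (rule system_component_bounded[where a="\<lambda>x. \<A>\<^sub>2 x (v x) (Dv x)"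
        and b="\<lambda>x. \<B>\<^sub>2 x (u x) (v x) (Du x) (Dv x)", OF \<Omega> q sup(2) p sup(1) V W N(2,1) _ A4(2) _ _ r(2,4) _ _ _ _ _ _ _
        _ _ _ _ _ _ _ _ sub'(2) s(3) _ sub'(5) s(4) _ g2 g4])
    fix \<phi> \<gamma> assume "W0 \<Omega> q \<phi> \<gamma>"
    then show "integrable (lebesgue_on \<Omega>) (\<lambda>x. \<A>\<^sub>2 x (v x) (Dv x) \<bullet> \<gamma> x) \<and>
        integrable (lebesgue_on \<Omega>) (\<lambda>x. \<B>\<^sub>2 x (u x) (v x) (Du x) (Dv x) * \<phi> x) \<and>
        (LINT x|lebesgue_on \<Omega>. \<A>\<^sub>2 x (v x) (Dv x) \<bullet> \<gamma> x) =
          (LINT x|lebesgue_on \<Omega>. \<B>\<^sub>2 x (u x) (v x) (Du x) (Dv x) * \<phi> x)"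
      by (rule weak_identity_W0[OF \<Omega> q]) (use sys u0 in blast)
  next
    show "b' 4 / qs + b' 3 / ps < 1 - q / qs" using sub'(3) unfolding gap by linarith
    show "b' 8 / q + b' 7 / p < 1 - q / qs" using sub'(6) unfolding gap by linarith
  qed (use A_nonneg B_nonneg b_nonneg in auto)
  ultimately show ?thesis
    using bounded_imp_Linfty_closure[OF \<Omega>(1) u0] bounded_imp_Linfty_closure[OF \<Omega>(1) v0] by blast
qed

end
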